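(* Let $(T_1,T_2,T)$ be a pure $\mathbb E$-contraction on a Hilbert space $\mathcal H$ and let the fundamental operators $A_{1*},A_{2*}$ of $(T_1^*,T_2^*,T^* )$ be commuting operators satisfying $[A_{1*}^*,A_{1*}]=[A_{2*}^*,A_{2*}]$. Consider the operators $Q_1,Q_2,V$ on $\mathcal K=H^2(\mathbb D)\otimes\mathcal D_{T^*}$ defined by $$Q_1=I\otimes A_{1*}^*+M_z\otimes A_{2*},\quad Q_2=I\otimes A_{2*}^*+M_z\otimes A_{1*},\quad V=M_z\otimes I.$$ Then $(Q_1,Q_2,V)$ is a minimal pure $\mathbb E$-isometric dilation of $(T_1,T_2,T)$.
   Context: The tetrablock is $\mathbb E=\{(x_1,x_2,x_3)\in\mathbb C^3: 1-zx_1-wx_2+zwx_3\ne0 \text{ whenever } |z|\le1,|w|\le1\}$, with distinguished boundary $b\mathbb E=\{(x_1,x_2,x_3)\in\overline{\mathbb E}:|x_3|=1\}$. A commuting triple $(T_1,T_2,T_3)$ of bounded Hilbert space operators is an $\mathbb E$-contraction if its Taylor joint spectrum lies in $\overline{\mathbb E}$ and $\|p(T_1,T_2,T_3)\|\le\sup_{\overline{\mathbb E}}|p|$ for every polynomial $p$ in three variables; the adjoint triple is then also an $\mathbb E$-contraction. It is pure if $(T_3^* )^n\to0$ strongly. A commuting triple is an $\mathbb E$-unitary if its entries are normal and its joint spectrum lies in $b\mathbb E$; an $\mathbb E$-isometry if it is the restriction of an $\mathbb E$-unitary to a common invariant subspace. An $\mathbb E$-isometry is pure if its third entry is a pure isometry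 (unitarily equivalent to a unilateral shift of some multiplicity). For a contraction $T$, $D_T=(I-T^*T)^{1/2}$, $\mathcal D_T=\overline{\mathrm{Ran}}\,D_T$. The fundamental operators of an $\mathbb E$-contraction $(S_1,S_2,S_3)$ are the unique bounded operators $A_1,A_2$ on $\mathcal D_{S_3}$ with $S_1-S_2^*S_3=D_{S_3}A_1D_{S_3}$ and $S_2-S_1^*S_3=D_{S_3}A_2D_{S_3}$ (they are known to exist). An $\mathbb E$-isometric dilation of $(T_1,T_2,T)$ on $\mathcal H$ is an $\mathbb E$-isometry $(Q_1,Q_2,V)$ on a Hilbert space $\mathcal K\supseteq\mathcal H$ such that $P_{\mathcal H}(Q_1^{m_1}Q_2^{m_2}V^n)|_{\mathcal H}=T_1^{m_1}T_2^{m_2}T^n$ for all integers $m_1,m_2,n\ge0$, where $P_{\mathcal H}$ is the orthogonal projection onto $\mathcal H$; here $\mathcal H$ is regarded as a subspace of $\mathcal K$ via some isometric embedding $\mathcal H\to\mathcal K$. The dilation is minimal if $\mathcal K=\overline{\mathrm{span}}\{Q_1^{m_1}Q_2^{m_2}V^nh: h\in\mathcal H,\ m_1,m_2,n\ge0\}$. $H^2(\mathbb D)$ is the Hardy space of the unit disc, $M_z$ is multiplication by $z$ on it, and $[S_1,S_2]=S_1S_2-S_2S_1$. *)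

theory Defs
  imports "HOL-Complex_Analysis.Complex_Analysis"
begin

section \<open>Complex Hilbert spaces\<close>

text \<open>The inner product is linear in the first and conjugate linear in the second argument.\<close>

class chilbert_space = banach +
  fixes scaleC :: "complex \<Rightarrow> 'a \<Rightarrow> 'a" (infixr "*\<^sub>C" 75)
    and cinner :: "'a \<Rightarrow> 'a \<Rightarrow> complex"
  assumes scaleC_add_right: "c *\<^sub>C (x + y) = c *\<^sub>C x + c *\<^sub>C y"
    and scaleC_add_left: "(c + d) *\<^sub>C x = c *\<^sub>C x + d *\<^sub>C x"
    and scaleC_scaleC: "c *\<^sub>C (d *\<^sub>C x) = (c * d) *\<^sub>C x"
    and scaleR_scaleC: "r *\<^sub>R x = complex_of_real r *\<^sub>C x"
    and cinner_commute: "cinner x y = cnj (cinner y x)"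
    and cinner_add_left: "cinner (x + y) z = cinner x z + cinner y z"
    and cinner_scaleC_left: "cinner (c *\<^sub>C x) y = c * cinner x y"
    and cinner_self: "cinner x x = complex_of_real ((norm x)\<^sup>2)"

lemma scaleC_one [simp]: "1 *\<^sub>C (x::'a::chilbert_space) = x"
  using scaleR_scaleC[of 1 x] by simp

global_interpretation complex_vector: vector_space "scaleC :: complex \<Rightarrow> 'a \<Rightarrow> 'a::chilbert_space"
  defines csubspace = complex_vector.subspace and cspan = complex_vector.span
  by unfold_locales (simp_all add: scaleC_add_right scaleC_add_left scaleC_scaleC)

lemma cinner_add_right: "cinner x (y + z) = cinner x y + cinner x (z::'a::chilbert_space)"
  by (subst (1 2 3) cinner_commute) (simp add: cinner_add_left)

lemma cinner_scaleC_right: "cinner x (c *\<^sub>C y) = cnj c * cinner x (y::'a::chilbert_space)"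
  by (subst (1 2) cinner_commute) (simp add: cinner_scaleC_left)

lemma norm_scaleC: "norm (c *\<^sub>C (x::'a::chilbert_space)) = cmod c * norm x"
proof -
  have "complex_of_real ((norm (c *\<^sub>C x))\<^sup>2) = c * cnj c * complex_of_real ((norm x)\<^sup>2)"
    by (metis cinner_self cinner_scaleC_left cinner_scaleC_right mult.assoc)
  also have "\<dots> = complex_of_real ((cmod c * norm x)\<^sup>2)"
    by (simp only: complex_norm_square power_mult_distrib of_real_mult)
  finally have "(norm (c *\<^sub>C x))\<^sup>2 = (cmod c * norm x)\<^sup>2"
    using of_real_eq_iff by blast
  then show ?thesis by simp
qed

lemma Re_cinner_le: "Re (cinner x y) \<le> norm x * norm (y::'a::chilbert_space)"
proof -
  have "complex_of_real ((norm (x + y))\<^sup>2) =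
      cinner x x + cinner y y + (cinner x y + cnj (cinner x y))"
    unfolding cinner_self[symmetric]
    by (simp add: cinner_add_left cinner_add_right cinner_commute[of y x])
  then have "(norm (x + y))\<^sup>2 = (norm x)\<^sup>2 + (norm y)\<^sup>2 + 2 * Re (cinner x y)"
    by (simp add: complex_eq_iff cinner_self)
  moreover have "(norm (x + y))\<^sup>2 \<le> (norm x + norm y)\<^sup>2"
    by (simp add: norm_triangle_ineq power_mono)
  ultimately show ?thesis by (simp add: power2_sum)
qed

lemma norm_cinner_le: "cmod (cinner x y) \<le> norm x * norm (y::'a::chilbert_space)"
proof (cases "cinner x y = 0")
  case False
  define u where "u = cnj (cinner x y) / complex_of_real (cmod (cinner x y))"
  have u: "cmod u = 1" using False by (simp add: u_def norm_divide)
  have "u * cinner x y = complex_of_real (cmod (cinner x y))"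
    using False complex_norm_square[of "cinner x y"]
    by (simp add: u_def power2_eq_square field_simps)
  then have "cmod (cinner x y) = Re (cinner (u *\<^sub>C x) y)"
    by (simp add: cinner_scaleC_left)
  also have "\<dots> \<le> norm (u *\<^sub>C x) * norm y" by (rule Re_cinner_le)
  finally show ?thesis by (simp add: norm_scaleC u)
qed simp

instantiation complex :: chilbert_space
begin
definition scaleC_complex :: "complex \<Rightarrow> complex \<Rightarrow> complex" where "scaleC_complex c x = c * x"
definition cinner_complex :: "complex \<Rightarrow> complex \<Rightarrow> complex" where "cinner_complex x y = x * cnj y"
instance
proof
  fix x :: complex
  show "cinner x x = complex_of_real ((norm x)\<^sup>2)"
    unfolding cinner_complex_def by (rule complex_norm_square[symmetric])
qed (simp_all add: scaleC_complex_def cinner_complex_def algebra_simps scaleR_conv_of_real)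
end

section \<open>The Hilbert space of square-summable sequences\<close>

typedef (overloaded) 'a seq2 =
  "{f :: nat \<Rightarrow> 'a::chilbert_space. summable (\<lambda>n. (norm (f n))\<^sup>2)}"
  morphisms entry Abs_seq2
  by (rule exI[of _ "\<lambda>_. 0"]) simp

setup_lifting type_definition_seq2

lemma summable_entry: "summable (\<lambda>n. (norm (entry f n))\<^sup>2)"
  using entry[of f] by simp

lemma norm2_add_le: "(norm (x + y))\<^sup>2 \<le> 2 * (norm x)\<^sup>2 + 2 * (norm (y::'a::real_normed_vector))\<^sup>2"
proof -
  have "(norm (x + y))\<^sup>2 \<le> (norm x + norm y)\<^sup>2"
    by (simp add: norm_triangle_ineq power_mono)
  also have "\<dots> \<le> 2 * (norm x)\<^sup>2 + 2 * (norm y)\<^sup>2"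
    using sum_squares_bound[of "norm x" "norm y"] by (simp add: power2_sum)
  finally show ?thesis .
qed

lemma summable_norm2_add:
  fixes f g :: "nat \<Rightarrow> 'a::real_normed_vector"
  assumes "summable (\<lambda>n. (norm (f n))\<^sup>2)" "summable (\<lambda>n. (norm (g n))\<^sup>2)"
  shows "summable (\<lambda>n. (norm (f n + g n))\<^sup>2)"
  by (rule summable_comparison_test'[where N=0 and g="\<lambda>n. 2 * (norm (f n))\<^sup>2 + 2 * (norm (g n))\<^sup>2"])
    (auto intro!: summable_add summable_mult assms norm2_add_le)

instantiation seq2 :: (chilbert_space) ab_group_add
begin
lift_definition zero_seq2 :: "'a seq2" is "\<lambda>_. 0" by simp
lift_definition plus_seq2 :: "'a seq2 \<Rightarrow> 'a seq2 \<Rightarrow> 'a seq2" is "\<lambda>f g n. f n + g n"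
  by (rule summable_norm2_add)
lift_definition uminus_seq2 :: "'a seq2 \<Rightarrow> 'a seq2" is "\<lambda>f n. - f n" by simp
lift_definition minus_seq2 :: "'a seq2 \<Rightarrow> 'a seq2 \<Rightarrow> 'a seq2" is "\<lambda>f g n. f n - g n"
proof -
  fix f g :: "nat \<Rightarrow> 'a"
  assume "summable (\<lambda>n. (norm (f n))\<^sup>2)" "summable (\<lambda>n. (norm (g n))\<^sup>2)"
  then show "summable (\<lambda>n. (norm (f n - g n))\<^sup>2)"
    using summable_norm2_add[of f "\<lambda>n. - g n"] by simp
qed
instance
  by standard
    (simp_all add: entry_inject[symmetric] zero_seq2.rep_eq plus_seq2.rep_eq uminus_seq2.rep_eq
      minus_seq2.rep_eq fun_eq_iff algebra_simps)
end

lemma summable_cinner: "summable (\<lambda>n. cinner (entry f n) (entry g n))"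
proof (rule summable_comparison_test'[where N=0 and
      g="\<lambda>n. (norm (entry f n))\<^sup>2 + (norm (entry g n))\<^sup>2"])
  show "summable (\<lambda>n. (norm (entry f n))\<^sup>2 + (norm (entry g n))\<^sup>2)"
    by (intro summable_add summable_entry)
  show "cmod (cinner (entry f n) (entry g n)) \<le> (norm (entry f n))\<^sup>2 + (norm (entry g n))\<^sup>2" for n
    using norm_cinner_le[of "entry f n" "entry g n"]
      sum_squares_bound[of "norm (entry f n)" "norm (entry g n)"]
      mult_nonneg_nonneg[OF norm_ge_zero[of "entry f n"] norm_ge_zero[of "entry g n"]]
    by linarith
qed

instantiation seq2 :: (chilbert_space) real_vector
begin
lift_definition scaleR_seq2 :: "real \<Rightarrow> 'a seq2 \<Rightarrow> 'a seq2" is "\<lambda>r f n. r *\<^sub>R f n"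
  by (simp add: power_mult_distrib summable_mult)
instance
  by standard
    (simp_all add: entry_inject[symmetric] plus_seq2.rep_eq scaleR_seq2.rep_eq fun_eq_iff
      algebra_simps)
end

instantiation seq2 :: (chilbert_space) real_normed_vector
begin
definition norm_seq2 :: "'a seq2 \<Rightarrow> real"
  where "norm_seq2 f = sqrt (\<Sum>n. (norm (entry f n))\<^sup>2)"
definition dist_seq2 :: "'a seq2 \<Rightarrow> 'a seq2 \<Rightarrow> real" where "dist_seq2 f g = norm (f - g)"
definition sgn_seq2 :: "'a seq2 \<Rightarrow> 'a seq2" where "sgn_seq2 f = f /\<^sub>R norm f"
definition [code del]: "(uniformity :: ('a seq2 \<times> 'a seq2) filter) =
    (INF e\<in>{0 <..}. principal {(x, y). dist x y < e})"
definition open_seq2 :: "'a seq2 set \<Rightarrow> bool" where [code del]: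
  "open_seq2 U \<longleftrightarrow> (\<forall>x\<in>U. eventually (\<lambda>(x', y). x' = x \<longrightarrow> y \<in> U) uniformity)"

lemma norm_seq2_sq: "(norm (f :: 'a seq2))\<^sup>2 = (\<Sum>n. (norm (entry f n))\<^sup>2)"
  by (simp add: norm_seq2_def suminf_nonneg summable_entry)

lemma L2_set_le_norm: "L2_set (\<lambda>n. norm (entry f n)) {..<N} \<le> norm (f :: 'a seq2)"
  unfolding L2_set_def norm_seq2_def
  by (auto intro!: real_sqrt_le_mono sum_le_suminf summable_entry)

lemma norm_seq2_le:
  assumes "\<And>N. L2_set (\<lambda>n. norm (entry f n)) {..<N} \<le> B"
  shows "norm (f :: 'a seq2) \<le> B"
proof -
  have "(\<lambda>N. L2_set (\<lambda>n. norm (entry f n)) {..<N}) \<longlonglongrightarrow> norm f"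
    unfolding L2_set_def norm_seq2_def
    by (intro tendsto_intros summable_LIMSEQ summable_entry)
  then show ?thesis by (rule LIMSEQ_le_const2) (use assms in blast)
qed

instance
proof
  fix x y :: "'a seq2" and a :: real
  show "norm x = 0 \<longleftrightarrow> x = 0"
  proof
    assume "norm x = 0"
    then have "(\<Sum>n. (norm (entry x n))\<^sup>2) = 0" using norm_seq2_sq[of x] by simp
    then have "\<forall>n. entry x n = 0"
      using suminf_eq_zero_iff[OF summable_entry[of x]] by simp
    then show "x = 0" by transfer auto
  qed (simp add: norm_seq2_def zero_seq2.rep_eq)
  show "norm (x + y) \<le> norm x + norm y"
  proof (rule norm_seq2_le)
    fix N
    have "L2_set (\<lambda>n. norm (entry (x + y) n)) {..<N}
        \<le> L2_set (\<lambda>n. norm (entry x n) + norm (entry y n)) {..<N}"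
      by (rule L2_set_mono) (auto simp: plus_seq2.rep_eq norm_triangle_ineq)
    also have "\<dots> \<le> L2_set (\<lambda>n. norm (entry x n)) {..<N} + L2_set (\<lambda>n. norm (entry y n)) {..<N}"
      by (rule L2_set_triangle_ineq)
    also have "\<dots> \<le> norm x + norm y" by (intro add_mono L2_set_le_norm)
    finally show "L2_set (\<lambda>n. norm (entry (x + y) n)) {..<N} \<le> norm x + norm y" .
  qed
  show "norm (a *\<^sub>R x) = \<bar>a\<bar> * norm x"
    by (simp add: norm_seq2_def scaleR_seq2.rep_eq power_mult_distrib suminf_mult
        summable_entry real_sqrt_mult)
qed (simp_all add: dist_seq2_def sgn_seq2_def uniformity_seq2_def open_seq2_def)

end

lemma norm_entry_le: "norm (entry f n) \<le> norm f"
proof -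
  have "norm (entry f n) = L2_set (\<lambda>n. norm (entry f n)) {n}" by simp
  also have "\<dots> \<le> L2_set (\<lambda>n. norm (entry f n)) {..<Suc n}"
    unfolding L2_set_def by (intro real_sqrt_le_mono sum_mono2) auto
  also have "\<dots> \<le> norm f" by (rule L2_set_le_norm)
  finally show ?thesis .
qed

instance seq2 :: (chilbert_space) banach
proof
  fix X :: "nat \<Rightarrow> 'a seq2"
  assume C: "Cauchy X"
  have "Cauchy (\<lambda>k. entry (X k) n)" for n
  proof (rule CauchyI)
    fix e :: real assume "e > 0"
    then obtain M where M: "\<forall>k\<ge>M. \<forall>l\<ge>M. norm (X k - X l) < e"
      using CauchyD[OF C] by blast
    show "\<exists>M. \<forall>k\<ge>M. \<forall>l\<ge>M. norm (entry (X k) n - entry (X l) n) < e"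
      using M norm_entry_le[of "X _ - X _" n] by (metis le_less_trans minus_seq2.rep_eq)
  qed
  then have "\<forall>n. \<exists>l. (\<lambda>k. entry (X k) n) \<longlonglongrightarrow> l"
    by (simp add: Cauchy_convergent convergent_def[symmetric])
  then obtain l where l: "\<And>n. (\<lambda>k. entry (X k) n) \<longlonglongrightarrow> l n" by metis
  have bd: "L2_set (\<lambda>n. norm (l n - entry (X m) n)) {..<N} \<le> e"
    if M: "\<forall>k\<ge>M. \<forall>l\<ge>M. norm (X k - X l) < e" and m: "m \<ge> M" for e M m N
  proof (rule LIMSEQ_le_const2)
    show "(\<lambda>k. L2_set (\<lambda>n. norm (entry (X k) n - entry (X m) n)) {..<N})
        \<longlonglongrightarrow> L2_set (\<lambda>n. norm (l n - entry (X m) n)) {..<N}"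
      unfolding L2_set_def by (intro tendsto_intros l)
    show "\<exists>K. \<forall>k\<ge>K. L2_set (\<lambda>n. norm (entry (X k) n - entry (X m) n)) {..<N} \<le> e"
    proof (intro exI allI impI)
      fix k assume "k \<ge> M"
      then have "norm (X k - X m) < e" using M m by blast
      then show "L2_set (\<lambda>n. norm (entry (X k) n - entry (X m) n)) {..<N} \<le> e"
        using L2_set_le_norm[of "X k - X m" N] by (simp add: minus_seq2.rep_eq)
    qed
  qed
  have sm: "summable (\<lambda>n. (norm (l n - entry (X m) n))\<^sup>2)"
    if M: "\<forall>k\<ge>M. \<forall>l\<ge>M. norm (X k - X l) < e" and m: "m \<ge> M" for e M m
  proof (rule bounded_imp_summable)
    show "(\<Sum>n\<le>N. (norm (l n - entry (X m) n))\<^sup>2) \<le> e\<^sup>2" for N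
    proof -
      have "sqrt (\<Sum>n\<le>N. (norm (l n - entry (X m) n))\<^sup>2) \<le> e"
        using bd[OF M m, of "Suc N"] by (simp add: L2_set_def lessThan_Suc_atMost)
      then show ?thesis by (rule sqrt_le_D)
    qed
  qed simp
  obtain M1 where M1: "\<forall>k\<ge>M1. \<forall>l\<ge>M1. norm (X k - X l) < 1"
    using CauchyD[OF C, of 1] by auto
  have "summable (\<lambda>n. (norm (l n))\<^sup>2)"
    using summable_norm2_add[OF sm[OF M1 order_refl] summable_entry[of "X M1"]] by simp
  then have eL: "entry (Abs_seq2 l) = l" by (simp add: Abs_seq2_inverse)
  have "X \<longlonglongrightarrow> Abs_seq2 l"
  proof (rule LIMSEQ_I)
    fix e :: real assume e: "e > 0"
    then obtain M where M: "\<forall>k\<ge>M. \<forall>l\<ge>M. norm (X k - X l) < e/2"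
      using CauchyD[OF C, of "e/2"] by auto
    have "norm (X m - Abs_seq2 l) < e" if "m \<ge> M" for m
    proof -
      have "norm (Abs_seq2 l - X m) \<le> e/2"
        by (rule norm_seq2_le) (unfold minus_seq2.rep_eq eL, rule bd[OF M that])
      then show ?thesis using e by (simp add: norm_minus_commute)
    qed
    then show "\<exists>M. \<forall>m\<ge>M. norm (X m - Abs_seq2 l) < e" by blast
  qed
  then show "convergent X" by (rule convergentI)
qed

instantiation seq2 :: (chilbert_space) chilbert_space
begin
lift_definition scaleC_seq2 :: "complex \<Rightarrow> 'a seq2 \<Rightarrow> 'a seq2" is "\<lambda>c f n. c *\<^sub>C f n"
  by (simp add: power_mult_distrib summable_mult norm_scaleC)
definition cinner_seq2 :: "'a seq2 \<Rightarrow> 'a seq2 \<Rightarrow> complex"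
  where "cinner_seq2 f g = (\<Sum>n. cinner (entry f n) (entry g n))"
instance
proof
  fix x y z :: "'a seq2" and c d :: complex and r :: real
  show "c *\<^sub>C (x + y) = c *\<^sub>C x + c *\<^sub>C y" by transfer (simp add: scaleC_add_right)
  show "(c + d) *\<^sub>C x = c *\<^sub>C x + d *\<^sub>C x" by transfer (simp add: scaleC_add_left)
  show "c *\<^sub>C (d *\<^sub>C x) = (c * d) *\<^sub>C x" by transfer (simp add: scaleC_scaleC)
  show "r *\<^sub>R x = complex_of_real r *\<^sub>C x" by transfer (simp add: scaleR_scaleC)
  show "cinner x y = cnj (cinner y x)"
    unfolding cinner_seq2_def
  proof (rule sums_unique[symmetric])
    have "(\<lambda>n. cnj (cinner (entry y n) (entry x n))) sums
        cnj (\<Sum>n. cinner (entry y n) (entry x n))"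
      by (subst sums_cnj) (rule summable_sums[OF summable_cinner])
    moreover have "(\<lambda>n. cnj (cinner (entry y n) (entry x n))) =
        (\<lambda>n. cinner (entry x n) (entry y n))"
      by (rule ext) (rule cinner_commute[symmetric])
    ultimately show "(\<lambda>n. cinner (entry x n) (entry y n)) sums
        cnj (\<Sum>n. cinner (entry y n) (entry x n))" by simp
  qed
  show "cinner (x + y) z = cinner x z + cinner y z"
    by (simp add: cinner_seq2_def plus_seq2.rep_eq cinner_add_left suminf_add summable_cinner)
  show "cinner (c *\<^sub>C x) y = c * cinner x y"
    by (simp add: cinner_seq2_def scaleC_seq2.rep_eq cinner_scaleC_left suminf_mult summable_cinner)
  show "cinner x x = complex_of_real ((norm x)\<^sup>2)"
    unfolding norm_seq2_sq cinner_seq2_def cinner_self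
    by (rule suminf_of_real[OF summable_entry, symmetric])
qed
end

text \<open>The unilateral shift.\<close>

lift_definition shift :: "'a::chilbert_space seq2 \<Rightarrow> 'a seq2"
  is "\<lambda>f n. case n of 0 \<Rightarrow> 0 | Suc m \<Rightarrow> f m"
  subgoal for f by (subst summable_Suc_iff[symmetric]) simp
  done

section \<open>The Hardy space of the unit disc\<close>

definition taylor_coeff :: "(complex \<Rightarrow> complex) \<Rightarrow> nat \<Rightarrow> complex"
  where "taylor_coeff f n = (deriv ^^ n) f 0 / fact n"

text \<open>Holomorphic functions on the open unit disc with square-summable Taylor coefficients.
  They are extended by zero outside the disc, so that equality of elements is equality
  on the disc.\<close>

typedef hardy = "{f :: complex \<Rightarrow> complex. f holomorphic_on ball 0 1 \<and>
    (\<forall>z. z \<notin> ball 0 1 \<longrightarrow> f z = 0) \<and> summable (\<lambda>n. (cmod (taylor_coeff f n))\<^sup>2)}"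
  morphisms hfun Abs_hardy
proof (rule exI[of _ "\<lambda>_. 0"])
  have "(deriv ^^ n) (\<lambda>_. 0) 0 = (0::complex)" for n by (induction n) auto
  then show "(\<lambda>_. 0) \<in> {f :: complex \<Rightarrow> complex. f holomorphic_on ball 0 1 \<and>
    (\<forall>z. z \<notin> ball 0 1 \<longrightarrow> f z = 0) \<and> summable (\<lambda>n. (cmod (taylor_coeff f n))\<^sup>2)}"
    by (simp add: taylor_coeff_def)
qed

setup_lifting type_definition_hardy

lemma hardy_sums:
  assumes "f holomorphic_on ball 0 1" "z \<in> ball 0 1"
  shows "(\<lambda>n. taylor_coeff f n * z ^ n) sums f z"
  using holomorphic_power_series[OF assms] by (simp add: taylor_coeff_def)

lemma taylor_coeff_unique:
  assumes "\<And>z. z \<in> ball 0 1 \<Longrightarrow> (\<lambda>n. a n * z ^ n) sums f z"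
  shows "taylor_coeff f n = a n"
proof -
  have "f has_fps_expansion Abs_fps a"
  proof (rule has_fps_expansionI)
    have "eventually (\<lambda>z. z \<in> ball 0 1) (nhds (0::complex))"
      by (rule eventually_nhds_in_open) auto
    then show "eventually (\<lambda>u. (\<lambda>n. fps_nth (Abs_fps a) n * u ^ n) sums f u) (nhds 0)"
      by eventually_elim (simp add: assms)
  qed
  from fps_nth_fps_expansion[OF this, of n] show ?thesis
    by (simp add: taylor_coeff_def)
qed

lemma hardy_of_coeffs:
  assumes "\<And>z. z \<in> ball 0 1 \<Longrightarrow> (\<lambda>n. a n * z ^ n) sums f z"
    and "\<And>z. z \<notin> ball 0 1 \<Longrightarrow> f z = 0" and "summable (\<lambda>n. (cmod (a n))\<^sup>2)"
  shows "f \<in> {f. f holomorphic_on ball 0 1 \<and>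
    (\<forall>z. z \<notin> ball 0 1 \<longrightarrow> f z = 0) \<and> summable (\<lambda>n. (cmod (taylor_coeff f n))\<^sup>2)}"
proof -
  have "f holomorphic_on ball 0 1"
    using power_series_holomorphic[of 0 1 a f] assms(1) by simp
  then show ?thesis using taylor_coeff_unique[OF assms(1)] assms by simp
qed

lemma hfun_sums: "z \<in> ball 0 1 \<Longrightarrow> (\<lambda>n. taylor_coeff (hfun f) n * z ^ n) sums hfun f z"
  using hfun[of f] by (auto intro: hardy_sums)

lemma hfun_outside: "z \<notin> ball 0 1 \<Longrightarrow> hfun f z = 0"
  using hfun[of f] by auto

lift_definition hcoeffs :: "hardy \<Rightarrow> complex seq2" is taylor_coeff by simp

lemma hcoeffs_inject: "hcoeffs f = hcoeffs g \<longleftrightarrow> f = g"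
proof
  assume "hcoeffs f = hcoeffs g"
  then have *: "taylor_coeff (hfun f) = taylor_coeff (hfun g)" by (metis hcoeffs.rep_eq)
  have "hfun f z = hfun g z" for z
  proof (cases "z \<in> ball 0 1")
    case True
    then show ?thesis using hfun_sums[OF True, of f] hfun_sums[OF True, of g] *
      by (metis sums_unique2)
  qed (simp add: hfun_outside)
  then show "f = g" by (simp add: hfun_inject[symmetric] fun_eq_iff)
qed simp

lemma seq2_power_series:
  assumes z: "z \<in> ball 0 1"
  shows "summable (\<lambda>n. entry (a :: complex seq2) n * z ^ n)"
proof (rule summable_comparison_test'[where N=0 and g="\<lambda>n. norm a * cmod z ^ n"])
  show "summable (\<lambda>n. norm a * cmod z ^ n)"
    using z by (intro summable_mult summable_geometric) auto
  show "norm (entry a n * z ^ n) \<le> norm a * cmod z ^ n" for n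
    by (simp add: norm_mult norm_power mult_right_mono norm_entry_le)
qed

lemma hcoeffs_surj: "\<exists>f. hcoeffs f = a"
proof -
  define g where "g z = (if z \<in> ball 0 1 then \<Sum>n. entry a n * z ^ n else 0)" for z
  have s: "(\<lambda>n. entry a n * z ^ n) sums g z" if "z \<in> ball 0 1" for z
    using summable_sums[OF seq2_power_series[OF that, of a]] that by (simp add: g_def)
  have "hfun (Abs_hardy g) = g"
    by (intro Abs_hardy_inverse hardy_of_coeffs[OF s] summable_entry)
      (auto simp: g_def)
  then have "entry (hcoeffs (Abs_hardy g)) = entry a"
    by (intro ext) (simp only: hcoeffs.rep_eq taylor_coeff_unique[OF s])
  then show ?thesis by (metis entry_inject)
qed

lemma hfun_lincomb:
  "(\<lambda>z. c * hfun f z + d * hfun g z) \<in> {f. f holomorphic_on ball 0 1 \<and>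
    (\<forall>z. z \<notin> ball 0 1 \<longrightarrow> f z = 0) \<and> summable (\<lambda>n. (cmod (taylor_coeff f n))\<^sup>2)}"
  (is "?h \<in> _") and taylor_coeff_lincomb:
  "taylor_coeff (\<lambda>z. c * hfun f z + d * hfun g z) n
    = entry (c *\<^sub>C hcoeffs f + d *\<^sub>C hcoeffs g) n"
proof -
  have s: "(\<lambda>n. entry (c *\<^sub>C hcoeffs f + d *\<^sub>C hcoeffs g) n * z ^ n) sums ?h z"
    if "z \<in> ball 0 1" for z
    using sums_add[OF sums_mult[OF hfun_sums[OF that, of f], of c]
        sums_mult[OF hfun_sums[OF that, of g], of d]]
    by (simp add: plus_seq2.rep_eq scaleC_seq2.rep_eq hcoeffs.rep_eq scaleC_complex_def algebra_simps)
  show "?h \<in> {f. f holomorphic_on ball 0 1 \<and>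
    (\<forall>z. z \<notin> ball 0 1 \<longrightarrow> f z = 0) \<and> summable (\<lambda>n. (cmod (taylor_coeff f n))\<^sup>2)}"
    by (rule hardy_of_coeffs[OF s]) (auto simp: hfun_outside summable_entry)
  show "taylor_coeff ?h n = entry (c *\<^sub>C hcoeffs f + d *\<^sub>C hcoeffs g) n"
    by (rule taylor_coeff_unique[OF s])
qed

instantiation hardy :: ab_group_add
begin
definition zero_hardy :: hardy where "0 = Abs_hardy (\<lambda>_. 0)"
definition plus_hardy :: "hardy \<Rightarrow> hardy \<Rightarrow> hardy" where "f + g = Abs_hardy (\<lambda>z. hfun f z + hfun g z)"
definition uminus_hardy :: "hardy \<Rightarrow> hardy" where "- f = Abs_hardy (\<lambda>z. - hfun f z)"
definition minus_hardy :: "hardy \<Rightarrow> hardy \<Rightarrow> hardy" where "f - g = Abs_hardy (\<lambda>z. hfun f z - hfun g z)"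

lemma hfun_zero: "hfun 0 = (\<lambda>_. 0)"
  and hfun_plus: "hfun (f + g) = (\<lambda>z. hfun f z + hfun g z)"
  and hfun_uminus: "hfun (- f) = (\<lambda>z. - hfun f z)"
  and hfun_minus: "hfun (f - g) = (\<lambda>z. hfun f z - hfun g z)"
  unfolding zero_hardy_def plus_hardy_def uminus_hardy_def minus_hardy_def
  using hfun_lincomb[of 0 f 0 g] hfun_lincomb[of 1 f 1 g] hfun_lincomb[of "-1" f 0 g]
    hfun_lincomb[of 1 f "-1" g]
  by (simp_all add: Abs_hardy_inverse)

instance
  by standard (simp_all add: hfun_inject[symmetric] hfun_zero hfun_plus hfun_uminus hfun_minus fun_eq_iff)
end

instantiation hardy :: real_vector
begin
definition scaleR_hardy :: "real \<Rightarrow> hardy \<Rightarrow> hardy"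
  where "scaleR_hardy r f = Abs_hardy (\<lambda>z. complex_of_real r * hfun f z)"

lemma hfun_scaleR: "hfun (r *\<^sub>R f) = (\<lambda>z. complex_of_real r * hfun f z)"
  unfolding scaleR_hardy_def using hfun_lincomb[of r f 0 f] by (simp add: Abs_hardy_inverse)

instance
  by standard (simp_all add: hfun_inject[symmetric] hfun_scaleR hfun_plus fun_eq_iff algebra_simps)
end

lemma hcoeffs_zero: "hcoeffs 0 = 0"
  using taylor_coeff_lincomb[of 0 0 0 0]
  by (simp add: entry_inject[symmetric] hcoeffs.rep_eq hfun_zero fun_eq_iff)

lemma hcoeffs_plus: "hcoeffs (f + g) = hcoeffs f + hcoeffs g"
  using taylor_coeff_lincomb[of 1 f 1 g]
  by (simp add: entry_inject[symmetric] hcoeffs.rep_eq hfun_plus fun_eq_iff)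

lemma hcoeffs_minus: "hcoeffs (f - g) = hcoeffs f - hcoeffs g"
  using hcoeffs_plus[of "f - g" g] by (simp add: algebra_simps)

lemma hcoeffs_scaleR: "hcoeffs (r *\<^sub>R f) = r *\<^sub>R hcoeffs f"
  using taylor_coeff_lincomb[of r f 0 f]
  by (simp add: entry_inject[symmetric] hcoeffs.rep_eq hfun_scaleR fun_eq_iff scaleR_scaleC)

instantiation hardy :: real_normed_vector
begin
definition norm_hardy :: "hardy \<Rightarrow> real"
  where "norm_hardy f = sqrt (\<Sum>n. (cmod (taylor_coeff (hfun f) n))\<^sup>2)"
definition dist_hardy :: "hardy \<Rightarrow> hardy \<Rightarrow> real" where "dist_hardy f g = norm (f - g)"
definition sgn_hardy :: "hardy \<Rightarrow> hardy" where "sgn_hardy f = f /\<^sub>R norm f"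
definition [code del]: "(uniformity :: (hardy \<times> hardy) filter) =
    (INF e\<in>{0 <..}. principal {(x, y). dist x y < e})"
definition open_hardy :: "hardy set \<Rightarrow> bool" where [code del]:
  "open_hardy U \<longleftrightarrow> (\<forall>x\<in>U. eventually (\<lambda>(x', y). x' = x \<longrightarrow> y \<in> U) uniformity)"

lemma norm_hcoeffs: "norm (hcoeffs f) = norm f"
  by (simp add: norm_hardy_def norm_seq2_def hcoeffs.rep_eq)

instance
proof
  fix x y :: hardy and a :: real
  show "norm x = 0 \<longleftrightarrow> x = 0"
    by (metis norm_hcoeffs hcoeffs_inject hcoeffs_zero norm_eq_zero)
  show "norm (x + y) \<le> norm x + norm y"
    by (metis norm_hcoeffs hcoeffs_plus norm_triangle_ineq)
  show "norm (a *\<^sub>R x) = \<bar>a\<bar> * norm x"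
    by (metis norm_hcoeffs hcoeffs_scaleR norm_scaleR)
qed (simp_all add: dist_hardy_def sgn_hardy_def uniformity_hardy_def open_hardy_def)
end

instance hardy :: banach
proof
  fix X :: "nat \<Rightarrow> hardy"
  assume "Cauchy X"
  then have "Cauchy (\<lambda>n. hcoeffs (X n))"
    by (simp add: Cauchy_def dist_norm hcoeffs_minus[symmetric] norm_hcoeffs)
  then obtain a where "(\<lambda>n. hcoeffs (X n)) \<longlonglongrightarrow> a"
    using Cauchy_convergent convergent_def by blast
  moreover obtain f where "hcoeffs f = a" using hcoeffs_surj by blast
  ultimately have "X \<longlonglongrightarrow> f"
    by (simp add: LIMSEQ_def dist_norm norm_hcoeffs[symmetric] hcoeffs_minus)
  then show "convergent X" by (rule convergentI)
qed

instantiation hardy :: chilbert_space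
begin
definition scaleC_hardy :: "complex \<Rightarrow> hardy \<Rightarrow> hardy"
  where "scaleC_hardy c f = Abs_hardy (\<lambda>z. c * hfun f z)"
definition cinner_hardy :: "hardy \<Rightarrow> hardy \<Rightarrow> complex"
  where "cinner_hardy f g = (\<Sum>n. taylor_coeff (hfun f) n * cnj (taylor_coeff (hfun g) n))"

lemma hfun_scaleC: "hfun (c *\<^sub>C f) = (\<lambda>z. c * hfun f z)"
  unfolding scaleC_hardy_def using hfun_lincomb[of c f 0 f] by (simp add: Abs_hardy_inverse)

lemma hcoeffs_scaleC: "hcoeffs (c *\<^sub>C f) = c *\<^sub>C hcoeffs f"
  using taylor_coeff_lincomb[of c f 0 f]
  by (simp add: entry_inject[symmetric] hcoeffs.rep_eq hfun_scaleC fun_eq_iff)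

lemma cinner_hcoeffs: "cinner f g = cinner (hcoeffs f) (hcoeffs g)"
  by (simp add: cinner_hardy_def cinner_seq2_def cinner_complex_def hcoeffs.rep_eq)

instance
  by standard
    (simp_all add: hcoeffs_inject[symmetric] hcoeffs_scaleR hcoeffs_plus hcoeffs_scaleC
      cinner_hcoeffs scaleC_add_right scaleC_add_left scaleC_scaleC scaleR_scaleC
      cinner_add_left cinner_scaleC_left cinner_self norm_hcoeffs cinner_commute[symmetric])
end

lift_definition mult_z :: "hardy \<Rightarrow> hardy" is "\<lambda>f z. z * f z"
proof -
  fix f :: "complex \<Rightarrow> complex"
  assume f: "f holomorphic_on ball 0 1 \<and> (\<forall>z. z \<notin> ball 0 1 \<longrightarrow> f z = 0) \<and>
    summable (\<lambda>n. (cmod (taylor_coeff f n))\<^sup>2)"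
  let ?a = "\<lambda>n. case n of 0 \<Rightarrow> 0 | Suc m \<Rightarrow> taylor_coeff f m"
  have s: "(\<lambda>n. ?a n * z ^ n) sums (z * f z)" if "z \<in> ball 0 1" for z
  proof -
    have "(\<lambda>n. ?a (Suc n) * z ^ Suc n) sums (z * f z)"
      using sums_mult[OF hardy_sums[OF conjunct1[OF f] that], of z]
      by (simp add: algebra_simps)
    then show ?thesis by (subst (asm) sums_Suc_iff) simp
  qed
  have "summable (\<lambda>n. (cmod (?a n))\<^sup>2)"
    using f by (subst summable_Suc_iff[symmetric]) simp
  then show "(\<lambda>z. z * f z) holomorphic_on ball 0 1 \<and> (\<forall>z. z \<notin> ball 0 1 \<longrightarrow> z * f z = 0) \<and>
    summable (\<lambda>n. (cmod (taylor_coeff (\<lambda>z. z * f z) n))\<^sup>2)"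
    using hardy_of_coeffs[OF s] f by simp
qed

section \<open>Operators on closed subspaces\<close>

text \<open>A Hilbert space which need not be a whole type is a closed complex subspace \<open>M\<close> of a type of
  class \<^class>\<open>chilbert_space\<close>. An operator on \<open>M\<close> is a function on that type of which only the
  values on \<open>M\<close> matter.\<close>

definition hilbert :: "'a::chilbert_space set \<Rightarrow> bool"
  where "hilbert M \<longleftrightarrow> csubspace M \<and> closed M"

definition clinear_on ::
    "'a::chilbert_space set \<Rightarrow> 'b::chilbert_space set \<Rightarrow> ('a \<Rightarrow> 'b) \<Rightarrow> bool"
  where "clinear_on M N A \<longleftrightarrow> (\<forall>x\<in>M. A x \<in> N) \<and> (\<forall>x\<in>M. \<forall>y\<in>M. A (x + y) = A x + A y) \<and>
    (\<forall>c. \<forall>x\<in>M. A (c *\<^sub>C x) = c *\<^sub>C A x)"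

definition bounded_op :: "'a::chilbert_space set \<Rightarrow> ('a \<Rightarrow> 'a) \<Rightarrow> bool"
  where "bounded_op M A \<longleftrightarrow> clinear_on M M A \<and> (\<exists>B. \<forall>x\<in>M. norm (A x) \<le> B * norm x)"

definition isometric_embedding ::
    "'a::chilbert_space set \<Rightarrow> 'b::chilbert_space set \<Rightarrow> ('a \<Rightarrow> 'b) \<Rightarrow> bool"
  where "isometric_embedding M N J \<longleftrightarrow> clinear_on M N J \<and> (\<forall>x\<in>M. norm (J x) = norm x)"

definition cadj :: "'a::chilbert_space set \<Rightarrow> ('a \<Rightarrow> 'a) \<Rightarrow> 'a \<Rightarrow> 'a"
  where "cadj M A y = (THE w. w \<in> M \<and> (\<forall>x\<in>M. cinner (A x) y = cinner x w))"

definition orth_proj :: "'a::chilbert_space set \<Rightarrow> 'a \<Rightarrow> 'a"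
  where "orth_proj M x = (THE y. y \<in> M \<and> (\<forall>z\<in>M. cinner (x - y) z = 0))"

definition positive_op :: "('a::chilbert_space \<Rightarrow> 'a) \<Rightarrow> bool"
  where "positive_op A \<longleftrightarrow> bounded_op UNIV A \<and>
    (\<forall>x. Im (cinner (A x) x) = 0 \<and> 0 \<le> Re (cinner (A x) x))"

definition op_sqrt :: "('a::chilbert_space \<Rightarrow> 'a) \<Rightarrow> 'a \<Rightarrow> 'a"
  where "op_sqrt B = (THE R. positive_op R \<and> R \<circ> R = B)"

definition defect_op :: "('a::chilbert_space \<Rightarrow> 'a) \<Rightarrow> 'a \<Rightarrow> 'a"
  where "defect_op T = op_sqrt (\<lambda>x. x - cadj UNIV T (T x))"

definition defect_space :: "('a::chilbert_space \<Rightarrow> 'a) \<Rightarrow> 'a set"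
  where "defect_space T = closure (range (defect_op T))"

definition commutator :: "('a::ab_group_add \<Rightarrow> 'a) \<Rightarrow> ('a \<Rightarrow> 'a) \<Rightarrow> 'a \<Rightarrow> 'a"
  where "commutator A B x = A (B x) - B (A x)"

definition commuting_triple ::
    "('a::chilbert_space \<Rightarrow> 'a) \<Rightarrow> ('a \<Rightarrow> 'a) \<Rightarrow> ('a \<Rightarrow> 'a) \<Rightarrow> bool"
  where "commuting_triple T1 T2 T3 \<longleftrightarrow>
    bounded_op UNIV T1 \<and> bounded_op UNIV T2 \<and> bounded_op UNIV T3 \<and>
    T1 \<circ> T2 = T2 \<circ> T1 \<and> T1 \<circ> T3 = T3 \<circ> T1 \<and> T2 \<circ> T3 = T3 \<circ> T2"

text \<open>Exactness of the Koszul complex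
  \<open>0 \<rightarrow> H \<rightarrow> H\<^sup>3 \<rightarrow> H\<^sup>3 \<rightarrow> H \<rightarrow> 0\<close> of a commuting triple, with the basis
  \<open>e1 \<and> e2\<close>, \<open>e1 \<and> e3\<close>, \<open>e2 \<and> e3\<close> in degree two.\<close>

definition koszul0 :: "('a::chilbert_space \<Rightarrow> 'a) \<Rightarrow> ('a \<Rightarrow> 'a) \<Rightarrow> ('a \<Rightarrow> 'a) \<Rightarrow> 'a \<Rightarrow> 'a \<times> 'a \<times> 'a"
  where "koszul0 A1 A2 A3 x = (A1 x, A2 x, A3 x)"

definition koszul1 ::
    "('a::chilbert_space \<Rightarrow> 'a) \<Rightarrow> ('a \<Rightarrow> 'a) \<Rightarrow> ('a \<Rightarrow> 'a) \<Rightarrow> 'a \<times> 'a \<times> 'a \<Rightarrow> 'a \<times> 'a \<times> 'a"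
  where "koszul1 A1 A2 A3 = (\<lambda>(x1, x2, x3). (A1 x2 - A2 x1, A1 x3 - A3 x1, A2 x3 - A3 x2))"

definition koszul2 ::
    "('a::chilbert_space \<Rightarrow> 'a) \<Rightarrow> ('a \<Rightarrow> 'a) \<Rightarrow> ('a \<Rightarrow> 'a) \<Rightarrow> 'a \<times> 'a \<times> 'a \<Rightarrow> 'a"
  where "koszul2 A1 A2 A3 = (\<lambda>(y12, y13, y23). A1 y23 - A2 y13 + A3 y12)"

definition koszul_exact :: "('a::chilbert_space \<Rightarrow> 'a) \<Rightarrow> ('a \<Rightarrow> 'a) \<Rightarrow> ('a \<Rightarrow> 'a) \<Rightarrow> bool"
  where "koszul_exact A1 A2 A3 \<longleftrightarrow>
    {x. koszul0 A1 A2 A3 x = 0} = {0} \<and>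
    {x. koszul1 A1 A2 A3 x = 0} = range (koszul0 A1 A2 A3) \<and>
    {y. koszul2 A1 A2 A3 y = 0} = range (koszul1 A1 A2 A3) \<and>
    range (koszul2 A1 A2 A3) = UNIV"

definition taylor_spectrum ::
    "('a::chilbert_space \<Rightarrow> 'a) \<Rightarrow> ('a \<Rightarrow> 'a) \<Rightarrow> ('a \<Rightarrow> 'a) \<Rightarrow> (complex \<times> complex \<times> complex) set"
  where "taylor_spectrum T1 T2 T3 = {(l1, l2, l3).
    \<not> koszul_exact (\<lambda>x. T1 x - l1 *\<^sub>C x) (\<lambda>x. T2 x - l2 *\<^sub>C x) (\<lambda>x. T3 x - l3 *\<^sub>C x)}"

section \<open>The tetrablock and its operator triples\<close>

definition tetrablock :: "(complex \<times> complex \<times> complex) set"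
  where "tetrablock = {(x1, x2, x3).
    \<forall>z w. cmod z \<le> 1 \<longrightarrow> cmod w \<le> 1 \<longrightarrow> 1 - z * x1 - w * x2 + z * w * x3 \<noteq> 0}"

definition tetrablock_boundary :: "(complex \<times> complex \<times> complex) set"
  where "tetrablock_boundary = {(x1, x2, x3). (x1, x2, x3) \<in> closure tetrablock \<and> cmod x3 = 1}"

text \<open>A polynomial in three variables is given by its coefficients \<open>c i j k\<close> with
  \<open>i, j, k \<le> N\<close>, where \<open>N\<close> and \<open>c\<close> are arbitrary.\<close>

definition poly3 :: "nat \<Rightarrow> (nat \<Rightarrow> nat \<Rightarrow> nat \<Rightarrow> complex) \<Rightarrow> complex \<times> complex \<times> complex \<Rightarrow> complex"
  where "poly3 N c = (\<lambda>(x1, x2, x3). \<Sum>i\<le>N. \<Sum>j\<le>N. \<Sum>k\<le>N. c i j k * x1 ^ i * x2 ^ j * x3 ^ k)"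

definition op_poly3 :: "nat \<Rightarrow> (nat \<Rightarrow> nat \<Rightarrow> nat \<Rightarrow> complex) \<Rightarrow>
    ('a::chilbert_space \<Rightarrow> 'a) \<Rightarrow> ('a \<Rightarrow> 'a) \<Rightarrow> ('a \<Rightarrow> 'a) \<Rightarrow> 'a \<Rightarrow> 'a"
  where "op_poly3 N c T1 T2 T3 h =
    (\<Sum>i\<le>N. \<Sum>j\<le>N. \<Sum>k\<le>N. c i j k *\<^sub>C (T1 ^^ i) ((T2 ^^ j) ((T3 ^^ k) h)))"

definition E_contraction :: "('a::chilbert_space \<Rightarrow> 'a) \<Rightarrow> ('a \<Rightarrow> 'a) \<Rightarrow> ('a \<Rightarrow> 'a) \<Rightarrow> bool"
  where "E_contraction T1 T2 T3 \<longleftrightarrow> commuting_triple T1 T2 T3 \<and>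
    taylor_spectrum T1 T2 T3 \<subseteq> closure tetrablock \<and>
    (\<forall>N c. onorm (op_poly3 N c T1 T2 T3) \<le> (SUP x\<in>closure tetrablock. cmod (poly3 N c x)))"

definition pure_E_contraction :: "('a::chilbert_space \<Rightarrow> 'a) \<Rightarrow> ('a \<Rightarrow> 'a) \<Rightarrow> ('a \<Rightarrow> 'a) \<Rightarrow> bool"
  where "pure_E_contraction T1 T2 T3 \<longleftrightarrow> E_contraction T1 T2 T3 \<and>
    (\<forall>h. (\<lambda>n. (cadj UNIV T3 ^^ n) h) \<longlonglongrightarrow> 0)"

definition E_unitary :: "('a::chilbert_space \<Rightarrow> 'a) \<Rightarrow> ('a \<Rightarrow> 'a) \<Rightarrow> ('a \<Rightarrow> 'a) \<Rightarrow> bool"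
  where "E_unitary U1 U2 U3 \<longleftrightarrow> commuting_triple U1 U2 U3 \<and>
    (\<forall>U\<in>{U1, U2, U3}. U \<circ> cadj UNIV U = cadj UNIV U \<circ> U) \<and>
    taylor_spectrum U1 U2 U3 \<subseteq> tetrablock_boundary"

text \<open>The space of the \<open>\<bbbE>\<close>-unitary is taken to be the space of square-summable sequences in the
  ambient space of \<open>K\<close>. This is no restriction: the smallest subspace containing \<open>K\<close> that reduces
  a given \<open>\<bbbE>\<close>-unitary extension is the closed span of countably many images of \<open>K\<close>, hence embeds
  into this space, and on the orthogonal complement of the embedded copy one takes the
  \<open>\<bbbE>\<close>-unitary \<open>(0, 0, I)\<close>.\<close>

definition E_isometry :: "'a::chilbert_space set \<Rightarrow> ('a \<Rightarrow> 'a) \<Rightarrow> ('a \<Rightarrow> 'a) \<Rightarrow> ('a \<Rightarrow> 'a) \<Rightarrow> bool"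
  where "E_isometry K Q1 Q2 V \<longleftrightarrow>
    bounded_op K Q1 \<and> bounded_op K Q2 \<and> bounded_op K V \<and>
    (\<exists>(J :: 'a \<Rightarrow> 'a seq2) U1 U2 U3. isometric_embedding K UNIV J \<and> E_unitary U1 U2 U3 \<and>
      (\<forall>x\<in>K. U1 (J x) = J (Q1 x) \<and> U2 (J x) = J (Q2 x) \<and> U3 (J x) = J (V x)))"

text \<open>Unitary equivalence with the unilateral shift on the square-summable sequences in some
  Hilbert space \<open>W\<close>. Since \<open>W\<close> embeds into \<open>K\<close>, it may be taken inside the same type.\<close>

definition pure_isometry :: "'a::chilbert_space set \<Rightarrow> ('a \<Rightarrow> 'a) \<Rightarrow> bool"
  where "pure_isometry K V \<longleftrightarrow> bounded_op K V \<and>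
    (\<exists>(W :: 'a set) (U :: 'a \<Rightarrow> 'a seq2). hilbert W \<and> isometric_embedding K UNIV U \<and>
      U ` K = {f. \<forall>n. entry f n \<in> W} \<and> (\<forall>x\<in>K. U (V x) = shift (U x)))"

definition pure_E_isometry ::
    "'a::chilbert_space set \<Rightarrow> ('a \<Rightarrow> 'a) \<Rightarrow> ('a \<Rightarrow> 'a) \<Rightarrow> ('a \<Rightarrow> 'a) \<Rightarrow> bool"
  where "pure_E_isometry K Q1 Q2 V \<longleftrightarrow> E_isometry K Q1 Q2 V \<and> pure_isometry K V"

definition fundamental_operators ::
    "('a::chilbert_space \<Rightarrow> 'a) \<Rightarrow> ('a \<Rightarrow> 'a) \<Rightarrow> ('a \<Rightarrow> 'a) \<Rightarrow> ('a \<Rightarrow> 'a) \<Rightarrow> ('a \<Rightarrow> 'a) \<Rightarrow> bool"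
  where "fundamental_operators S1 S2 S3 A1 A2 \<longleftrightarrow>
    bounded_op (defect_space S3) A1 \<and> bounded_op (defect_space S3) A2 \<and>
    (\<forall>x. S1 x - cadj UNIV S2 (S3 x) = defect_op S3 (A1 (defect_op S3 x))) \<and>
    (\<forall>x. S2 x - cadj UNIV S1 (S3 x) = defect_op S3 (A2 (defect_op S3 x)))"

text \<open>\<open>J\<close> is the embedding of the space of \<open>(T1, T2, T)\<close> into \<open>K\<close>.\<close>

definition dilates_via :: "'k::chilbert_space set \<Rightarrow> ('k \<Rightarrow> 'k) \<Rightarrow> ('k \<Rightarrow> 'k) \<Rightarrow> ('k \<Rightarrow> 'k) \<Rightarrow>
    ('h::chilbert_space \<Rightarrow> 'h) \<Rightarrow> ('h \<Rightarrow> 'h) \<Rightarrow> ('h \<Rightarrow> 'h) \<Rightarrow> ('h \<Rightarrow> 'k) \<Rightarrow> bool"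
  where "dilates_via K Q1 Q2 V T1 T2 T J \<longleftrightarrow> isometric_embedding UNIV K J \<and>
    (\<forall>m1 m2 n h. orth_proj (range J) ((Q1 ^^ m1) ((Q2 ^^ m2) ((V ^^ n) (J h)))) =
      J ((T1 ^^ m1) ((T2 ^^ m2) ((T ^^ n) h))))"

definition minimal_via :: "'k::chilbert_space set \<Rightarrow> ('k \<Rightarrow> 'k) \<Rightarrow> ('k \<Rightarrow> 'k) \<Rightarrow> ('k \<Rightarrow> 'k) \<Rightarrow>
    ('h \<Rightarrow> 'k) \<Rightarrow> bool"
  where "minimal_via K Q1 Q2 V J \<longleftrightarrow>
    K = closure (cspan {(Q1 ^^ m1) ((Q2 ^^ m2) ((V ^^ n) (J h))) | m1 m2 n h. True})"

definition minimal_pure_E_isometric_dilation ::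
    "'k::chilbert_space set \<Rightarrow> ('k \<Rightarrow> 'k) \<Rightarrow> ('k \<Rightarrow> 'k) \<Rightarrow> ('k \<Rightarrow> 'k) \<Rightarrow>
    ('h::chilbert_space \<Rightarrow> 'h) \<Rightarrow> ('h \<Rightarrow> 'h) \<Rightarrow> ('h \<Rightarrow> 'h) \<Rightarrow> bool"
  where "minimal_pure_E_isometric_dilation K Q1 Q2 V T1 T2 T \<longleftrightarrow> pure_E_isometry K Q1 Q2 V \<and>
    (\<exists>J. dilates_via K Q1 Q2 V T1 T2 T J \<and> minimal_via K Q1 Q2 V J)"

section \<open>Hilbert space tensor products\<close>

text \<open>\<open>K\<close>, with the bilinear map \<open>t\<close>, is a Hilbert space tensor product of \<open>M\<close> and \<open>N\<close>; this
  determines \<open>K\<close> up to a unique unitary compatible with \<open>t\<close>.\<close>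

definition hilbert_tensor :: "'a::chilbert_space set \<Rightarrow> 'b::chilbert_space set \<Rightarrow>
    'k::chilbert_space set \<Rightarrow> ('a \<Rightarrow> 'b \<Rightarrow> 'k) \<Rightarrow> bool"
  where "hilbert_tensor M N K t \<longleftrightarrow> hilbert K \<and>
    (\<forall>f\<in>M. clinear_on N K (t f)) \<and> (\<forall>x\<in>N. clinear_on M K (\<lambda>f. t f x)) \<and>
    (\<forall>f\<in>M. \<forall>g\<in>M. \<forall>x\<in>N. \<forall>y\<in>N. cinner (t f x) (t g y) = cinner f g * cinner x y) \<and>
    K = closure (cspan {t f x | f x. f \<in> M \<and> x \<in> N})"

text \<open>The operator \<open>A \<otimes> B\<close> on \<open>K\<close>. Its values on \<open>K\<close> are determined by the stated properties; its
  values outside \<open>K\<close> are irrelevant, which is why \<open>SOME\<close> is used instead of \<open>THE\<close>.\<close>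

definition tensor_op :: "'a::chilbert_space set \<Rightarrow> 'b::chilbert_space set \<Rightarrow>
    'k::chilbert_space set \<Rightarrow> ('a \<Rightarrow> 'b \<Rightarrow> 'k) \<Rightarrow> ('a \<Rightarrow> 'a) \<Rightarrow> ('b \<Rightarrow> 'b) \<Rightarrow> 'k \<Rightarrow> 'k"
  where "tensor_op M N K t A B =
    (SOME C. bounded_op K C \<and> (\<forall>f\<in>M. \<forall>x\<in>N. C (t f x) = t (A f) (B x)))"

end

theory Submission
  imports Defs
begin

text \<open>Let \<open>S1, S2, S3\<close> be the adjoints of \<open>T1, T2, T\<close> and let \<open>D\<close> be the defect operator of \<open>S3\<close>. In
  coordinates the dilation space consists of the square-summable sequences in the defect space,
  \<open>V\<close> is the shift and \<open>Q1 = I \<otimes> A1* + M\<^sub>z \<otimes> A2\<close>. The space of the triple is embedded by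
  sending \<open>h\<close> to its orbit \<open>n \<mapsto> D S3\<^sup>n h\<close>. This is isometric because \<open>\<parallel>D x\<parallel>\<^sup>2 = \<parallel>x\<parallel>\<^sup>2 - \<parallel>S3 x\<parallel>\<^sup>2\<close>
  telescopes and the triple is pure (\<open>orbit_sums\<close>).

  Dilation: the equations of the fundamental operators give \<open>D S1 = A1 D + A2* D S3\<close>
  (\<open>defect_intertwines\<close>), which says that the adjoint of \<open>Q1\<close> maps the orbit of \<open>h\<close> to the orbit of
  \<open>S1 h\<close> (\<open>pencil_orbit\<close>); the same holds for \<open>Q2\<close> and \<open>V\<close>. So the embedded space is invariant
  under the three adjoints, which restrict to \<open>S1, S2, S3\<close> there, and compressing products of
  \<open>Q1, Q2, V\<close> to it gives products of \<open>T1, T2, T\<close>. Minimality: the orbit of \<open>h\<close> minus the shifted orbit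
  of \<open>S3 h\<close> is the constant function \<open>D h\<close>, so the powers of \<open>V\<close> alone already generate everything
  (\<open>emb_diff\<close>).

  Tetrablock isometry: replacing the unilateral by the bilateral shift \<open>S\<close> extends \<open>Q2\<close> to
  \<open>U2 = I \<otimes> A2* + S \<otimes> A1\<close>, extends \<open>V\<close> to the unitary \<open>U3\<close>, and \<open>Q1\<close> to \<open>U2* U3\<close>. The hypotheses on
  \<open>A1, A2\<close> say that \<open>U2\<close> is normal, so all these operators and their adjoints commute. Then every
  point \<open>(l1, l2, l3)\<close> of the Taylor spectrum has approximate joint eigenvectors: otherwise
  the sum of the \<open>N\<^sub>i* N\<^sub>i\<close>, with \<open>N\<^sub>i = U\<^sub>i - l\<^sub>i\<close>, is invertible and yields a contracting homotopy of the
  Koszul complex (\<open>koszul_exact_if_bounded_below\<close>). Hence \<open>\<bar>l3\<bar> = 1\<close> and \<open>l1 = cnj l2 * l3\<close>, and such a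
  point lies in the distinguished boundary once \<open>\<bar>l2\<bar> \<le> 1\<close>. On an approximate eigenvector \<open>U2\<close> is
  close to \<open>I \<otimes> (A2* + l3 A1)\<close>, so it suffices that this operator has numerical radius at most \<open>1\<close>
  (\<open>E_unitary_criterion\<close>, \<open>bilateral_E_unitary\<close>).

  The numerical radius: for \<open>\<bar>v\<bar> \<le> 1\<close> the function \<open>(x1 - v x3) / (1 - v x2)\<close> is bounded by \<open>1\<close> on the
  tetrablock. The von Neumann inequality for its Taylor polynomials becomes
  \<open>\<parallel>S1 y - z S3 y\<parallel> \<le> \<parallel>y - z S2 y\<parallel>\<close>; adding its square to the one with \<open>S1\<close> and \<open>S2\<close> exchanged and
  choosing the unimodular parameters well gives \<open>\<bar>\<langle>A1 y, y\<rangle>\<bar> + \<bar>\<langle>A2 y, y\<rangle>\<bar> \<le> \<parallel>y\<parallel>\<^sup>2\<close>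
  (\<open>numerical_radius_bound\<close>).\<close>

section \<open>Geometry of complex Hilbert spaces\<close>

lemma cinner_zero_left [simp]: "cinner 0 (x::'a::chilbert_space) = 0"
  using cinner_add_left[of 0 0 x] by simp

lemma cinner_zero_right [simp]: "cinner (x::'a::chilbert_space) 0 = 0"
  using cinner_add_right[of x 0 0] by simp

lemma cinner_minus_left [simp]: "cinner (- x) (y::'a::chilbert_space) = - cinner x y"
  using cinner_add_left[of "- x" x y] by (simp add: eq_neg_iff_add_eq_0)

lemma cinner_minus_right [simp]: "cinner x (- (y::'a::chilbert_space)) = - cinner x y"
  using cinner_add_right[of x "- y" y] by (simp add: eq_neg_iff_add_eq_0)

lemma cinner_diff_left: "cinner (x - y) (z::'a::chilbert_space) = cinner x z - cinner y z"
  using cinner_add_left[of x "- y" z] by simp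

lemma cinner_diff_right: "cinner z (x - (y::'a::chilbert_space)) = cinner z x - cinner z y"
  using cinner_add_right[of z x "- y"] by simp

lemma cinner_scaleR_left: "cinner (r *\<^sub>R x) (y::'a::chilbert_space) = complex_of_real r * cinner x y"
  by (simp add: scaleR_scaleC cinner_scaleC_left)

lemma cinner_scaleR_right: "cinner x (r *\<^sub>R (y::'a::chilbert_space)) = complex_of_real r * cinner x y"
  by (simp add: scaleR_scaleC cinner_scaleC_right)

lemmas cinner_distrib = cinner_add_left cinner_add_right cinner_diff_left cinner_diff_right
  cinner_scaleC_left cinner_scaleC_right cinner_scaleR_left cinner_scaleR_right

lemma Re_cinner_self: "Re (cinner x x) = (norm (x::'a::chilbert_space))\<^sup>2"
  by (simp add: cinner_self)

lemma cinner_self_eq_0: "cinner x x = 0 \<longleftrightarrow> (x::'a::chilbert_space) = 0"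
  by (simp add: cinner_self)

lemma cinner_ext: "(\<And>z. cinner x z = cinner y z) \<Longrightarrow> (x::'a::chilbert_space) = y"
  using cinner_self_eq_0[of "x - y"] by (simp add: cinner_diff_left)

lemma cinner_ext_right: "(\<And>z. cinner z x = cinner z y) \<Longrightarrow> (x::'a::chilbert_space) = y"
  using cinner_self_eq_0[of "x - y"] by (simp add: cinner_diff_right)

lemma cinner_ext_on:
  assumes "csubspace M" "x \<in> M" "y \<in> M" "\<And>z. z \<in> M \<Longrightarrow> cinner z x = cinner z (y::'a::chilbert_space)"
  shows "x = y"
proof -
  have "x - y \<in> M" using assms(1-3) by (rule complex_vector.subspace_diff)
  then have "cinner (x - y) (x - y) = 0" using assms(4) by (simp add: cinner_diff_right)
  then show ?thesis by (simp add: cinner_self_eq_0)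
qed

lemma bounded_bilinear_cinner:
  "bounded_bilinear (cinner :: 'a \<Rightarrow> 'a::chilbert_space \<Rightarrow> complex)"
proof
  show "\<exists>K. \<forall>a b::'a. norm (cinner a b) \<le> norm a * norm b * K"
    using norm_cinner_le by (intro exI[of _ 1]) auto
qed (simp_all add: cinner_distrib scaleR_conv_of_real)

lemmas tendsto_cinner [tendsto_intros] = bounded_bilinear.tendsto[OF bounded_bilinear_cinner]
lemmas continuous_on_cinner [continuous_intros] =
  bounded_bilinear.continuous_on[OF bounded_bilinear_cinner]
lemmas cinner_sum_right = bounded_bilinear.sum_right[OF bounded_bilinear_cinner]

lemma bounded_linear_scaleC: "bounded_linear ((*\<^sub>C) c :: 'a \<Rightarrow> 'a::chilbert_space)"
proof (rule bounded_linear_intro[where K="cmod c"])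
  show "c *\<^sub>C (r *\<^sub>R x) = r *\<^sub>R (c *\<^sub>C x)" for r and x :: 'a
    by (simp add: scaleR_scaleC scaleC_scaleC mult.commute)
qed (simp_all add: scaleC_add_right norm_scaleC)

lemmas tendsto_scaleC [tendsto_intros] = bounded_linear.tendsto[OF bounded_linear_scaleC]

lemma scaleC_zero_left [simp]: "0 *\<^sub>C (x::'a::chilbert_space) = 0"
  by (rule complex_vector.scale_zero_left)

lemma norm_sq_add: "(norm (x + y))\<^sup>2 = (norm x)\<^sup>2 + (norm (y::'a::chilbert_space))\<^sup>2 + 2 * Re (cinner x y)"
proof -
  have "cinner (x + y) (x + y) = cinner x x + cinner y y + (cinner x y + cnj (cinner x y))"
    by (simp add: cinner_distrib cinner_commute[of y x])
  then show ?thesis by (simp add: cinner_self complex_eq_iff)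
qed

lemma norm_sq_diff: "(norm (x - y))\<^sup>2 = (norm x)\<^sup>2 + (norm (y::'a::chilbert_space))\<^sup>2 - 2 * Re (cinner x y)"
  using norm_sq_add[of x "- y"] by simp

lemma hilbert_UNIV: "hilbert UNIV"
  by (simp add: hilbert_def complex_vector.subspace_UNIV)

lemma csubspace_closure:
  assumes "csubspace (M::'a::chilbert_space set)"
  shows "csubspace (closure M)"
  unfolding complex_vector.subspace_def
proof (intro conjI allI ballI)
  show "0 \<in> closure M"
    using assms complex_vector.subspace_0 closure_subset by blast
  show "x + y \<in> closure M" if x: "x \<in> closure M" and y: "y \<in> closure M" for x y
  proof -
    obtain f where "\<forall>n. f n \<in> M" "f \<longlonglongrightarrow> x"
      using x unfolding closure_sequential by blast
    moreover obtain g where "\<forall>n. g n \<in> M" "g \<longlonglongrightarrow> y"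
      using y unfolding closure_sequential by blast
    ultimately have "(\<lambda>n. f n + g n) \<longlonglongrightarrow> x + y" "\<forall>n. f n + g n \<in> M"
      using complex_vector.subspace_add[OF assms] by (simp_all add: tendsto_add)
    then show ?thesis unfolding closure_sequential by (intro exI[of _ "\<lambda>n. f n + g n"]) simp
  qed
  show "c *\<^sub>C x \<in> closure M" if x: "x \<in> closure M" for c x
  proof -
    obtain f where "\<forall>n. f n \<in> M" "f \<longlonglongrightarrow> x"
      using x unfolding closure_sequential by blast
    then have "(\<lambda>n. c *\<^sub>C f n) \<longlonglongrightarrow> c *\<^sub>C x" "\<forall>n. c *\<^sub>C f n \<in> M"
      using complex_vector.subspace_scale[OF assms] by (simp_all add: tendsto_scaleC)
    then show ?thesis unfolding closure_sequential by (intro exI[of _ "\<lambda>n. c *\<^sub>C f n"]) simp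
  qed
qed

text \<open>The parallelogram law makes every minimizing sequence for the distance to \<open>M\<close> a Cauchy
  sequence; its limit is the foot of the perpendicular.\<close>

lemma nearest_point_exists:
  assumes M: "hilbert (M::'a::chilbert_space set)"
  shows "\<exists>y\<in>M. \<forall>m\<in>M. norm (x - y) \<le> norm (x - m)"
proof -
  have sub: "csubspace M" and cl: "closed M" using M by (auto simp: hilbert_def)
  have ne: "M \<noteq> {}" using complex_vector.subspace_0[OF sub] by blast
  define d where "d = infdist x M"
  have d: "d \<le> norm (x - m)" if "m \<in> M" for m
    using infdist_le[OF that, of x] by (simp add: d_def dist_norm)
  have d0: "0 \<le> d" by (simp add: d_def infdist_nonneg)
  have "\<exists>m\<in>M. norm (x - m) < d + inverse (Suc n)" for n
  proof -
    have "infdist x M < d + inverse (Suc n)" by (simp add: d_def)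
    then show ?thesis using infdist_notempty[OF ne, of x]
      by (metis cINF_less_iff bdd_below_image_dist dist_norm ne)
  qed
  then obtain m where mM: "\<And>n. m n \<in> M" and m: "\<And>n. norm (x - m n) < d + inverse (Suc n)"
    by metis
  have lim: "(\<lambda>n. norm (x - m n)) \<longlonglongrightarrow> d"
  proof (rule tendsto_sandwich[OF always_eventually always_eventually])
    show "\<forall>n. d \<le> norm (x - m n)" using d mM by blast
    show "\<forall>n. norm (x - m n) \<le> d + inverse (Suc n)" using m less_imp_le by blast
    show "(\<lambda>n. d + inverse (Suc n)) \<longlonglongrightarrow> d" by (rule LIMSEQ_inverse_real_of_nat_add)
  qed simp
  have par: "(norm (m i - m j))\<^sup>2 \<le> 2 * ((norm (x - m i))\<^sup>2 - d\<^sup>2) + 2 * ((norm (x - m j))\<^sup>2 - d\<^sup>2)" for i j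
  proof -
    have "(1/2) *\<^sub>R (m i + m j) \<in> M"
      unfolding scaleR_scaleC by (intro complex_vector.subspace_scale complex_vector.subspace_add sub mM)
    then have "d \<le> norm (x - (1/2) *\<^sub>R (m i + m j))" by (rule d)
    moreover have "(x - m i) + (x - m j) = 2 *\<^sub>R (x - (1/2) *\<^sub>R (m i + m j))"
      by (simp add: scaleR_2 algebra_simps)
    ultimately have "2 * d \<le> norm ((x - m i) + (x - m j))" by simp
    then have "(2 * d)\<^sup>2 \<le> (norm ((x - m i) + (x - m j)))\<^sup>2" using d0 by (intro power_mono) auto
    moreover have "m i - m j = (x - m j) - (x - m i)" by simp
    moreover have "Re (cinner (x - m j) (x - m i)) = Re (cinner (x - m i) (x - m j))"
      by (subst cinner_commute) simp
    ultimately show ?thesis by (simp only: norm_sq_diff norm_sq_add) (simp add: power2_eq_square)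
  qed
  have "Cauchy m"
  proof (rule CauchyI)
    fix e :: real assume e: "e > 0"
    have "(\<lambda>n. (norm (x - m n))\<^sup>2 - d\<^sup>2) \<longlonglongrightarrow> d\<^sup>2 - d\<^sup>2" by (intro tendsto_intros lim)
    then have "eventually (\<lambda>n. (norm (x - m n))\<^sup>2 - d\<^sup>2 < e\<^sup>2 / 4) sequentially"
      using e by (intro order_tendstoD) auto
    then obtain N where N: "\<And>n. n \<ge> N \<Longrightarrow> (norm (x - m n))\<^sup>2 - d\<^sup>2 < e\<^sup>2 / 4"
      unfolding eventually_sequentially by blast
    have "norm (m i - m j) < e" if "i \<ge> N" "j \<ge> N" for i j
    proof -
      have "(norm (m i - m j))\<^sup>2 < e\<^sup>2" 
        by (rule le_less_trans[OF par]) (use N[OF that(1)] N[OF that(2)] in argo)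
      then show ?thesis using e by (simp add: power_less_imp_less_base)
    qed
    then show "\<exists>N. \<forall>i\<ge>N. \<forall>j\<ge>N. norm (m i - m j) < e" by blast
  qed
  then obtain y where y: "m \<longlonglongrightarrow> y" using Cauchy_convergent convergent_def by blast
  have "y \<in> M" using closed_sequentially[OF cl _ y] mM by blast
  moreover have "norm (x - y) = d"
    by (rule LIMSEQ_unique[OF _ lim]) (intro tendsto_intros y)
  ultimately show ?thesis using d by blast
qed

text \<open>If \<open>x - y\<close> had a component along some \<open>z\<close> in \<open>M\<close>, moving the nearest point \<open>y\<close> by that component
  would bring it closer to \<open>x\<close>.\<close>

lemma projection_exists:
  assumes M: "hilbert (M::'a::chilbert_space set)"
  shows "\<exists>y\<in>M. \<forall>z\<in>M. cinner (x - y) z = 0"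
proof -
  have sub: "csubspace M" using M by (auto simp: hilbert_def)
  obtain y where y: "y \<in> M" "\<And>m. m \<in> M \<Longrightarrow> norm (x - y) \<le> norm (x - m)"
    using nearest_point_exists[OF M] by blast
  have "cinner (x - y) z = 0" if z: "z \<in> M" for z
  proof (cases "z = 0")
    case False
    define w where "w = cinner (x - y) z"
    \<comment> \<open>the coefficient of \<open>z\<close> in the projection of \<open>x - y\<close> onto the line of \<open>z\<close>\<close>
    define c where "c = w / complex_of_real ((norm z)\<^sup>2)"
    have "y + c *\<^sub>C z \<in> M" by (intro complex_vector.subspace_add complex_vector.subspace_scale sub y z)
    then have "(norm (x - y))\<^sup>2 \<le> (norm ((x - y) - c *\<^sub>C z))\<^sup>2"
      using y(2) by (simp add: diff_diff_add)
    also have "\<dots> = (norm (x - y))\<^sup>2 + (cmod c)\<^sup>2 * (norm z)\<^sup>2 - 2 * Re (cnj c * w)"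
      by (simp add: norm_sq_diff norm_scaleC power_mult_distrib cinner_scaleC_right w_def)
    also have "cnj c * w = complex_of_real ((cmod w)\<^sup>2 / (norm z)\<^sup>2)"
      using complex_norm_square[of w] by (simp add: c_def mult.commute)
    also have "(cmod c)\<^sup>2 * (norm z)\<^sup>2 = (cmod w)\<^sup>2 / (norm z)\<^sup>2"
    proof -
      have "cmod c = cmod w / (norm z)\<^sup>2" by (simp add: c_def norm_divide norm_power)
      then show ?thesis using False by (simp add: power2_eq_square)
    qed
    finally have "(cmod w)\<^sup>2 / (norm z)\<^sup>2 \<le> 0" by simp
    then show ?thesis using False by (simp add: w_def divide_le_0_iff)
  qed simp
  then show ?thesis using y(1) by blast
qed

text \<open>Riesz representation on a closed subspace: away from the kernel of \<open>f\<close>, the projection theorem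
  gives a vector orthogonal to the kernel, and a multiple of it represents \<open>f\<close>.\<close>

lemma riesz_representation:
  fixes M :: "'a::chilbert_space set" and f :: "'a \<Rightarrow> complex"
  assumes M: "hilbert M" and add: "\<And>x y. x \<in> M \<Longrightarrow> y \<in> M \<Longrightarrow> f (x + y) = f x + f y"
    and sc: "\<And>c x. x \<in> M \<Longrightarrow> f (c *\<^sub>C x) = c * f x"
    and bd: "\<And>x. x \<in> M \<Longrightarrow> cmod (f x) \<le> B * norm x"
  shows "\<exists>!w. w \<in> M \<and> (\<forall>x\<in>M. f x = cinner x w)"
proof -
  have sub: "csubspace M" and cl: "closed M" using M by (auto simp: hilbert_def)
  note subs = complex_vector.subspace_0[OF sub] complex_vector.subspace_add[OF sub]
    complex_vector.subspace_scale[OF sub] complex_vector.subspace_diff[OF sub]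
  have f0: "f 0 = 0" using sc[of 0 0] subs(1) by simp
  have diff: "f (x - y) = f x - f y" if "x \<in> M" "y \<in> M" for x y
    using add[of "x - y" y] subs(4)[OF that] that by simp
  define N where "N = {x \<in> M. f x = 0}"
  have "csubspace N"
    unfolding complex_vector.subspace_def using subs f0 add sc by (auto simp: N_def)
  moreover have "closed N"
    unfolding closed_sequential_limits
  proof (intro allI impI, elim conjE)
    fix X l assume X: "\<forall>n. X n \<in> N" and l: "X \<longlonglongrightarrow> l"
    have lM: "l \<in> M" using closed_sequentially[OF cl _ l] X by (auto simp: N_def)
    have "cmod (f l) \<le> B * norm (l - X n)" for n
      using bd[of "l - X n"] diff[of l "X n"] X lM subs(4) by (auto simp: N_def)
    moreover have "(\<lambda>n. B * norm (l - X n)) \<longlonglongrightarrow> B * norm (l - l)" by (intro tendsto_intros l)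
    ultimately have "cmod (f l) \<le> B * norm (l - l)"
      by (intro LIMSEQ_le_const) auto
    then show "l \<in> N" using lM by (simp add: N_def)
  qed
  ultimately have N: "hilbert N" by (simp add: hilbert_def)
  have "\<exists>w\<in>M. \<forall>x\<in>M. f x = cinner x w"
  proof (cases "M = N")
    case True
    then show ?thesis using subs(1) by (intro bexI[of _ 0]) (auto simp: N_def)
  next
    case False
    then obtain x0 where x0: "x0 \<in> M" "f x0 \<noteq> 0" by (auto simp: N_def)
    obtain y where y: "y \<in> N" "\<And>z. z \<in> N \<Longrightarrow> cinner (x0 - y) z = 0"
      using projection_exists[OF N] by blast
    define u where "u = x0 - y"
    have uM: "u \<in> M" and fu: "f u \<noteq> 0" using x0 y diff subs by (auto simp: u_def N_def)
    then have u0: "u \<noteq> 0" using f0 by auto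
    define w where "w = (cnj (f u) / complex_of_real ((norm u)\<^sup>2)) *\<^sub>C u"
    have "f x = cinner x w" if x: "x \<in> M" for x
    proof -
      have "f u *\<^sub>C x - f x *\<^sub>C u \<in> N" using x uM subs diff sc by (simp add: N_def)
      then have "cinner u (f u *\<^sub>C x - f x *\<^sub>C u) = 0" using y(2) by (simp add: u_def)
      then have "cinner (f u *\<^sub>C x - f x *\<^sub>C u) u = 0" by (subst cinner_commute) simp
      then have "f u * cinner x u = f x * cinner u u" by (simp add: cinner_distrib)
      then show ?thesis using u0 by (simp add: w_def cinner_scaleC_right cinner_self field_simps)
    qed
    moreover have "w \<in> M" using subs(3) uM by (simp add: w_def)
    ultimately show ?thesis by blast
  qed
  then obtain w where w: "w \<in> M" "\<forall>x\<in>M. f x = cinner x w" by blast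
  show ?thesis
  proof (rule ex1I[of _ w])
    fix v assume "v \<in> M \<and> (\<forall>x\<in>M. f x = cinner x v)"
    then show "v = w" using w by (intro cinner_ext_on[OF sub]) auto
  qed (use w in blast)
qed

section \<open>Bounded operators and adjoints\<close>

lemma clinear_onD:
  assumes "clinear_on M N A"
  shows "x \<in> M \<Longrightarrow> A x \<in> N" "x \<in> M \<Longrightarrow> y \<in> M \<Longrightarrow> A (x + y) = A x + A y"
    "x \<in> M \<Longrightarrow> A (c *\<^sub>C x) = c *\<^sub>C A x"
  using assms by (auto simp: clinear_on_def)

lemma clinear_on_diff:
  assumes "clinear_on M N A" "csubspace M" "x \<in> M" "y \<in> M"
  shows "A (x - y) = A x - A y"
  using clinear_onD(2)[OF assms(1) complex_vector.subspace_diff[OF assms(2-4)] assms(4)] by simp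

lemma clinear_on_0:
  assumes "clinear_on M N A" "csubspace M"
  shows "A 0 = 0"
  using clinear_on_diff[OF assms complex_vector.subspace_0[OF assms(2)] complex_vector.subspace_0[OF assms(2)]]
  by simp

lemma bounded_opE:
  assumes "bounded_op M A"
  obtains B where "B \<ge> 0" "\<And>x. x \<in> M \<Longrightarrow> norm (A x) \<le> B * norm x"
proof -
  obtain B where B: "\<And>x. x \<in> M \<Longrightarrow> norm (A x) \<le> B * norm x"
    using assms by (auto simp: bounded_op_def)
  show thesis
  proof (rule that[of "max B 0"])
    show "norm (A x) \<le> max B 0 * norm x" if "x \<in> M" for x
      using B[OF that] by (rule order_trans) (simp add: mult_right_mono)
  qed simp
qed

lemma bounded_op_clinear: "bounded_op M A \<Longrightarrow> clinear_on M M A"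
  by (simp add: bounded_op_def)

lemma bounded_op_closed: "bounded_op M A \<Longrightarrow> x \<in> M \<Longrightarrow> A x \<in> M"
  by (simp add: bounded_op_def clinear_on_def)

lemma bounded_opI:
  assumes "\<And>x. x \<in> M \<Longrightarrow> A x \<in> M" "\<And>x y. x \<in> M \<Longrightarrow> y \<in> M \<Longrightarrow> A (x + y) = A x + A y"
    "\<And>c x. x \<in> M \<Longrightarrow> A (c *\<^sub>C x) = c *\<^sub>C A x" "\<And>x. x \<in> M \<Longrightarrow> norm (A x) \<le> B * norm x"
  shows "bounded_op M A"
  unfolding bounded_op_def clinear_on_def
  by (intro conjI ballI allI exI[of _ B]) (fact assms)+

lemma bounded_op_UNIV_bounded_linear: "bounded_op UNIV A \<Longrightarrow> bounded_linear A"
proof -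
  assume A: "bounded_op UNIV A"
  then obtain B where "\<And>x. norm (A x) \<le> B * norm x" using bounded_opE[of UNIV A] by auto
  then show ?thesis
    using clinear_onD[OF bounded_op_clinear[OF A]]
    by (intro bounded_linear_intro[where K=B]) (auto simp: scaleR_scaleC mult.commute)
qed

lemma bounded_op_compose:
  assumes A: "bounded_op M A" and B: "bounded_op M B"
  shows "bounded_op M (\<lambda>x. A (B x))"
proof -
  obtain a where a: "a \<ge> 0" "\<And>x. x \<in> M \<Longrightarrow> norm (A x) \<le> a * norm x" using bounded_opE[OF A] by metis
  obtain b where b: "b \<ge> 0" "\<And>x. x \<in> M \<Longrightarrow> norm (B x) \<le> b * norm x" using bounded_opE[OF B] by metis
  note l = clinear_onD[OF bounded_op_clinear[OF A]] clinear_onD[OF bounded_op_clinear[OF B]]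
  show ?thesis
  proof (rule bounded_opI)
    fix x assume x: "x \<in> M"
    have "norm (A (B x)) \<le> a * norm (B x)" by (intro a l x)
    also have "\<dots> \<le> a * (b * norm x)" by (intro mult_left_mono a b x)
    finally show "norm (A (B x)) \<le> (a * b) * norm x" by (simp add: mult.assoc)
  qed (simp_all add: l)
qed

lemma bounded_op_add:
  assumes A: "bounded_op M A" and B: "bounded_op M B" and M: "csubspace M"
  shows "bounded_op M (\<lambda>x. A x + B x)"
proof -
  obtain a where a: "\<And>x. x \<in> M \<Longrightarrow> norm (A x) \<le> a * norm x" using bounded_opE[OF A] by metis
  obtain b where b: "\<And>x. x \<in> M \<Longrightarrow> norm (B x) \<le> b * norm x" using bounded_opE[OF B] by metis
  note l = clinear_onD[OF bounded_op_clinear[OF A]] clinear_onD[OF bounded_op_clinear[OF B]]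
  show ?thesis
  proof (rule bounded_opI)
    fix x assume x: "x \<in> M"
    show "norm (A x + B x) \<le> (a + b) * norm x"
      using norm_triangle_ineq[of "A x" "B x"] a[OF x] b[OF x] by (simp add: distrib_right)
  qed (simp_all add: l complex_vector.subspace_add[OF M] scaleC_add_right)
qed

lemma bounded_op_scaleC:
  assumes "bounded_op M A" "csubspace M"
  shows "bounded_op M (\<lambda>x. c *\<^sub>C A x)"
proof -
  obtain a where a: "\<And>x. x \<in> M \<Longrightarrow> norm (A x) \<le> a * norm x" using bounded_opE[OF assms(1)] by metis
  note l = clinear_onD[OF bounded_op_clinear[OF assms(1)]]
  show ?thesis
  proof (rule bounded_opI)
    show "norm (c *\<^sub>C A x) \<le> (cmod c * a) * norm x" if "x \<in> M" for x
      using a[OF that] by (simp add: norm_scaleC mult.assoc mult_left_mono)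
  qed (simp_all add: l complex_vector.subspace_scale[OF assms(2)] scaleC_add_right scaleC_scaleC mult.commute)
qed

lemma bounded_op_ident: "bounded_op M (\<lambda>x. x)"
  by (rule bounded_opI[where B=1]) auto

lemma bounded_op_diff:
  assumes "bounded_op M A" "bounded_op M B" "csubspace M"
  shows "bounded_op M (\<lambda>x. A x - B x)"
proof -
  have *: "- (1::complex) *\<^sub>C y = - y" for y :: 'a
    using complex_vector.scale_minus_left[of 1 y] by simp
  show ?thesis
    using bounded_op_add[OF assms(1) bounded_op_scaleC[OF assms(2,3), of "-1"] assms(3)]
    unfolding * by simp
qed

lemma bounded_op_funpow: "bounded_op M A \<Longrightarrow> bounded_op M (A ^^ n)"
proof (induction n)
  case 0
  then show ?case using bounded_op_ident by (simp add: id_def)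
next
  case (Suc n)
  then show ?case using bounded_op_compose[of M A "A ^^ n"] by (simp add: comp_def)
qed

text \<open>Same formula as \<open>cadj\<close>, but with two different types: the embedding of the defect space into
  the dilation space needs an adjoint too.\<close>

definition adj_on :: "'a::chilbert_space set \<Rightarrow> ('a \<Rightarrow> 'b::chilbert_space) \<Rightarrow> 'b \<Rightarrow> 'a"
  where "adj_on M A y = (THE w. w \<in> M \<and> (\<forall>x\<in>M. cinner (A x) y = cinner x w))"

lemma cadj_eq_adj_on: "cadj M A = adj_on M A"
  by (simp add: fun_eq_iff cadj_def adj_on_def)

lemma
  fixes A :: "'a::chilbert_space \<Rightarrow> 'b::chilbert_space"
  assumes M: "hilbert M" and A: "clinear_on M UNIV A" and b: "\<And>x. x \<in> M \<Longrightarrow> norm (A x) \<le> B * norm x"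
  shows adj_on_in: "adj_on M A y \<in> M"
    and adj_on: "x \<in> M \<Longrightarrow> cinner (A x) y = cinner x (adj_on M A y)"
proof -
  have "\<exists>!w. w \<in> M \<and> (\<forall>x\<in>M. cinner (A x) y = cinner x w)"
  proof (rule riesz_representation[OF M, where B="B * norm y"])
    fix x assume x: "x \<in> M"
    have "cmod (cinner (A x) y) \<le> norm (A x) * norm y" by (rule norm_cinner_le)
    also have "\<dots> \<le> B * norm x * norm y" using b[OF x] by (simp add: mult_right_mono)
    finally show "cmod (cinner (A x) y) \<le> B * norm y * norm x" by (simp add: ac_simps)
  qed (use clinear_onD[OF A] in \<open>auto simp: cinner_distrib\<close>)
  from theI'[OF this, folded adj_on_def]
  show "adj_on M A y \<in> M" "x \<in> M \<Longrightarrow> cinner (A x) y = cinner x (adj_on M A y)" by auto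
qed

lemma adj_on_norm_le:
  assumes M: "hilbert M" and A: "clinear_on M UNIV A" and B: "B \<ge> 0"
    and b: "\<And>x. x \<in> M \<Longrightarrow> norm (A x) \<le> B * norm x"
  shows "norm (adj_on M A y) \<le> B * norm y"
proof -
  let ?w = "adj_on M A y"
  have "(norm ?w)\<^sup>2 = Re (cinner (A ?w) y)"
    by (simp add: adj_on[OF M A b] adj_on_in[OF M A b] Re_cinner_self)
  also have "\<dots> \<le> norm (A ?w) * norm y" by (rule Re_cinner_le)
  also have "\<dots> \<le> B * norm ?w * norm y" by (intro mult_right_mono b adj_on_in[OF M A b]) auto
  finally have "norm ?w * norm ?w \<le> norm ?w * (B * norm y)" by (simp add: power2_eq_square ac_simps)
  then show ?thesis using B by (cases "?w = 0") auto
qed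

lemma bounded_op_clinear_UNIV: "bounded_op M A \<Longrightarrow> clinear_on M UNIV A"
  by (simp add: bounded_op_def clinear_on_def)

lemma cadj_in:
  assumes M: "hilbert M" and A: "bounded_op M A"
  shows "cadj M A y \<in> M"
proof -
  obtain B where "\<And>x. x \<in> M \<Longrightarrow> norm (A x) \<le> B * norm x" using bounded_opE[OF A] by metis
  then show ?thesis
    unfolding cadj_eq_adj_on by (rule adj_on_in[OF M bounded_op_clinear_UNIV[OF A]])
qed

lemma cadj:
  assumes M: "hilbert M" and A: "bounded_op M A" and x: "x \<in> M"
  shows "cinner (A x) y = cinner x (cadj M A y)"
proof -
  obtain B where "\<And>x. x \<in> M \<Longrightarrow> norm (A x) \<le> B * norm x" using bounded_opE[OF A] by metis
  then show ?thesis
    unfolding cadj_eq_adj_on by (rule adj_on[OF M bounded_op_clinear_UNIV[OF A] _ x])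
qed

lemma cadj_right:
  assumes "hilbert M" "bounded_op M A" "x \<in> M"
  shows "cinner y (A x) = cinner (cadj M A y) x"
  using cadj[OF assms, of y] by (metis cinner_commute)

lemma adj_on_bounded:
  assumes M: "hilbert M" and A: "clinear_on M UNIV A" and b: "\<And>x. x \<in> M \<Longrightarrow> norm (A x) \<le> B * norm x"
  shows "clinear_on UNIV M (adj_on M A)"
proof -
  have sub: "csubspace M" using M by (simp add: hilbert_def)
  note i = adj_on_in[OF M A b] and a = adj_on[OF M A b, symmetric]
  show ?thesis
    unfolding clinear_on_def
  proof (intro conjI ballI allI i)
    show "adj_on M A (x + y) = adj_on M A x + adj_on M A y" for x y
      by (rule cinner_ext_on[OF sub])
        (simp_all add: i a cinner_add_right complex_vector.subspace_add[OF sub])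
    show "adj_on M A (c *\<^sub>C x) = c *\<^sub>C adj_on M A x" for c x
      by (rule cinner_ext_on[OF sub])
        (simp_all add: i a cinner_scaleC_right complex_vector.subspace_scale[OF sub])
  qed
qed

lemma bounded_op_cadj:
  assumes M: "hilbert M" and A: "bounded_op M A"
  shows "bounded_op M (cadj M A)"
proof -
  obtain B where B: "B \<ge> 0" "\<And>x. x \<in> M \<Longrightarrow> norm (A x) \<le> B * norm x" using bounded_opE[OF A] by metis
  note l = bounded_op_clinear_UNIV[OF A]
  note r = clinear_onD[OF adj_on_bounded[OF M l B(2)]]
  show ?thesis
    unfolding cadj_eq_adj_on by (rule bounded_opI[where B=B]) (rule r adj_on_norm_le[OF M l B] UNIV_I | assumption)+
qed

lemma cadj_norm_le:
  assumes M: "hilbert M" and A: "bounded_op M A" and B: "B \<ge> 0" "\<And>x. x \<in> M \<Longrightarrow> norm (A x) \<le> B * norm x"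
  shows "norm (cadj M A y) \<le> B * norm y"
  unfolding cadj_eq_adj_on
  by (rule adj_on_norm_le[OF M bounded_op_clinear_UNIV[OF A] B])

lemma cadj_UNIV_eq:
  assumes "\<And>x y. cinner (A x) y = cinner x (B y)"
  shows "cadj UNIV A = B"
proof
  fix y show "cadj UNIV A y = B y"
    unfolding cadj_def
  proof (rule the_equality)
    show "w = B y" if "w \<in> UNIV \<and> (\<forall>x\<in>UNIV. cinner (A x) y = cinner x w)" for w
    proof (rule cinner_ext_right)
      show "cinner z w = cinner z (B y)" for z using that assms[of z y] by simp
    qed
  qed (simp add: assms)
qed

lemma cadj_cadj: "bounded_op UNIV A \<Longrightarrow> cadj UNIV (cadj UNIV A) = A"
  by (rule cadj_UNIV_eq) (simp add: cadj_right[OF hilbert_UNIV])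

lemma cadj_commute:
  assumes "bounded_op UNIV A" "bounded_op UNIV B" "A \<circ> B = B \<circ> A"
  shows "cadj UNIV A (cadj UNIV B x) = cadj UNIV B (cadj UNIV A x)"
proof (rule cinner_ext_right)
  fix z
  have "cinner (A (B z)) x = cinner (B (A z)) x" using fun_cong[OF assms(3), of z] by simp
  then show "cinner z (cadj UNIV A (cadj UNIV B x)) = cinner z (cadj UNIV B (cadj UNIV A x))"
    by (simp add: cadj[OF hilbert_UNIV, symmetric] assms(1,2))
qed

text \<open>Two candidates \<open>y\<close>, \<open>w\<close> for the projection differ by a vector of \<open>M\<close> that is orthogonal to \<open>M\<close>.\<close>

lemma orth_proj_eq:
  assumes "csubspace M" "y \<in> M" "\<And>z. z \<in> M \<Longrightarrow> cinner (x - y) z = 0"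
  shows "orth_proj M x = y"
  unfolding orth_proj_def
proof (rule the_equality)
  fix w assume w: "w \<in> M \<and> (\<forall>z\<in>M. cinner (x - w) z = 0)"
  have "w - y \<in> M" using w assms(1,2) by (simp add: complex_vector.subspace_diff)
  then have "cinner (x - y) (w - y) - cinner (x - w) (w - y) = 0" using w assms(3) by simp
  then have "cinner (w - y) (w - y) = 0" by (simp add: cinner_diff_left)
  then show "w = y" by (simp add: cinner_self_eq_0)
qed (use assms in auto)

section \<open>Square roots of positive operators and defect operators\<close>

text \<open>Polarization: a sesquilinear form that is real on the diagonal is Hermitian.\<close>

lemma positive_op_symmetric:
  assumes A: "positive_op A"
  shows "cinner (A x) y = cinner x (A y)"
proof -
  have l: "A (x + y) = A x + A y" "A (c *\<^sub>C x) = c *\<^sub>C A x" for x y c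
    using A by (auto simp: positive_op_def bounded_op_def clinear_on_def)
  have r: "Im (cinner (A z) z) = 0" for z using A by (simp add: positive_op_def)
  have "Im (cinner (A x) y + cinner (A y) x) = 0"
    using r[of "x + y"] r[of x] r[of y] by (simp add: l cinner_distrib)
  moreover have "Re (cinner (A x) y) = Re (cinner (A y) x)"
    using r[of "x + \<i> *\<^sub>C y"] r[of x] r[of y] by (simp add: l cinner_distrib)
  ultimately have "cinner (A x) y = cnj (cinner (A y) x)"
    by (simp add: complex_eq_iff)
  then show ?thesis by (metis cinner_commute)
qed

lemma positive_op_eq_0:
  assumes A: "positive_op A" and x: "Re (cinner (A x) x) = 0"
  shows "A x = 0"
proof -
  have bd: "bounded_op UNIV A" using A by (simp add: positive_op_def)
  obtain C where C: "C \<ge> 0" "\<And>x. norm (A x) \<le> C * norm x" using bounded_opE[OF bd] by auto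
  interpret bounded_linear A using bd by (rule bounded_op_UNIV_bounded_linear)
  define n where "n = (norm (A x))\<^sup>2"
  define t where "t = 1 / (C + 1)"
  have t: "t > 0" "t * C < 1" using C(1) by (auto simp: t_def field_simps)
  \<comment> \<open>a small step from \<open>x\<close> in the direction \<open>- A x\<close> would make the form negative\<close>
  have "0 \<le> Re (cinner (A (x - t *\<^sub>R A x)) (x - t *\<^sub>R A x))"
    using A by (simp add: positive_op_def)
  also have "\<dots> = t\<^sup>2 * Re (cinner (A (A x)) (A x)) - 2 * t * n"
    using x positive_op_symmetric[OF A, of "A x" x]
    by (simp add: diff scaleR cinner_distrib n_def Re_cinner_self power2_eq_square algebra_simps)
  also have "Re (cinner (A (A x)) (A x)) \<le> C * n"
  proof -
    have "Re (cinner (A (A x)) (A x)) \<le> norm (A (A x)) * norm (A x)" by (rule Re_cinner_le)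
    also have "\<dots> \<le> C * norm (A x) * norm (A x)" by (intro mult_right_mono C) auto
    finally show ?thesis by (simp add: n_def power2_eq_square mult.assoc)
  qed
  finally have "0 \<le> t\<^sup>2 * (C * n) - 2 * t * n" by (simp add: mult_left_mono)
  also have "\<dots> = t * n * (t * C - 2)" by (simp add: algebra_simps power2_eq_square)
  finally have "0 \<le> t * n * (t * C - 2)" .
  then have "t * n \<le> 0" using t by (auto simp: zero_le_mult_iff)
  then have "n \<le> 0" using t by (simp add: mult_le_0_iff)
  then show ?thesis by (simp add: n_def)
qed

text \<open>For a symmetric contraction \<open>B\<close>, the limit \<open>L\<close> of these iterates satisfies
  \<open>L = (B + L\<^sup>2) / 2\<close>, that is \<open>(I - L)\<^sup>2 = I - B\<close>. The same iteration with the number \<open>1\<close> for \<open>B\<close> increases to a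
  limit at most \<open>1\<close>, and its increments dominate the norms of the increments of the operators.\<close>

primrec sqrt_iter :: "('a::chilbert_space \<Rightarrow> 'a) \<Rightarrow> nat \<Rightarrow> 'a \<Rightarrow> 'a" where
  "sqrt_iter B 0 = (\<lambda>x. 0)"
| "sqrt_iter B (Suc n) = (\<lambda>x. (1/2) *\<^sub>C (B x + sqrt_iter B n (sqrt_iter B n x)))"

primrec sqrt_iter_num :: "nat \<Rightarrow> real" where
  "sqrt_iter_num 0 = 0"
| "sqrt_iter_num (Suc n) = (1 + (sqrt_iter_num n)\<^sup>2) / 2"

lemma sqrt_iter_num_bounds: "0 \<le> sqrt_iter_num n \<and> sqrt_iter_num n \<le> 1"
proof (induction n)
  case (Suc n)
  then have "(sqrt_iter_num n)\<^sup>2 \<le> 1" by (simp add: power_le_one)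
  then show ?case by simp
qed simp

lemma sqrt_iter_num_mono: "sqrt_iter_num n \<le> sqrt_iter_num (Suc n)"
proof -
  have "0 \<le> (1 - sqrt_iter_num n)\<^sup>2" by simp
  then show ?thesis by (simp only: power2_diff sqrt_iter_num.simps) simp
qed

lemma sqrt_iter_num_Cauchy: "Cauchy sqrt_iter_num"
proof -
  have "convergent sqrt_iter_num"
  proof (rule Bseq_mono_convergent)
    show "Bseq sqrt_iter_num"
      by (rule BseqI'[where K=1]) (use sqrt_iter_num_bounds in simp)
    show "\<forall>m n. m \<le> n \<longrightarrow> sqrt_iter_num m \<le> sqrt_iter_num n"
      using lift_Suc_mono_le[of sqrt_iter_num, OF sqrt_iter_num_mono] by blast
  qed
  then show ?thesis by (rule convergent_Cauchy)
qed

locale symmetric_contraction =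
  fixes B :: "'a::chilbert_space \<Rightarrow> 'a"
  assumes bounded: "bounded_op UNIV B" and contr: "norm (B x) \<le> norm x"
    and sym: "cinner (B x) y = cinner x (B y)"
begin

abbreviation "Y \<equiv> sqrt_iter B"
abbreviation "y \<equiv> sqrt_iter_num"

lemma bounded_Y: "bounded_op UNIV (Y n)"
proof (induction n)
  case 0
  show ?case by (rule bounded_opI[where B=0]) auto
next
  case (Suc n)
  show ?case
    unfolding sqrt_iter.simps
    by (rule bounded_op_scaleC[OF bounded_op_add[OF bounded bounded_op_compose[OF Suc Suc]]])
      (rule complex_vector.subspace_UNIV)+
qed

lemmas bounded_linear_Y = bounded_op_UNIV_bounded_linear[OF bounded_Y]

lemma norm_Y: "norm (Y n x) \<le> y n * norm x"
proof (induction n arbitrary: x)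
  case (Suc n)
  have "norm (Y n (Y n x)) \<le> y n * norm (Y n x)" by (rule Suc)
  also have "\<dots> \<le> y n * (y n * norm x)" using sqrt_iter_num_bounds by (intro mult_left_mono Suc) auto
  finally have "norm (B x) + norm (Y n (Y n x)) \<le> norm x + y n * (y n * norm x)"
    using contr[of x] by simp
  then have "norm (B x + Y n (Y n x)) \<le> norm x + y n * (y n * norm x)"
    by (rule order_trans[OF norm_triangle_ineq])
  then show ?case by (simp add: norm_scaleC power2_eq_square mult.assoc distrib_right del: complex_vector.scale_right_distrib)
qed simp

lemma norm_Y_le: "norm (Y n x) \<le> norm x"
  using norm_Y[of n x] sqrt_iter_num_bounds[of n] mult_right_mono[of "y n" 1 "norm x"] by simp

lemma Y_step: "norm (Y (Suc n) x - Y n x) \<le> (y (Suc n) - y n) * norm x"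
proof (induction n arbitrary: x)
  case 0
  show ?case using contr[of x] by (simp add: norm_scaleC)
next
  case (Suc n)
  define a b where "a = Y (Suc n)" and "b = Y n"
  define p q where "p = y (Suc n)" and "q = y n"
  interpret a: bounded_linear a unfolding a_def by (rule bounded_linear_Y)
  have pq: "0 \<le> p" "q \<le> p" using sqrt_iter_num_mono[of n] sqrt_iter_num_bounds[of "Suc n"] by (simp_all only: p_def q_def)
  have IH: "norm (a z - b z) \<le> (p - q) * norm z" for z
    unfolding a_def b_def p_def q_def by (rule Suc)
  have na: "norm (a z) \<le> p * norm z" and nb: "norm (b z) \<le> q * norm z" for z
    unfolding a_def b_def p_def q_def by (rule norm_Y)+
  have ax: "a x = (1/2) *\<^sub>C (B x + b (b x))" unfolding a_def b_def by simp
  have aax: "Y (Suc (Suc n)) x = (1/2) *\<^sub>C (B x + a (a x))" unfolding a_def by simp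
  have "Y (Suc (Suc n)) x - Y (Suc n) x = Y (Suc (Suc n)) x - a x" by (simp only: a_def)
  also have "\<dots> = (1/2) *\<^sub>C (a (a x) - b (b x))"
  proof -
    have "Y (Suc (Suc n)) x - a x = (1/2) *\<^sub>C (B x + a (a x)) - (1/2) *\<^sub>C (B x + b (b x))"
      by (simp only: aax flip: ax)
    then show ?thesis by (simp add: algebra_simps)
  qed
  also have "a (a x) - b (b x) = a (a x - b x) + (a (b x) - b (b x))" by (simp add: a.diff)
  finally have "norm (Y (Suc (Suc n)) x - Y (Suc n) x)
      = (1/2) * norm (a (a x - b x) + (a (b x) - b (b x)))" by (simp only: norm_scaleC) simp
  also have "norm (a (a x - b x) + (a (b x) - b (b x))) \<le> p * ((p - q) * norm x) + (p - q) * (q * norm x)"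
  proof (intro order_trans[OF norm_triangle_ineq] add_mono)
    show "norm (a (a x - b x)) \<le> p * ((p - q) * norm x)"
      by (rule order_trans[OF na mult_left_mono[OF IH pq(1)]])
    show "norm (a (b x) - b (b x)) \<le> (p - q) * (q * norm x)"
      by (rule order_trans[OF IH mult_left_mono[OF nb]]) (use pq in simp)
  qed
  also have "(1/2) * (p * ((p - q) * norm x) + (p - q) * (q * norm x)) = ((1 + p\<^sup>2)/2 - (1 + q\<^sup>2)/2) * norm x"
    by (simp add: power2_eq_square field_simps)
  also have "(1 + p\<^sup>2)/2 - (1 + q\<^sup>2)/2 = y (Suc (Suc n)) - y (Suc n)" by (simp add: p_def q_def)
  finally show ?case by simp
qed

lemma Y_diff_le:
  assumes "n \<le> m"
  shows "norm (Y m x - Y n x) \<le> (y m - y n) * norm x"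
  using assms
proof (induction m)
  case (Suc m)
  show ?case
  proof (cases "n = Suc m")
    case False
    then have "norm (Y m x - Y n x) \<le> (y m - y n) * norm x" using Suc by simp
    with Y_step have "norm (Y (Suc m) x - Y n x) \<le> (y (Suc m) - y m) * norm x + (y m - y n) * norm x"
      by (rule norm_diff_triangle_le)
    also have "\<dots> = (y (Suc m) - y n) * norm x" by (simp only: left_diff_distrib)
    finally show ?thesis .
  qed simp
qed simp

definition L :: "'a \<Rightarrow> 'a" where "L x = lim (\<lambda>n. Y n x)"

lemma Y_tendsto: "(\<lambda>n. Y n x) \<longlonglongrightarrow> L x"
proof -
  have "Cauchy (\<lambda>n. Y n x)"
  proof (rule CauchyI)
    fix e :: real assume e: "e > 0"
    have pos: "norm x + 1 > 0" by (simp add: add_nonneg_pos)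
    then have "e / (norm x + 1) > 0" using e by simp
    then obtain N where N: "\<And>m n. m \<ge> N \<Longrightarrow> n \<ge> N \<Longrightarrow> norm (y m - y n) < e / (norm x + 1)"
      using CauchyD[OF sqrt_iter_num_Cauchy] by metis
    have *: "norm (Y m x - Y n x) < e" if "m \<ge> n" "n \<ge> N" for m n
    proof -
      have "norm (Y m x - Y n x) \<le> (y m - y n) * norm x" by (rule Y_diff_le[OF that(1)])
      also have "\<dots> \<le> norm (y m - y n) * norm x" by (intro mult_right_mono) auto
      also have "\<dots> \<le> norm (y m - y n) * (norm x + 1)" by (intro mult_left_mono) auto
      also have "\<dots> < e / (norm x + 1) * (norm x + 1)"
        by (rule mult_strict_right_mono[OF N pos]) (use that in simp_all)
      also have "\<dots> = e" using pos by simp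
      finally show ?thesis .
    qed
    have "norm (Y m x - Y n x) < e" if "m \<ge> N" "n \<ge> N" for m n
      using *[of n m] *[of m n] that by (cases "m \<ge> n") (auto simp: norm_minus_commute)
    then show "\<exists>N. \<forall>m\<ge>N. \<forall>n\<ge>N. norm (Y m x - Y n x) < e" by blast
  qed
  then show ?thesis unfolding L_def by (simp add: Cauchy_convergent_iff convergent_LIMSEQ_iff)
qed

lemma norm_L: "norm (L x) \<le> norm x"
  by (rule LIMSEQ_le_const2[OF tendsto_norm[OF Y_tendsto]]) (simp add: norm_Y_le)

lemma bounded_L: "bounded_op UNIV L"
proof (rule bounded_opI[where B=1])
  show "L (u + v) = L u + L v" for u v
  proof (rule LIMSEQ_unique[OF Y_tendsto])
    show "(\<lambda>n. Y n (u + v)) \<longlonglongrightarrow> L u + L v"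
      using tendsto_add[OF Y_tendsto[of u] Y_tendsto[of v]]
      by (simp add: bounded_linear.linear[OF bounded_linear_Y, THEN linear_add])
  qed
  show "L (c *\<^sub>C u) = c *\<^sub>C L u" for c u
  proof (rule LIMSEQ_unique[OF Y_tendsto])
    show "(\<lambda>n. Y n (c *\<^sub>C u)) \<longlonglongrightarrow> c *\<^sub>C L u"
      using tendsto_scaleC[OF Y_tendsto[of u], of c]
      by (simp add: clinear_onD(3)[OF bounded_op_clinear[OF bounded_Y]])
  qed
qed (simp_all add: norm_L)

lemma Y_sym: "cinner (Y n u) v = cinner u (Y n v)"
  by (induction n arbitrary: u v) (simp_all add: cinner_distrib sym)

lemma L_sym: "cinner (L u) v = cinner u (L v)"
  by (rule LIMSEQ_unique[OF tendsto_cinner[OF Y_tendsto tendsto_const]])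
    (unfold Y_sym, intro tendsto_intros Y_tendsto)

lemma Y_commute:
  assumes "bounded_op UNIV C" "\<And>u. C (B u) = B (C u)"
  shows "C (Y n u) = Y n (C u)"
  by (induction n arbitrary: u)
    (simp_all add: assms(2) clinear_onD(2,3)[OF bounded_op_clinear[OF assms(1)]]
      clinear_on_0[OF bounded_op_clinear[OF assms(1)] complex_vector.subspace_UNIV])

lemma L_commute:
  assumes C: "bounded_op UNIV C" "\<And>u. C (B u) = B (C u)"
  shows "C (L u) = L (C u)"
proof (rule LIMSEQ_unique[OF _ Y_tendsto])
  show "(\<lambda>n. Y n (C u)) \<longlonglongrightarrow> C (L u)"
    unfolding Y_commute[OF C, symmetric]
    by (rule bounded_linear.tendsto[OF bounded_op_UNIV_bounded_linear[OF C(1)] Y_tendsto])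
qed

lemma L_eq: "L u + L u = B u + L (L u)"
proof -
  have "(\<lambda>n. Y n (Y n u)) \<longlonglongrightarrow> L (L u)"
  proof (rule Lim_transform[OF Y_tendsto])
    have le: "norm (Y n (Y n u) - Y n (L u)) \<le> norm (L u - Y n u)" for n
      using norm_Y_le[of n "L u - Y n u"]
      by (simp add: bounded_linear.linear[OF bounded_linear_Y, THEN linear_diff] norm_minus_commute)
    have "(\<lambda>n. norm (L u - Y n u)) \<longlonglongrightarrow> 0"
      using tendsto_norm[OF tendsto_diff[OF tendsto_const Y_tendsto[of u]], of "L u"] by simp
    with always_eventually[OF allI[OF le]] show "(\<lambda>n. Y n (Y n u) - Y n (L u)) \<longlonglongrightarrow> 0"
      by (rule Lim_null_comparison)
  qed
  then have "(\<lambda>n. Y (Suc n) u) \<longlonglongrightarrow> (1/2) *\<^sub>C (B u + L (L u))"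
    unfolding sqrt_iter.simps by (rule tendsto_scaleC[OF tendsto_add[OF tendsto_const]])
  with LIMSEQ_Suc[OF Y_tendsto[of u]] have "L u = (1/2) *\<^sub>C (B u + L (L u))"
    by (rule LIMSEQ_unique)
  then have "2 *\<^sub>C L u = 2 *\<^sub>C ((1/2) *\<^sub>C (B u + L (L u)))" by (rule arg_cong)
  then show ?thesis using scaleC_add_left[of 1 1 "L u"] by (simp only: scaleC_scaleC) simp
qed

lemma positive_root: "positive_op (\<lambda>x. x - L x)"
  unfolding positive_op_def
proof (intro conjI allI)
  show "bounded_op UNIV (\<lambda>x. x - L x)"
    by (rule bounded_op_diff[OF bounded_op_ident bounded_L complex_vector.subspace_UNIV])
  show "Im (cinner (x - L x) x) = 0" for x
  proof -
    have "cnj (cinner (L x) x) = cinner (L x) x" using L_sym cinner_commute by metis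
    then have "Im (cinner (L x) x) = 0" by (simp add: complex_eq_iff)
    then show ?thesis by (simp add: cinner_diff_left cinner_self)
  qed
  show "0 \<le> Re (cinner (x - L x) x)" for x
  proof -
    have "Re (cinner (L x) x) \<le> norm x * norm x"
      by (rule order_trans[OF Re_cinner_le mult_right_mono[OF norm_L]]) simp
    then show ?thesis by (simp add: cinner_diff_left Re_cinner_self power2_eq_square)
  qed
qed

lemma root_square: "(x - L x) - L (x - L x) = x - B x"
proof -
  have "L (x - L x) = L x - L (L x)"
    by (rule clinear_on_diff[OF bounded_op_clinear[OF bounded_L] complex_vector.subspace_UNIV]) simp_all
  moreover have "B x = L x + L x - L (L x)" by (simp add: L_eq)
  ultimately show ?thesis by (simp only:) (simp add: algebra_simps)
qed

text \<open>A second root \<open>R\<close> commutes with \<open>I - R\<^sup>2 = B\<close>, hence with the first one \<open>S\<close>; for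
  \<open>v = S x - R x\<close> the sum of the two positive numbers \<open>\<langle>S v, v\<rangle>\<close> and \<open>\<langle>R v, v\<rangle>\<close> is then
  \<open>\<langle>(S\<^sup>2 - R\<^sup>2) x, v\<rangle> = 0\<close>.\<close>

lemma root_unique:
  assumes R: "positive_op R" and sq: "\<And>x. R (R x) = x - B x"
  shows "R x = x - L x"
proof -
  define S where "S = (\<lambda>x. x - L x)"
  have bR: "bounded_op UNIV R" using R by (simp add: positive_op_def)
  have S: "positive_op S" unfolding S_def by (rule positive_root)
  have bS: "bounded_op UNIV S" using S by (simp add: positive_op_def)
  note R_diff = clinear_on_diff[OF bounded_op_clinear[OF bR] complex_vector.subspace_UNIV, simplified]
  note S_diff = clinear_on_diff[OF bounded_op_clinear[OF bS] complex_vector.subspace_UNIV, simplified]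
  have B_eq: "B u = u - R (R u)" for u by (simp add: sq)
  have "R (B u) = B (R u)" for u by (simp only: B_eq R_diff)
  then have RS: "R (S u) = S (R u)" for u
    unfolding S_def by (simp add: R_diff L_commute[OF bR])
  define v where "v = S x - R x"
  have "S v + R v = S (S x) - R (R x)" unfolding v_def by (simp add: S_diff R_diff RS)
  also have "\<dots> = 0" unfolding sq unfolding S_def by (simp add: root_square)
  finally have "S v + R v = 0" .
  then have "Re (cinner (S v) v) + Re (cinner (R v) v) = 0"
    by (metis cinner_add_left cinner_zero_left plus_complex.sel(1) zero_complex.sel(1))
  moreover have "0 \<le> Re (cinner (S v) v)" "0 \<le> Re (cinner (R v) v)"
    using R S by (auto simp: positive_op_def)
  ultimately have "Re (cinner (S v) v) = 0" "Re (cinner (R v) v) = 0" by linarith+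
  then have "S v = 0" "R v = 0" using positive_op_eq_0 R S by blast+
  then have "cinner v v = 0"
    unfolding v_def cinner_diff_right
    by (simp flip: positive_op_symmetric[OF S] positive_op_symmetric[OF R] add: v_def[symmetric])
  then show ?thesis by (simp add: cinner_self_eq_0 v_def S_def)
qed

lemma op_sqrt_eq: "op_sqrt (\<lambda>x. x - B x) = (\<lambda>x. x - L x)"
  unfolding op_sqrt_def
proof (rule the_equality)
  show "positive_op (\<lambda>x. x - L x) \<and> (\<lambda>x. x - L x) \<circ> (\<lambda>x. x - L x) = (\<lambda>x. x - B x)"
    by (simp add: positive_root root_square fun_eq_iff)
  show "R = (\<lambda>x. x - L x)" if "positive_op R \<and> R \<circ> R = (\<lambda>x. x - B x)" for R
    using that root_unique[of R] by (simp add: fun_eq_iff)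
qed

end

lemma csubspace_image:
  assumes A: "clinear_on M N A" and M: "csubspace M"
  shows "csubspace (A ` M)"
  unfolding complex_vector.subspace_def
proof (intro conjI ballI allI)
  show "0 \<in> A ` M" using clinear_on_0[OF A M] complex_vector.subspace_0[OF M] by (metis image_eqI)
  show "u + v \<in> A ` M" if u: "u \<in> A ` M" and v: "v \<in> A ` M" for u v
  proof -
    obtain x where x: "x \<in> M" "u = A x" using u by (rule imageE)
    obtain y where y: "y \<in> M" "v = A y" using v by (rule imageE)
    show ?thesis
      by (rule image_eqI[where x="x + y"])
        (simp_all add: x y clinear_onD(2)[OF A] complex_vector.subspace_add[OF M])
  qed
  show "c *\<^sub>C u \<in> A ` M" if u: "u \<in> A ` M" for c u
  proof -
    obtain x where x: "x \<in> M" "u = A x" using u by (rule imageE)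
    show ?thesis
      by (rule image_eqI[where x="c *\<^sub>C x"])
        (simp_all add: x clinear_onD(3)[OF A] complex_vector.subspace_scale[OF M])
  qed
qed

locale contraction =
  fixes S :: "'a::chilbert_space \<Rightarrow> 'a"
  assumes bounded: "bounded_op UNIV S" and contr: "norm (S x) \<le> norm x"
begin

sublocale gram: symmetric_contraction "\<lambda>x. cadj UNIV S (S x)"
proof
  show "bounded_op UNIV (\<lambda>x. cadj UNIV S (S x))"
    by (rule bounded_op_compose[OF bounded_op_cadj[OF hilbert_UNIV bounded] bounded])
  show "norm (cadj UNIV S (S x)) \<le> norm x" for x
    using cadj_norm_le[OF hilbert_UNIV bounded, of 1 "S x"] contr order_trans by fastforce
  show "cinner (cadj UNIV S (S x)) y = cinner x (cadj UNIV S (S y))" for x y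
    by (simp add: cadj[OF hilbert_UNIV bounded, symmetric] cadj_right[OF hilbert_UNIV bounded, symmetric])
qed

lemma defect_op_eq: "defect_op S = (\<lambda>x. x - gram.L x)"
  unfolding defect_op_def by (rule gram.op_sqrt_eq)

lemma positive_defect_op: "positive_op (defect_op S)"
  unfolding defect_op_eq by (rule gram.positive_root)

lemma bounded_defect_op: "bounded_op UNIV (defect_op S)"
  using positive_defect_op by (simp add: positive_op_def)

lemma defect_op_sym: "cinner (defect_op S x) y = cinner x (defect_op S y)"
  by (rule positive_op_symmetric[OF positive_defect_op])

lemma defect_op_square: "defect_op S (defect_op S x) = x - cadj UNIV S (S x)"
  unfolding defect_op_eq by (rule gram.root_square)

lemma norm_defect_op: "(norm (defect_op S x))\<^sup>2 = (norm x)\<^sup>2 - (norm (S x))\<^sup>2"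
proof -
  have "cinner (defect_op S x) (defect_op S x) = cinner x x - cinner x (cadj UNIV S (S x))"
    by (simp add: defect_op_sym defect_op_square cinner_diff_right)
  also have "cinner x (cadj UNIV S (S x)) = cinner (S x) (S x)"
    by (simp add: cadj[OF hilbert_UNIV bounded])
  finally have "Re (cinner (defect_op S x) (defect_op S x)) = Re (cinner x x) - Re (cinner (S x) (S x))"
    by simp
  then show ?thesis by (simp only: Re_cinner_self)
qed

lemma defect_op_in: "defect_op S x \<in> defect_space S"
  unfolding defect_space_def by (rule subsetD[OF closure_subset]) (rule rangeI)

lemma hilbert_defect_space: "hilbert (defect_space S)"
proof -
  have "csubspace (range (defect_op S))"
    by (rule csubspace_image[OF bounded_op_clinear[OF bounded_defect_op] complex_vector.subspace_UNIV])
  then show ?thesis unfolding hilbert_def defect_space_def by (simp add: csubspace_closure)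
qed

text \<open>The kernel of a symmetric operator is orthogonal to its range.\<close>

lemma defect_op_inj:
  assumes y: "y \<in> defect_space S" and 0: "defect_op S y = 0"
  shows "y = 0"
proof -
  have "closed {z. cinner y z = 0}"
    by (intro closed_Collect_eq continuous_intros)
  moreover have "range (defect_op S) \<subseteq> {z. cinner y z = 0}"
    using 0 by (auto simp flip: defect_op_sym)
  ultimately have "defect_space S \<subseteq> {z. cinner y z = 0}"
    unfolding defect_space_def by (rule closure_minimal[rotated])
  then show ?thesis using y cinner_self_eq_0 by auto
qed

end

section \<open>The von Neumann inequality over the tetrablock\<close>

text \<open>For fixed \<open>w\<close> the defining expression is affine in \<open>z\<close>, and the bound says that its zero lies
  outside the closed unit disc.\<close>

lemma tetrablock_bound:
  assumes "(x1, x2, x3) \<in> tetrablock" "cmod w \<le> 1"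
  shows "cmod (x1 - w * x3) < cmod (1 - w * x2)"
proof (rule ccontr)
  assume "\<not> ?thesis"
  then have le: "cmod (1 - w * x2) \<le> cmod (x1 - w * x3)" by simp
  have ne: "1 - z * x1 - w * x2 + z * w * x3 \<noteq> 0" if "cmod z \<le> 1" for z
    using assms that by (auto simp: tetrablock_def)
  have "x1 - w * x3 \<noteq> 0" using le ne[of 0] by auto
  \<comment> \<open>the zero of the defining expression as a function of its first variable\<close>
  define z where "z = (1 - w * x2) / (x1 - w * x3)"
  have "z * (x1 - w * x3) = 1 - w * x2" using \<open>x1 - w * x3 \<noteq> 0\<close> by (simp add: z_def)
  then have "1 - z * x1 - w * x2 + z * w * x3 = 0" by (simp add: algebra_simps)
  moreover have "cmod z \<le> 1" using le \<open>x1 - w * x3 \<noteq> 0\<close> by (simp add: z_def norm_divide)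
  ultimately show False using ne by blast
qed

lemma tetrablock_swap: "(x1, x2, x3) \<in> tetrablock \<Longrightarrow> (x2, x1, x3) \<in> tetrablock"
  unfolding tetrablock_def
proof clarsimp
  fix z w
  assume "\<forall>z. cmod z \<le> 1 \<longrightarrow> (\<forall>w. cmod w \<le> 1 \<longrightarrow> 1 - z * x1 - w * x2 + z * w * x3 \<noteq> 0)"
    and "cmod z \<le> 1" "cmod w \<le> 1"
  then have "1 - w * x1 - z * x2 + w * z * x3 \<noteq> 0" by blast
  moreover assume "1 - z * x2 - w * x1 + z * w * x3 = 0"
  ultimately show False by (simp add: algebra_simps)
qed

lemma tetrablock_cmod_3:
  assumes x: "(x1, x2, x3) \<in> tetrablock"
  shows "cmod x3 \<le> 1"
proof -
  \<comment> \<open>the parallelogram law turns the bounds at \<open>w = 1\<close> and \<open>w = -1\<close> into one on squares\<close>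
  have *: "(cmod a)\<^sup>2 + (cmod x3)\<^sup>2 \<le> 1 + (cmod b)\<^sup>2"
    if ab: "(a, b, x3) \<in> tetrablock" for a b
  proof -
    have "(cmod (a - x3))\<^sup>2 \<le> (cmod (1 - b))\<^sup>2" "(cmod (a + x3))\<^sup>2 \<le> (cmod (1 + b))\<^sup>2"
      using tetrablock_bound[OF ab, of 1] tetrablock_bound[OF ab, of "-1"] by (simp_all add: power_mono)
    moreover have "(cmod (p + q))\<^sup>2 + (cmod (p - q))\<^sup>2 = 2 * (cmod p)\<^sup>2 + 2 * (cmod q)\<^sup>2" for p q :: complex
      by (simp add: norm_sq_add norm_sq_diff)
    from this[of a x3] this[of 1 b]
    have "(cmod (a + x3))\<^sup>2 + (cmod (a - x3))\<^sup>2 = 2 * (cmod a)\<^sup>2 + 2 * (cmod x3)\<^sup>2"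
      "(cmod (1 + b))\<^sup>2 + (cmod (1 - b))\<^sup>2 = 2 + 2 * (cmod b)\<^sup>2" by simp_all
    ultimately show ?thesis by linarith
  qed
  have "(cmod x3)\<^sup>2 \<le> 1\<^sup>2" using *[OF x] *[OF tetrablock_swap[OF x]] by simp
  then show ?thesis by (rule power2_le_imp_le) simp
qed

lemma closure_tetrablock_le:
  fixes f g :: "complex \<times> complex \<times> complex \<Rightarrow> real"
  assumes x: "x \<in> closure tetrablock" and "\<And>x. x \<in> tetrablock \<Longrightarrow> f x \<le> g x"
    and "continuous_on UNIV f" "continuous_on UNIV g"
  shows "f x \<le> g x"
proof -
  have "closed {x. f x \<le> g x}" using assms(3,4) by (rule closed_Collect_le)
  moreover have "tetrablock \<subseteq> {x. f x \<le> g x}" using assms(2) by auto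
  ultimately have "closure tetrablock \<subseteq> {x. f x \<le> g x}" by (intro closure_minimal)
  then show ?thesis using x by blast
qed

lemma closure_tetrablock_bound:
  assumes x: "(x1, x2, x3) \<in> closure tetrablock" and w: "cmod w \<le> 1"
  shows "cmod (x1 - w * x3) \<le> cmod (1 - w * x2)"
proof -
  have "cmod (fst y - w * snd (snd y)) \<le> cmod (1 - w * fst (snd y))" if "y \<in> tetrablock" for y
    using tetrablock_bound[of "fst y" "fst (snd y)" "snd (snd y)", OF _ w] that by simp
  then have "cmod (fst (x1, x2, x3) - w * snd (snd (x1, x2, x3))) \<le> cmod (1 - w * fst (snd (x1, x2, x3)))"
    by (rule closure_tetrablock_le[OF x]) (assumption | intro continuous_intros)+
  then show ?thesis by simp
qed

lemma closure_tetrablock_cmod_3: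
  assumes x: "(x1, x2, x3) \<in> closure tetrablock"
  shows "cmod x3 \<le> 1"
proof -
  have "cmod (snd (snd y)) \<le> 1" if "y \<in> tetrablock" for y
    using tetrablock_cmod_3[of "fst y" "fst (snd y)" "snd (snd y)"] that by simp
  then have "cmod (snd (snd (x1, x2, x3))) \<le> 1"
    by (rule closure_tetrablock_le[OF x]) (assumption | intro continuous_intros)+
  then show ?thesis by simp
qed

lemma closure_tetrablock_swap:
  assumes x: "(x1, x2, x3) \<in> closure tetrablock"
  shows "(x2, x1, x3) \<in> closure tetrablock"
proof -
  let ?s = "\<lambda>x :: complex \<times> complex \<times> complex. (fst (snd x), fst x, snd (snd x))"
  have "?s ` closure tetrablock \<subseteq> closure (?s ` tetrablock)"
    by (rule image_closure_subset[OF _ closed_closure closure_subset]) (intro continuous_intros)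
  also have "?s ` tetrablock \<subseteq> tetrablock" using tetrablock_swap by auto
  then have "closure (?s ` tetrablock) \<subseteq> closure tetrablock" by (rule closure_mono)
  finally have "?s (x1, x2, x3) \<in> closure tetrablock" using x by blast
  then show ?thesis by simp
qed

lemma closure_tetrablock_cmod_1:
  assumes x: "(x1, x2, x3) \<in> closure tetrablock"
  shows "cmod x1 \<le> 1"
  using closure_tetrablock_bound[OF x, of 0] by simp

lemma tetrablock_zero: "(0, 0, 0) \<in> tetrablock"
  by (simp add: tetrablock_def)

lemma bounded_op_sum:
  assumes "\<And>i. i \<in> I \<Longrightarrow> bounded_op UNIV (f i)"
  shows "bounded_op UNIV (\<lambda>x. \<Sum>i\<in>I. f i x)"
  using assms
proof (induction I rule: infinite_finite_induct)
  case (insert i I)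
  then show ?case
    using bounded_op_add[of UNIV "f i" "\<lambda>x. \<Sum>i\<in>I. f i x"] by (simp add: complex_vector.subspace_UNIV)
qed (auto intro!: bounded_opI[where B=0])

text \<open>The von Neumann inequality, with an arbitrary bound \<open>B\<close> in place of the supremum. The conditions
  are symmetric in the first two entries, so whatever follows from them holds with \<open>T1\<close> and \<open>T2\<close>
  exchanged.\<close>

locale tetra_contraction =
  fixes T1 T2 T3 :: "'a::chilbert_space \<Rightarrow> 'a"
  assumes commuting: "commuting_triple T1 T2 T3"
    and von_Neumann: "\<And>N c B h. (\<And>x. x \<in> closure tetrablock \<Longrightarrow> cmod (poly3 N c x) \<le> B) \<Longrightarrow>
      norm (op_poly3 N c T1 T2 T3 h) \<le> B * norm h"
begin

lemma bounded: "bounded_op UNIV T1" "bounded_op UNIV T2" "bounded_op UNIV T3"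
  using commuting by (auto simp: commuting_triple_def)

lemma comp_commute: "T1 \<circ> T2 = T2 \<circ> T1" "T1 \<circ> T3 = T3 \<circ> T1" "T2 \<circ> T3 = T3 \<circ> T2"
  using commuting by (auto simp: commuting_triple_def)

lemma commute: "T1 (T2 h) = T2 (T1 h)" "T1 (T3 h) = T3 (T1 h)" "T2 (T3 h) = T3 (T2 h)"
  using comp_commute[THEN fun_cong, of h] by simp_all

lemma funpow_commute: "T1 ((T2 ^^ j) h) = (T2 ^^ j) (T1 h)"
  by (induction j) (simp_all add: commute)

lemma funpow_funpow_commute: "(T1 ^^ i) ((T2 ^^ j) h) = (T2 ^^ j) ((T1 ^^ i) h)"
  by (induction i arbitrary: h) (simp_all add: funpow_commute)

end

lemma E_contraction_tetra_contraction:
  assumes E: "E_contraction T1 T2 T3"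
  shows "tetra_contraction T1 T2 T3"
proof
  show c: "commuting_triple T1 T2 T3" using E by (simp add: E_contraction_def)
  then have b: "bounded_op UNIV T1" "bounded_op UNIV T2" "bounded_op UNIV T3"
    by (simp_all add: commuting_triple_def)
  fix N c B h
  assume B: "\<And>x. x \<in> closure tetrablock \<Longrightarrow> cmod (poly3 N c x) \<le> B"
  have "bounded_op UNIV (\<lambda>h. c i j k *\<^sub>C (T1 ^^ i) ((T2 ^^ j) ((T3 ^^ k) h)))" for i j k
    by (rule bounded_op_scaleC[OF bounded_op_compose[OF bounded_op_funpow[OF b(1)]
        bounded_op_compose[OF bounded_op_funpow[OF b(2)] bounded_op_funpow[OF b(3)]]]
        complex_vector.subspace_UNIV])
  then have "bounded_op UNIV (op_poly3 N c T1 T2 T3)"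
    unfolding op_poly3_def[abs_def] by (rule bounded_op_sum[OF bounded_op_sum[OF bounded_op_sum]])
  then have "norm (op_poly3 N c T1 T2 T3 h) \<le> onorm (op_poly3 N c T1 T2 T3) * norm h"
    by (rule onorm[OF bounded_op_UNIV_bounded_linear])
  also have "onorm (op_poly3 N c T1 T2 T3) \<le> (SUP x\<in>closure tetrablock. cmod (poly3 N c x))"
    using E by (simp add: E_contraction_def)
  also have "\<dots> \<le> B"
    using tetrablock_zero closure_subset[of tetrablock] by (intro cSUP_least B) auto
  finally show "norm (op_poly3 N c T1 T2 T3 h) \<le> B * norm h" by (simp add: mult_right_mono)
qed

context tetra_contraction
begin

lemma swap: "tetra_contraction T2 T1 T3"
proof
  show "commuting_triple T2 T1 T3" using commuting by (simp add: commuting_triple_def)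
  fix N c B h
  assume B: "\<And>x. x \<in> closure tetrablock \<Longrightarrow> cmod (poly3 N c x) \<le> B"
  let ?c = "\<lambda>i j k. c j i k"
  have "cmod (poly3 N ?c (x1, x2, x3)) \<le> B" if "(x1, x2, x3) \<in> closure tetrablock" for x1 x2 x3
  proof -
    have "poly3 N ?c (x1, x2, x3) = poly3 N c (x2, x1, x3)"
      unfolding poly3_def by (simp, subst sum.swap) (simp add: ac_simps)
    then show ?thesis using B[OF closure_tetrablock_swap[OF that]] by simp
  qed
  then have "norm (op_poly3 N ?c T1 T2 T3 h) \<le> B * norm h"
    by (intro von_Neumann) (metis prod_cases3)
  also have "op_poly3 N ?c T1 T2 T3 h = op_poly3 N c T2 T1 T3 h"
    unfolding op_poly3_def by (subst sum.swap) (simp add: funpow_funpow_commute)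
  finally show "norm (op_poly3 N c T2 T1 T3 h) \<le> B * norm h" .
qed

lemma norm_T3_le: "norm (T3 h) \<le> norm h"
  using von_Neumann[of "Suc 0" "\<lambda>i j k. if i = 0 \<and> j = 0 \<and> k = Suc 0 then 1 else 0" 1 h]
    closure_tetrablock_cmod_3
  by (force simp: poly3_def op_poly3_def)

lemma norm_T1_le: "norm (T1 h) \<le> norm h"
  using von_Neumann[of "Suc 0" "\<lambda>i j k. if i = Suc 0 \<and> j = 0 \<and> k = 0 then 1 else 0" 1 h]
    closure_tetrablock_cmod_1
  by (force simp: poly3_def op_poly3_def)

end

lemma sum_atMost_two:
  assumes "N \<ge> 1" "\<And>i. i \<ge> 2 \<Longrightarrow> f i = 0"
  shows "(\<Sum>i\<le>N. f i) = f 0 + f (1::nat)"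
proof -
  have "(\<Sum>i\<le>N. f i) = (\<Sum>i\<in>{0, 1}. f i)"
    by (rule sum.mono_neutral_right) (use assms in \<open>auto simp: numeral_2_eq_2 Suc_le_eq\<close>)
  then show ?thesis by simp
qed

lemma tendsto_ident_scaled: "(\<lambda>n. complex_of_real (1 - inverse (real (Suc n))) * z) \<longlonglongrightarrow> z"
proof -
  have "(\<lambda>n. complex_of_real (1 - inverse (real (Suc n))) * z) \<longlonglongrightarrow> complex_of_real (1 - 0) * z"
    by (intro tendsto_intros LIMSEQ_inverse_real_of_nat)
  then show ?thesis by simp
qed

lemma cmod_le_if_Re_le:
  assumes "\<And>z. cmod z = 1 \<Longrightarrow> Re (cnj z * b) \<le> r"
  shows "cmod b \<le> r"
proof (cases "b = 0")
  case True
  then show ?thesis using assms[of 1] by simp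
next
  case False
  define z where "z = b / complex_of_real (cmod b)"
  have "cmod z = 1" using False by (simp add: z_def norm_divide)
  moreover have "cnj z * b = complex_of_real (cmod b)"
    using False complex_norm_square[of b] by (simp add: z_def power2_eq_square field_simps)
  ultimately show ?thesis using assms[of z] by simp
qed

context tetra_contraction
begin

abbreviation "S1 \<equiv> cadj UNIV T1"
abbreviation "S2 \<equiv> cadj UNIV T2"
abbreviation "S3 \<equiv> cadj UNIV T3"

lemma norm_T2_le: "norm (T2 h) \<le> norm h"
  by (rule tetra_contraction.norm_T1_le[OF swap])

lemmas linear_simps = clinear_onD(2,3)[OF bounded_op_clinear[OF bounded(1)], OF UNIV_I]
  clinear_onD(2,3)[OF bounded_op_clinear[OF bounded(2)], OF UNIV_I]
  clinear_onD(2,3)[OF bounded_op_clinear[OF bounded(3)], OF UNIV_I]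

text \<open>The left-hand side is the value at \<open>h\<close> of a polynomial in the triple, and that polynomial equals
  \<open>(x1 - v x3) / (1 - v x2)\<close> times \<open>1 - (v x2)\<^sup>N\<^sup>+\<^sup>1\<close>.\<close>

lemma geometric_vector_bound:
  assumes v: "cmod v < 1" and N: "N \<ge> 1"
  shows "norm (\<Sum>j\<le>N. v ^ j *\<^sub>C (T2 ^^ j) (T1 h - v *\<^sub>C T3 h)) \<le> (1 + cmod v ^ Suc N) * norm h"
proof -
  \<comment> \<open>the coefficients of \<open>(x1 - v x3) (1 + v x2 + \<dots> + (v x2)\<^sup>N)\<close>\<close>
  define c where "c = (\<lambda>i j k. if i = 1 then if k = 0 then v ^ j else 0
    else if i = (0::nat) then if k = (1::nat) then - (v ^ Suc j) else 0 else 0)"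
  have c: "c 1 j 0 = v ^ j" "c 0 j 1 = - (v ^ Suc j)" "c 0 j 0 = 0" "c 1 j 1 = 0"
    "k \<ge> 2 \<Longrightarrow> c i j k = 0" "i \<ge> 2 \<Longrightarrow> c i j k = 0" for i j k
    by (simp_all add: c_def)
  have op: "op_poly3 N c T1 T2 T3 h = (\<Sum>j\<le>N. v ^ j *\<^sub>C (T2 ^^ j) (T1 h - v *\<^sub>C T3 h))"
  proof -
    have lin: "(T2 ^^ j) (x - v *\<^sub>C y) = (T2 ^^ j) x - v *\<^sub>C (T2 ^^ j) y" for j x y
      using clinear_on_diff[OF bounded_op_clinear[OF bounded_op_funpow[OF bounded(2)]] complex_vector.subspace_UNIV]
        clinear_onD(3)[OF bounded_op_clinear[OF bounded_op_funpow[OF bounded(2)]]] by simp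
    have "op_poly3 N c T1 T2 T3 h = (\<Sum>j\<le>N. - (v ^ Suc j) *\<^sub>C (T2 ^^ j) (T3 h)) + (\<Sum>j\<le>N. v ^ j *\<^sub>C T1 ((T2 ^^ j) h))"
      unfolding op_poly3_def by (simp add: sum_atMost_two[OF N] c[simplified])
    also have "\<dots> = (\<Sum>j\<le>N. v ^ j *\<^sub>C T1 ((T2 ^^ j) h) - v ^ Suc j *\<^sub>C (T2 ^^ j) (T3 h))"
      by (simp add: sum_subtractf sum_negf)
    also have "\<dots> = (\<Sum>j\<le>N. v ^ j *\<^sub>C (T2 ^^ j) (T1 h - v *\<^sub>C T3 h))"
      by (simp add: lin funpow_commute complex_vector.scale_right_diff_distrib scaleC_scaleC mult.commute)
    finally show ?thesis .
  qed
  have "cmod (poly3 N c (x1, x2, x3)) \<le> 1 + cmod v ^ Suc N"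
    if x: "(x1, x2, x3) \<in> closure tetrablock" for x1 x2 x3
  proof -
    let ?g = "\<Sum>j\<le>N. (v * x2) ^ j"
    have "poly3 N c (x1, x2, x3) = (\<Sum>j\<le>N. - (v ^ Suc j) * x2 ^ j * x3) + (\<Sum>j\<le>N. v ^ j * x1 * x2 ^ j)"
      unfolding poly3_def by (simp add: sum_atMost_two[OF N] c[simplified])
    also have "\<dots> = (x1 - v * x3) * ?g"
      unfolding sum.distrib[symmetric] sum_distrib_left
      by (intro sum.cong refl) (simp add: power_mult_distrib algebra_simps)
    also have "cmod \<dots> \<le> cmod (1 - v * x2) * cmod ?g"
      unfolding norm_mult using closure_tetrablock_bound[OF x, of v] v by (simp add: mult_right_mono)
    also have "\<dots> = cmod (1 - (v * x2) ^ Suc N)"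
      unfolding norm_mult[symmetric] by (simp only: one_diff_power_eq lessThan_Suc_atMost)
    also have "\<dots> \<le> 1 + (cmod v * cmod x2) ^ Suc N"
      using norm_triangle_ineq4[of 1 "(v * x2) ^ Suc N"] by (simp only: norm_power norm_mult norm_one)
    also have "\<dots> \<le> 1 + cmod v ^ Suc N"
      using closure_tetrablock_cmod_1[OF closure_tetrablock_swap[OF x]]
      by (intro add_left_mono power_mono) (auto simp: mult_left_le)
    finally show ?thesis .
  qed
  then have "norm (op_poly3 N c T1 T2 T3 h) \<le> (1 + cmod v ^ Suc N) * norm h"
    by (intro von_Neumann) (metis prod_cases3)
  then show ?thesis by (simp only: op)
qed

lemma geometric_vector_telescope:
  "(\<Sum>j\<le>N. v ^ j *\<^sub>C (T2 ^^ j) w) - v *\<^sub>C T2 (\<Sum>j\<le>N. v ^ j *\<^sub>C (T2 ^^ j) w)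
    = w - v ^ Suc N *\<^sub>C (T2 ^^ Suc N) w"
proof (induction N)
  case (Suc N)
  define r q where "r = (\<Sum>j\<le>N. v ^ j *\<^sub>C (T2 ^^ j) w)" and "q = v ^ Suc N *\<^sub>C (T2 ^^ Suc N) w"
  have IH: "r - v *\<^sub>C T2 r = w - q" using Suc by (simp only: r_def q_def)
  have "(r + q) - v *\<^sub>C T2 (r + q) = (r - v *\<^sub>C T2 r) + q - v *\<^sub>C T2 q"
    by (simp add: linear_simps scaleC_add_right)
  also have "\<dots> = w - v *\<^sub>C T2 q" by (simp add: IH)
  also have "v *\<^sub>C T2 q = v ^ Suc (Suc N) *\<^sub>C (T2 ^^ Suc (Suc N)) w"
    by (simp add: q_def linear_simps scaleC_scaleC)
  finally show ?case by (simp only: r_def q_def sum.atMost_Suc)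
qed simp

text \<open>The function \<open>(x1 - v x3) / (1 - v x2)\<close> is bounded by \<open>1\<close> on the closed tetrablock. The von Neumann
  inequality for the truncations of its geometric series, read in the adjoint form, becomes
  an inequality between two norms that no longer contains an inverse.\<close>

lemma adjoint_linear_fractional_bound_open:
  assumes z: "cmod z < 1"
  shows "norm (S1 y - z *\<^sub>C S3 y) \<le> norm (y - z *\<^sub>C S2 y)"
proof -
  define v where "v = cnj z"
  define h where "h = S1 y - z *\<^sub>C S3 y"
  define u where "u = y - z *\<^sub>C S2 y"
  define w where "w = T1 h - v *\<^sub>C T3 h"
  have v: "cmod v < 1" using z by (simp add: v_def)
  note adj = cadj[OF hilbert_UNIV bounded(1) UNIV_I, symmetric] cadj[OF hilbert_UNIV bounded(2) UNIV_I, symmetric]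
    cadj[OF hilbert_UNIV bounded(3) UNIV_I, symmetric]
  have T2_pow: "norm ((T2 ^^ n) x) \<le> norm x" for n x
    by (induction n) (auto intro: order_trans[OF norm_T2_le])
  have "cmod (cinner (w - v ^ Suc N *\<^sub>C (T2 ^^ Suc N) w) y) \<le> (1 + cmod v ^ Suc N) * norm h * norm u"
    if N: "N \<ge> 1" for N
  proof -
    let ?r = "\<Sum>j\<le>N. v ^ j *\<^sub>C (T2 ^^ j) w"
    have "cinner (w - v ^ Suc N *\<^sub>C (T2 ^^ Suc N) w) y = cinner ?r u"
      unfolding geometric_vector_telescope[symmetric] u_def by (simp add: cinner_distrib adj v_def)
    then have "cmod (cinner (w - v ^ Suc N *\<^sub>C (T2 ^^ Suc N) w) y) \<le> norm ?r * norm u"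
      by (simp only: norm_cinner_le)
    also have "\<dots> \<le> (1 + cmod v ^ Suc N) * norm h * norm u"
      unfolding w_def by (intro mult_right_mono geometric_vector_bound[OF v N]) simp
    finally show ?thesis .
  qed
  moreover have "(\<lambda>N. (1 + cmod v ^ Suc N) * norm h * norm u) \<longlonglongrightarrow> (1 + 0) * norm h * norm u"
    by (intro tendsto_intros LIMSEQ_Suc[OF LIMSEQ_power_zero]) (use v in simp)
  moreover have "(\<lambda>N. cmod (cinner (w - v ^ Suc N *\<^sub>C (T2 ^^ Suc N) w) y)) \<longlonglongrightarrow> cmod (cinner (w - 0) y)"
  proof (intro tendsto_intros)
    have "(\<lambda>N. cmod v ^ Suc N * norm w) \<longlonglongrightarrow> 0 * norm w"
      by (intro tendsto_intros LIMSEQ_Suc[OF LIMSEQ_power_zero]) (use v in simp)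
    moreover have "norm (v ^ Suc N *\<^sub>C (T2 ^^ Suc N) w) \<le> cmod v ^ Suc N * norm w" for N
      unfolding norm_scaleC norm_power by (intro mult_left_mono T2_pow) simp
    ultimately show "(\<lambda>N. v ^ Suc N *\<^sub>C (T2 ^^ Suc N) w) \<longlonglongrightarrow> 0"
      using Lim_null_comparison[OF always_eventually[OF allI]] by (metis (no_types, lifting) mult_zero_left)
  qed
  ultimately have "cmod (cinner (w - 0) y) \<le> (1 + 0) * norm h * norm u"
    by (intro LIMSEQ_le) blast+
  moreover have "cinner w y = cinner h h"
    by (simp add: w_def cinner_distrib h_def v_def cadj[OF hilbert_UNIV bounded(1)] cadj[OF hilbert_UNIV bounded(3)])
  ultimately have "norm h * norm h \<le> norm h * norm u"
    by (simp add: cinner_self norm_power norm_mult power2_eq_square del: of_real_power)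
  then show ?thesis unfolding h_def[symmetric] u_def[symmetric] by (cases "h = 0") auto
qed

lemma adjoint_linear_fractional_bound:
  assumes z: "cmod z = 1"
  shows "norm (S1 y - z *\<^sub>C S3 y) \<le> norm (y - z *\<^sub>C S2 y)"
proof -
  define r where "r n = complex_of_real (1 - inverse (real (Suc n))) * z" for n
  have r: "r \<longlonglongrightarrow> z" unfolding r_def by (rule tendsto_ident_scaled)
  have lim: "(\<lambda>n. r n *\<^sub>C x) \<longlonglongrightarrow> z *\<^sub>C x" for x :: 'a
  proof -
    have "(\<lambda>n. cmod (r n - z) * norm x) \<longlonglongrightarrow> 0 * norm x"
      by (intro tendsto_intros tendsto_norm_zero LIM_zero r)
    then have "(\<lambda>n. norm (r n *\<^sub>C x - z *\<^sub>C x)) \<longlonglongrightarrow> 0"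
      by (simp add: norm_scaleC flip: complex_vector.scale_left_diff_distrib)
    then show ?thesis by (rule LIM_zero_cancel[OF tendsto_norm_zero_cancel])
  qed
  have "cmod (r n) < 1" for n
  proof -
    have "\<bar>1 - inverse (real (Suc n))\<bar> < 1" by (simp add: field_simps)
    then show ?thesis by (simp only: r_def norm_mult norm_of_real z mult_1_right)
  qed
  note open_bound = adjoint_linear_fractional_bound_open[OF this]
  show ?thesis
  proof (rule LIMSEQ_le)
    show "(\<lambda>n. norm (S1 y - r n *\<^sub>C S3 y)) \<longlonglongrightarrow> norm (S1 y - z *\<^sub>C S3 y)"
      by (intro tendsto_norm tendsto_diff tendsto_const lim)
    show "(\<lambda>n. norm (y - r n *\<^sub>C S2 y)) \<longlonglongrightarrow> norm (y - z *\<^sub>C S2 y)"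
      by (intro tendsto_norm tendsto_diff tendsto_const lim)
  qed (use open_bound in blast)
qed

text \<open>Square the preceding inequality, expand, and choose the phase of \<open>z\<close> that makes the mixed terms
  as large as possible.\<close>

lemma adjoint_form_bound_half:
  "2 * cmod (cinner (S2 y) y - cinner (S3 y) (S1 y))
    \<le> (norm y)\<^sup>2 + (norm (S2 y))\<^sup>2 - (norm (S1 y))\<^sup>2 - (norm (S3 y))\<^sup>2"
proof -
  define b where "b = cinner y (S2 y) - cinner (S1 y) (S3 y)"
  define r where "r = ((norm y)\<^sup>2 + (norm (S2 y))\<^sup>2 - (norm (S1 y))\<^sup>2 - (norm (S3 y))\<^sup>2) / 2"
  have "cmod b \<le> r"
  proof (rule cmod_le_if_Re_le)
    fix z assume z: "cmod z = 1"
    have "(norm (S1 y - z *\<^sub>C S3 y))\<^sup>2 \<le> (norm (y - z *\<^sub>C S2 y))\<^sup>2"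
      by (intro power_mono adjoint_linear_fractional_bound z) simp
    then show "Re (cnj z * b) \<le> r"
      by (simp add: norm_sq_diff norm_scaleC z cinner_scaleC_right b_def r_def right_diff_distrib field_simps)
  qed
  moreover have "cnj b = cinner (S2 y) y - cinner (S3 y) (S1 y)"
    unfolding b_def complex_cnj_diff by (simp flip: cinner_commute)
  then have "cmod (cinner (S2 y) y - cinner (S3 y) (S1 y)) = cmod b" by (metis complex_mod_cnj)
  ultimately show ?thesis by (simp add: r_def)
qed

text \<open>The squared norms of \<open>S1 y\<close> and \<open>S2 y\<close> cancel between the two exchanged versions.\<close>

lemma adjoint_form_bound:
  "cmod (cinner (S1 y) y - cinner (S3 y) (S2 y)) + cmod (cinner (S2 y) y - cinner (S3 y) (S1 y))
    \<le> (norm y)\<^sup>2 - (norm (S3 y))\<^sup>2"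
  using adjoint_form_bound_half[of y] tetra_contraction.adjoint_form_bound_half[OF swap, of y] by linarith

lemma contraction_S3: "contraction S3"
proof
  show "bounded_op UNIV S3" by (rule bounded_op_cadj[OF hilbert_UNIV bounded(3)])
  show "norm (S3 x) \<le> norm x" for x
    using cadj_norm_le[OF hilbert_UNIV bounded(3), of 1 x] norm_T3_le by simp
qed

end

section \<open>Fundamental operators\<close>

locale fundamental_pair = tetra_contraction +
  fixes A1 A2 :: "'a \<Rightarrow> 'a"
  assumes fundamental: "fundamental_operators S1 S2 S3 A1 A2"
begin

lemma swap_fundamental: "fundamental_pair T2 T1 T3 A2 A1"
  using swap fundamental
  by (auto simp: fundamental_pair_def fundamental_pair_axioms_def fundamental_operators_def)

sublocale defect: contraction S3
  by (rule contraction_S3)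

abbreviation "D \<equiv> defect_op S3"
abbreviation "\<D> \<equiv> defect_space S3"

lemma bounded_A: "bounded_op \<D> A1" "bounded_op \<D> A2"
  using fundamental by (auto simp: fundamental_operators_def)

lemma fundamental_eq:
  "D (A1 (D x)) = S1 x - T2 (S3 x)" "D (A2 (D x)) = S2 x - T1 (S3 x)"
  using fundamental by (simp_all add: fundamental_operators_def cadj_cadj bounded)

lemma hilbert_D: "hilbert \<D>" by (rule defect.hilbert_defect_space)

lemma csubspace_D: "csubspace \<D>" using hilbert_D by (simp add: hilbert_def)

lemmas T_adjoint = cadj[OF hilbert_UNIV bounded(1) UNIV_I] cadj[OF hilbert_UNIV bounded(2) UNIV_I]
  cadj[OF hilbert_UNIV bounded(3) UNIV_I]

text \<open>For \<open>y = D x\<close> the left-hand side is \<open>adjoint_form_bound\<close> at \<open>x\<close>, by the fundamental equations; such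
  vectors are dense in the defect space.\<close>

lemma numerical_radius_bound:
  assumes y: "y \<in> \<D>"
  shows "cmod (cinner (A1 y) y) + cmod (cinner (A2 y) y) \<le> (norm y)\<^sup>2"
proof -
  have range: "cmod (cinner (A1 (D x)) (D x)) + cmod (cinner (A2 (D x)) (D x)) \<le> (norm (D x))\<^sup>2" for x
    using adjoint_form_bound[of x]
    by (simp add: defect.norm_defect_op fundamental_eq cinner_diff_left T_adjoint flip: defect.defect_op_sym)
  obtain f where f: "\<And>n. f n \<in> range D" "f \<longlonglongrightarrow> y"
    using y unfolding defect_space_def closure_sequential by blast
  have fD: "f n \<in> \<D>" for n using f(1)[of n] defect.defect_op_in by auto
  have lim: "(\<lambda>n. A (f n)) \<longlonglongrightarrow> A y" if A: "bounded_op \<D> A" for A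
  proof -
    obtain B where B: "\<And>x. x \<in> \<D> \<Longrightarrow> norm (A x) \<le> B * norm x" using bounded_opE[OF A] by metis
    have le: "norm (A (f n) - A y) \<le> B * norm (f n - y)" for n
      using B[OF complex_vector.subspace_diff[OF csubspace_D fD y]]
        clinear_on_diff[OF bounded_op_clinear[OF A] csubspace_D fD y] by simp
    have "(\<lambda>n. B * norm (f n - y)) \<longlonglongrightarrow> B * 0"
      by (intro tendsto_intros tendsto_norm_zero LIM_zero f(2))
    then have "(\<lambda>n. B * norm (f n - y)) \<longlonglongrightarrow> 0" by simp
    with always_eventually[OF allI[OF le]] have "(\<lambda>n. A (f n) - A y) \<longlonglongrightarrow> 0" by (rule Lim_null_comparison)
    then show ?thesis by (rule LIM_zero_cancel)
  qed
  have "(\<lambda>n. cmod (cinner (A1 (f n)) (f n)) + cmod (cinner (A2 (f n)) (f n)))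
      \<longlonglongrightarrow> cmod (cinner (A1 y) y) + cmod (cinner (A2 y) y)"
    by (intro tendsto_add tendsto_norm tendsto_cinner lim bounded_A f(2))
  moreover have "(\<lambda>n. (norm (f n))\<^sup>2) \<longlonglongrightarrow> (norm y)\<^sup>2" by (intro tendsto_intros f(2))
  moreover have "cmod (cinner (A1 (f n)) (f n)) + cmod (cinner (A2 (f n)) (f n)) \<le> (norm (f n))\<^sup>2" for n
    using range f(1)[of n] by auto
  ultimately show ?thesis by (intro LIMSEQ_le) blast+
qed

text \<open>Both sides lie in the defect space, where the defect operator is injective, and it maps them
  to the same vector.\<close>

lemma defect_intertwines: "D (S1 x) = A1 (D x) + cadj \<D> A2 (D (S3 x))"
proof -
  let ?r = "A1 (D x) + cadj \<D> A2 (D (S3 x))"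
  have in1: "A1 (D x) \<in> \<D>" by (rule bounded_op_closed[OF bounded_A(1) defect.defect_op_in])
  have in2: "cadj \<D> A2 (D (S3 x)) \<in> \<D>" by (rule cadj_in[OF hilbert_D bounded_A(2)])
  note D_lin = clinear_onD(2)[OF bounded_op_clinear[OF defect.bounded_defect_op], OF UNIV_I UNIV_I]
    clinear_on_diff[OF bounded_op_clinear[OF defect.bounded_defect_op] complex_vector.subspace_UNIV, OF UNIV_I UNIV_I]
  have adj2: "D (cadj \<D> A2 (D (S3 x))) = T2 (S3 x) - T3 (S1 (S3 x))"
  proof (rule cinner_ext_right)
    fix u
    have "cinner u (D (cadj \<D> A2 (D (S3 x)))) = cinner (D u) (cadj \<D> A2 (D (S3 x)))"
      by (rule defect.defect_op_sym[symmetric])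
    also have "\<dots> = cinner (A2 (D u)) (D (S3 x))"
      by (rule cadj[OF hilbert_D bounded_A(2) defect.defect_op_in, symmetric])
    also have "\<dots> = cinner (S2 u - T1 (S3 u)) (S3 x)"
      by (simp add: fundamental_eq flip: defect.defect_op_sym)
    also have "\<dots> = cinner u (T2 (S3 x) - T3 (S1 (S3 x)))"
      by (simp add: cinner_diff_left cinner_diff_right T_adjoint
          cadj_right[OF hilbert_UNIV bounded(2) UNIV_I] cadj_right[OF hilbert_UNIV bounded(3) UNIV_I])
    finally show "cinner u (D (cadj \<D> A2 (D (S3 x)))) = cinner u (T2 (S3 x) - T3 (S1 (S3 x)))" .
  qed
  have "D (D (S1 x) - ?r) = S1 x - T3 (S3 (S1 x)) - (S1 x - T2 (S3 x) + (T2 (S3 x) - T3 (S1 (S3 x))))"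
    by (simp add: D_lin defect.defect_op_square cadj_cadj bounded fundamental_eq adj2)
  also have "\<dots> = 0"
    using cadj_commute[OF bounded(1,3) comp_commute(2), of x] by simp
  finally have "D (D (S1 x) - ?r) = 0" .
  moreover have "D (S1 x) - ?r \<in> \<D>"
    by (rule complex_vector.subspace_diff[OF csubspace_D defect.defect_op_in
        complex_vector.subspace_add[OF csubspace_D in1 in2]])
  ultimately have "D (S1 x) - ?r = 0" by (rule defect.defect_op_inj[rotated])
  then show ?thesis by simp
qed

end

section \<open>A criterion for tetrablock unitaries\<close>

text \<open>Here \<open>\<bar>x1 - w x3\<bar> = \<bar>cnj x2 - w\<bar> \<le> \<bar>1 - w x2\<bar>\<close> by the Schwarz--Pick identity, so the defining expression
  vanishes nowhere on the open bidisc; scaling the point by \<open>r < 1\<close>, with \<open>r\<^sup>2\<close> in the last entry,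
  moves it into the tetrablock.\<close>

lemma tetrablock_boundaryI:
  assumes x3: "cmod x3 = 1" and x2: "cmod x2 \<le> 1"
  shows "(cnj x2 * x3, x2, x3) \<in> tetrablock_boundary"
proof -
  define x1 where "x1 = cnj x2 * x3"
  have le: "cmod (x1 - w * x3) \<le> cmod (1 - w * x2)" if w: "cmod w \<le> 1" for w
  proof -
    have sq: "(cmod (cnj x2 - w))\<^sup>2 = (cmod x2)\<^sup>2 + (cmod w)\<^sup>2 - 2 * Re (w * x2)"
      "(cmod (1 - w * x2))\<^sup>2 = 1 + (cmod w)\<^sup>2 * (cmod x2)\<^sup>2 - 2 * Re (w * x2)"
      unfolding cmod_power2 by (simp_all add: power2_eq_square algebra_simps)
    have "0 \<le> (1 - (cmod w)\<^sup>2) * (1 - (cmod x2)\<^sup>2)"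
      using w x2 by (intro mult_nonneg_nonneg) (simp_all add: power_le_one)
    then have "(cmod (cnj x2 - w))\<^sup>2 \<le> (cmod (1 - w * x2))\<^sup>2"
      unfolding sq by (simp add: algebra_simps)
    then have "cmod (cnj x2 - w) \<le> cmod (1 - w * x2)" by (rule power2_le_imp_le) simp
    moreover have "x1 - w * x3 = (cnj x2 - w) * x3" by (simp add: x1_def algebra_simps)
    ultimately show ?thesis by (simp add: norm_mult x3)
  qed
  have ne: "1 - z * x1 - w * x2 + z * w * x3 \<noteq> 0" if z: "cmod z < 1" and w: "cmod w < 1" for z w
  proof
    assume "1 - z * x1 - w * x2 + z * w * x3 = 0"
    then have eq: "1 - w * x2 = z * (x1 - w * x3)" by (simp add: algebra_simps)
    have "cmod (w * x2) < 1"
      unfolding norm_mult using w x2 by (metis mult_left_le mult_less_cancel_left2 norm_ge_zero le_less_trans mult.commute)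
    then have "1 - w * x2 \<noteq> 0" by (metis eq_iff_diff_eq_0 norm_one less_irrefl)
    then have "0 < cmod (x1 - w * x3)" using eq by auto
    then have "cmod z * cmod (x1 - w * x3) < 1 * cmod (x1 - w * x3)" using z by (intro mult_strict_right_mono)
    also have "\<dots> \<le> cmod (1 - w * x2)" using le[of w] w by simp
    finally show False using eq by (simp add: norm_mult)
  qed
  define r where "r n = complex_of_real (1 - inverse (real (Suc n)))" for n
  have r1: "cmod (r n) < 1" for n
  proof -
    have "\<bar>1 - inverse (real (Suc n))\<bar> < 1" by (simp add: field_simps)
    then show ?thesis by (simp only: r_def norm_of_real)
  qed
  have "(r n * x1, r n * x2, r n * (r n * x3)) \<in> tetrablock" for n
    unfolding tetrablock_def
  proof clarsimp
    fix z w :: complex assume z: "cmod z \<le> 1" and w: "cmod w \<le> 1"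
    have small: "cmod (r n * z) < 1" if "cmod z \<le> 1" for z
      unfolding norm_mult using r1[of n] that by (metis le_less_trans mult_left_le norm_ge_zero)
    assume "1 - z * (r n * x1) - w * (r n * x2) + z * w * (r n * (r n * x3)) = 0"
    then show False using ne[OF small[OF z] small[OF w]] by (simp add: ac_simps)
  qed
  moreover have "(\<lambda>n. (r n * x1, r n * x2, r n * (r n * x3))) \<longlonglongrightarrow> (1 * x1, 1 * x2, 1 * (1 * x3))"
  proof -
    have "r \<longlonglongrightarrow> 1" using tendsto_ident_scaled[of 1] by (simp add: r_def[abs_def])
    then show ?thesis by (intro tendsto_intros)
  qed
  ultimately have "(x1, x2, x3) \<in> closure tetrablock"
    unfolding closure_sequential by (intro exI[of _ "\<lambda>n. (r n * x1, r n * x2, r n * (r n * x3))"]) simp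
  then show ?thesis using x3 by (simp add: tetrablock_boundary_def x1_def)
qed

text \<open>The iteration \<open>x \<mapsto> x - t (A x - y)\<close> contracts for small \<open>t\<close>, because \<open>A\<close> is bounded below in the
  sense of its quadratic form.\<close>

lemma coercive_bijective:
  fixes A :: "'a::chilbert_space \<Rightarrow> 'a"
  assumes A: "bounded_op UNIV A" and d: "d > 0" and co: "\<And>x. d * (norm x)\<^sup>2 \<le> Re (cinner (A x) x)"
  shows "\<exists>!x. A x = y"
proof -
  obtain B where B: "B \<ge> 0" "\<And>x. norm (A x) \<le> B * norm x" using bounded_opE[OF A] by auto
  have A_diff: "A (u - v) = A u - A v" for u v
    using clinear_on_diff[OF bounded_op_clinear[OF A] complex_vector.subspace_UNIV] by simp
  define t where "t = d / (B\<^sup>2 + d\<^sup>2 + 1)"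
  define q where "q = 1 - t * d"
  have pos: "B\<^sup>2 + d\<^sup>2 + 1 > 0" by (simp add: add_nonneg_pos)
  have t: "t > 0" using d pos by (simp add: t_def)
  have "t * B\<^sup>2 \<le> d"
  proof -
    have "d * B\<^sup>2 \<le> d * (B\<^sup>2 + d\<^sup>2 + 1)" using d by (intro mult_left_mono) auto
    then show ?thesis using pos by (simp add: t_def field_simps)
  qed
  then have tt: "t\<^sup>2 * B\<^sup>2 \<le> t * d" using t by (simp add: power2_eq_square mult.assoc mult_left_mono)
  have "t * d < 1"
    unfolding t_def using pos by (simp add: field_simps power2_eq_square[symmetric] add_pos_nonneg)
  then have q: "0 \<le> q" "q < 1" using t d by (simp_all add: q_def)
  have contr: "(norm (x - t *\<^sub>R A x))\<^sup>2 \<le> q * (norm x)\<^sup>2" for x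
  proof -
    have "Re (cinner x (A x)) = Re (cinner (A x) x)" by (subst cinner_commute) simp
    then have "(norm (x - t *\<^sub>R A x))\<^sup>2 = (norm x)\<^sup>2 + t\<^sup>2 * (norm (A x))\<^sup>2 - 2 * t * Re (cinner (A x) x)"
      using t by (simp add: norm_sq_diff cinner_scaleR_right power_mult_distrib)
    also have "\<dots> \<le> (norm x)\<^sup>2 + t\<^sup>2 * (B * norm x)\<^sup>2 - 2 * t * (d * (norm x)\<^sup>2)"
      using t by (intro diff_mono add_left_mono mult_left_mono power_mono B co) auto
    also have "\<dots> = (norm x)\<^sup>2 + (t\<^sup>2 * B\<^sup>2) * (norm x)\<^sup>2 - 2 * t * d * (norm x)\<^sup>2"
      by (simp add: power_mult_distrib)
    also have "\<dots> \<le> (norm x)\<^sup>2 + (t * d) * (norm x)\<^sup>2 - 2 * t * d * (norm x)\<^sup>2"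
      using tt t d by (intro diff_mono add_left_mono mult_right_mono) auto
    finally show ?thesis by (simp add: q_def algebra_simps)
  qed
  let ?f = "\<lambda>x. x - t *\<^sub>R (A x - y)"
  have "\<exists>!x. ?f x = x"
  proof (rule banach_fix_type)
    show "0 \<le> sqrt q" "sqrt q < 1" using q by simp_all
    have "dist (?f u) (?f v) \<le> sqrt q * dist u v" for u v
    proof -
      have eq: "?f u - ?f v = (u - v) - t *\<^sub>R A (u - v)" by (simp add: A_diff algebra_simps)
      have "(norm (?f u - ?f v))\<^sup>2 \<le> (sqrt q * norm (u - v))\<^sup>2"
        unfolding eq using contr[of "u - v"] q by (simp add: power_mult_distrib)
      then show ?thesis unfolding dist_norm by (rule power2_le_imp_le) (use q in simp)
    qed
    then show "\<forall>x z. dist (?f x) (?f z) \<le> sqrt q * dist x z" by blast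
  qed
  then show ?thesis using t by simp
qed

text \<open>The operators \<open>Gi\<close> define a contracting homotopy of the Koszul complex of the \<open>Ni\<close>.\<close>

lemma koszul_exactI:
  assumes add: "\<And>A x y. A \<in> {N1, N2, N3, G1, G2, G3} \<Longrightarrow> A (x + y) = A x + A (y::'a::chilbert_space)"
    and comm: "\<And>A B x. A \<in> {N1, N2, N3} \<Longrightarrow> B \<in> {N1, N2, N3, G1, G2, G3} \<Longrightarrow> A (B x) = B (A x)"
    and one: "\<And>x. G1 (N1 x) + G2 (N2 x) + G3 (N3 x) = x"
  shows "koszul_exact N1 N2 N3"
proof -
  have diff: "A (x - y) = A x - A y" if "A \<in> {N1, N2, N3, G1, G2, G3}" for A x y
    using add[OF that, of "x - y" y] by simp
  have zero: "A 0 = 0" if "A \<in> {N1, N2, N3, G1, G2, G3}" for A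
    using diff[OF that, of 0 0] by simp
  have neg: "A (- x) = - A x" if "A \<in> {N1, N2, N3, G1, G2, G3}" for A x
    using diff[OF that, of 0 x] zero[OF that] by simp
  note lin = add diff zero neg
  have c: "N1 (N2 x) = N2 (N1 x)" "N1 (N3 x) = N3 (N1 x)" "N2 (N3 x) = N3 (N2 x)"
    "N1 (G1 x) = G1 (N1 x)" "N1 (G2 x) = G2 (N1 x)" "N1 (G3 x) = G3 (N1 x)"
    "N2 (G1 x) = G1 (N2 x)" "N2 (G2 x) = G2 (N2 x)" "N2 (G3 x) = G3 (N2 x)"
    "N3 (G1 x) = G1 (N3 x)" "N3 (G2 x) = G2 (N3 x)" "N3 (G3 x) = G3 (N3 x)" for x
    by (simp_all add: comm)
  have "{x. koszul0 N1 N2 N3 x = 0} = {0}"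
  proof (intro equalityI subsetI)
    fix x assume "x \<in> {x. koszul0 N1 N2 N3 x = 0}"
    then have "N1 x = 0" "N2 x = 0" "N3 x = 0" by (simp_all add: koszul0_def zero_prod_def)
    then have "x = 0" using one[of x] by (simp add: zero)
    then show "x \<in> {0}" by simp
  qed (simp add: koszul0_def zero_prod_def zero)
  moreover have "{x. koszul1 N1 N2 N3 x = 0} = range (koszul0 N1 N2 N3)"
  proof (intro equalityI subsetI)
    fix x assume x: "x \<in> {x. koszul1 N1 N2 N3 x = 0}"
    obtain x1 x2 x3 where x_eq: "x = (x1, x2, x3)" by (metis prod_cases3)
    have z: "N1 x2 = N2 x1" "N1 x3 = N3 x1" "N2 x3 = N3 x2"
      using x by (simp_all add: x_eq koszul1_def zero_prod_def)
    have "koszul0 N1 N2 N3 (G1 x1 + G2 x2 + G3 x3) = x"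
      using one[of x1] one[of x2] one[of x3] z by (simp add: koszul0_def x_eq lin c)
    then show "x \<in> range (koszul0 N1 N2 N3)" by (metis rangeI)
  qed (auto simp: koszul0_def koszul1_def zero_prod_def c)
  moreover have "{y. koszul2 N1 N2 N3 y = 0} = range (koszul1 N1 N2 N3)"
  proof (intro equalityI subsetI)
    fix y assume y: "y \<in> {y. koszul2 N1 N2 N3 y = 0}"
    obtain y12 y13 y23 where y_eq: "y = (y12, y13, y23)" by (metis prod_cases3)
    have z: "N2 y13 = N1 y23 + N3 y12"
      using y by (simp add: y_eq koszul2_def algebra_simps)
    have Gz: "G (N2 y13) = G (N1 y23) + G (N3 y12)" if "G \<in> {N1, N2, N3, G1, G2, G3}" for G
      unfolding z by (rule add[OF that])
    \<comment> \<open>the contraction of \<open>y\<close> with the vector \<open>(G1, G2, G3)\<close> of operators\<close>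
    have "koszul1 N1 N2 N3 (- G2 y12 - G3 y13, G1 y12 - G3 y23, G1 y13 + G2 y23) =
      (G1 (N1 y12) + G2 (N2 y12) + G3 (N3 y12), G1 (N1 y13) + G2 (N2 y13) + G3 (N3 y13),
       G1 (N1 y23) + G2 (N2 y23) + G3 (N3 y23))"
      by (simp add: koszul1_def lin c Gz)
    then have "koszul1 N1 N2 N3 (- G2 y12 - G3 y13, G1 y12 - G3 y23, G1 y13 + G2 y23) = y"
      by (simp add: one y_eq)
    then show "y \<in> range (koszul1 N1 N2 N3)" by (metis rangeI)
  qed (auto simp: koszul1_def koszul2_def lin c)
  moreover have "range (koszul2 N1 N2 N3) = UNIV"
  proof (intro equalityI subsetI)
    fix x
    have "koszul2 N1 N2 N3 (G3 x, - G2 x, G1 x) = x"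
      using one[of x] by (simp add: koszul2_def lin c)
    then show "x \<in> range (koszul2 N1 N2 N3)" by (metis rangeI)
  qed simp
  ultimately show ?thesis by (simp add: koszul_exact_def)
qed

text \<open>If the sum \<open>A\<close> of the \<open>Mi Ni\<close> is bounded below, then it is invertible, and the operators
  \<open>A\<^sup>-\<^sup>1 Mi\<close> contract the Koszul complex.\<close>

lemma koszul_exact_if_bounded_below:
  fixes N1 N2 N3 M1 M2 M3 :: "'a::chilbert_space \<Rightarrow> 'a"
  assumes N: "\<And>A. A \<in> {N1, N2, N3, M1, M2, M3} \<Longrightarrow> bounded_op UNIV A"
    and adj: "\<And>x y. cinner (N1 x) y = cinner x (M1 y)" "\<And>x y. cinner (N2 x) y = cinner x (M2 y)"
      "\<And>x y. cinner (N3 x) y = cinner x (M3 y)"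
    and comm: "\<And>A B x. A \<in> {N1, N2, N3} \<Longrightarrow> B \<in> {N1, N2, N3, M1, M2, M3} \<Longrightarrow> A (B x) = B (A x)"
    and d: "d > 0" "\<And>x. d * (norm x)\<^sup>2 \<le> (norm (N1 x))\<^sup>2 + (norm (N2 x))\<^sup>2 + (norm (N3 x))\<^sup>2"
  shows "koszul_exact N1 N2 N3"
proof -
  define A where "A = (\<lambda>x. M1 (N1 x) + M2 (N2 x) + M3 (N3 x))"
  have add: "B (x + y) = B x + B y" if "B \<in> {N1, N2, N3, M1, M2, M3}" for B x y
    using clinear_onD(2)[OF bounded_op_clinear[OF N[OF that]]] by simp
  have A: "bounded_op UNIV A"
    unfolding A_def
    by (rule bounded_op_add[OF bounded_op_add[OF bounded_op_compose bounded_op_compose] bounded_op_compose])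
      (simp_all add: N complex_vector.subspace_UNIV)
  have "cinner (A x) x = cinner (N1 x) (N1 x) + cinner (N2 x) (N2 x) + cinner (N3 x) (N3 x)" for x
  proof -
    have "cinner x (A x) = cinner (N1 x) (N1 x) + cinner (N2 x) (N2 x) + cinner (N3 x) (N3 x)"
      by (simp add: A_def cinner_add_right adj)
    then show ?thesis using cinner_commute[of "A x" x] by (simp add: cinner_self)
  qed
  then have "d * (norm x)\<^sup>2 \<le> Re (cinner (A x) x)" for x
    using d(2)[of x] by (simp add: Re_cinner_self)
  then have ex1: "\<exists>!x. A x = y" for y by (rule coercive_bijective[OF A d(1)])
  define E where "E y = (THE x. A x = y)" for y
  have AE: "A (E y) = y" for y unfolding E_def by (rule theI'[OF ex1])
  have E: "A x = y \<Longrightarrow> E y = x" for x y using ex1 AE by metis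
  have A_add: "A (x + y) = A x + A y" for x y
    using clinear_onD(2)[OF bounded_op_clinear[OF A]] by simp
  have E_add: "E (x + y) = E x + E y" for x y by (rule E) (simp add: A_add AE)
  have A_comm: "A (B x) = B (A x)" if B: "B \<in> {N1, N2, N3}" for B x
  proof -
    have "B (A x) = B (M1 (N1 x)) + B (M2 (N2 x)) + B (M3 (N3 x))" using add B by (auto simp: A_def)
    also have "\<dots> = M1 (N1 (B x)) + M2 (N2 (B x)) + M3 (N3 (B x))"
      using comm[OF B, of M1 "N1 x"] comm[OF B, of M2 "N2 x"] comm[OF B, of M3 "N3 x"]
        comm[OF B, of N1 x] comm[OF B, of N2 x] comm[OF B, of N3 x] by simp
    finally show ?thesis by (simp add: A_def)
  qed
  have E_comm: "E (B x) = B (E x)" if B: "B \<in> {N1, N2, N3}" for B x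
    by (rule E) (simp add: A_comm[OF B] AE)
  show ?thesis
  proof (rule koszul_exactI)
    fix B x y assume "B \<in> {N1, N2, N3, \<lambda>x. E (M1 x), \<lambda>x. E (M2 x), \<lambda>x. E (M3 x)}"
    then show "B (x + y) = B x + B y"
      using add[of N1] add[of N2] add[of N3] add[of M1] add[of M2] add[of M3] E_add by auto
  next
    fix B C x assume B: "B \<in> {N1, N2, N3}"
      and "C \<in> {N1, N2, N3, \<lambda>x. E (M1 x), \<lambda>x. E (M2 x), \<lambda>x. E (M3 x)}"
    then consider "C \<in> {N1, N2, N3}" | M where "M \<in> {M1, M2, M3}" "C = (\<lambda>x. E (M x))" by blast
    then show "B (C x) = C (B x)"
    proof cases
      case 1
      then show ?thesis using comm[OF B, of C x] by blast
    next
      case 2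
      then have "B (M x) = M (B x)" using comm[OF B, of M x] by blast
      then show ?thesis using E_comm[OF B, of "M x"] 2 by simp
    qed
  next
    show "E (M1 (N1 x)) + E (M2 (N2 x)) + E (M3 (N3 x)) = x" for x
      unfolding E_add[symmetric] by (rule E) (simp add: A_def)
  qed
qed

lemma le_if_le_add_epsilon:
  fixes a b K :: real
  assumes "K \<ge> 0" "\<And>e. e > 0 \<Longrightarrow> a \<le> b + K * e"
  shows "a \<le> b"
proof (rule field_le_epsilon)
  fix e :: real assume e: "e > 0"
  have "a \<le> b + K * (e / (K + 1))" by (rule assms(2)) (use assms(1) e in simp)
  also have "K * (e / (K + 1)) \<le> e" using assms(1) e by (simp add: field_simps)
  finally show "a \<le> b + e" by simp
qed

text \<open>A point of the joint spectrum admits approximate joint eigenvectors \<open>x\<close>. As \<open>U3\<close> is isometric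
  and \<open>U1 = U2\<^sup>* U3\<close>, its coordinates satisfy \<open>\<bar>l3\<bar> = 1\<close> and \<open>l1 = cnj l2 * l3\<close>. Since \<open>U3 x\<close> is
  nearly \<open>l3 x\<close>, the number \<open>l2\<close> is nearly a value of the quadratic form of \<open>C + l3 B\<close>, so
  that the numerical radius of this operator bounds \<open>\<bar>l2\<bar>\<close>.\<close>

lemma E_unitary_criterion:
  fixes U2 U2' U3 U3' B C :: "'a::chilbert_space \<Rightarrow> 'a"
  assumes bd: "bounded_op UNIV U2" "bounded_op UNIV U2'" "bounded_op UNIV U3" "bounded_op UNIV U3'"
      "bounded_op UNIV B"
    and adj: "\<And>x y. cinner (U2 x) y = cinner x (U2' y)" "\<And>x y. cinner (U3 x) y = cinner x (U3' y)"
    and inv: "\<And>x. U3' (U3 x) = x" "\<And>x. U3 (U3' x) = x"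
    and normal: "\<And>x. U2 (U2' x) = U2' (U2 x)" and comm: "\<And>x. U2 (U3 x) = U3 (U2 x)"
    and dec: "\<And>x. U2 x = C x + B (U3 x)"
    and num: "\<And>l x. cmod l = 1 \<Longrightarrow> cmod (cinner (C x + l *\<^sub>C B x) x) \<le> (norm x)\<^sup>2"
  shows "E_unitary (\<lambda>x. U2' (U3 x)) U2 U3"
proof -
  let ?U1 = "\<lambda>x. U2' (U3 x)" and ?U1' = "\<lambda>x. U2 (U3' x)"
  have adj': "cinner x (U2 y) = cinner (U2' x) y" "cinner x (U3 y) = cinner (U3' x) y" for x y
    using adj[of y x] cinner_commute by metis+
  have c: "U2 (U3 x) = U3 (U2 x)" "U2 (U3' x) = U3' (U2 x)" "U2' (U3 x) = U3 (U2' x)"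
    "U2' (U3' x) = U3' (U2' x)" "U2 (U2' x) = U2' (U2 x)" for x
  proof -
    show c1: "U2 (U3 x) = U3 (U2 x)" for x by (rule comm)
    show c2: "U2 (U3' x) = U3' (U2 x)" for x using c1[of "U3' x"] inv by metis
    show "U2' (U3 x) = U3 (U2' x)"
      by (rule cinner_ext) (simp add: adj c2 flip: adj')
    show "U2' (U3' x) = U3' (U2' x)"
      by (rule cinner_ext) (simp add: c1 flip: adj')
    show "U2 (U2' x) = U2' (U2 x)" by (rule normal)
  qed
  have bU1: "bounded_op UNIV ?U1" "bounded_op UNIV ?U1'"
    by (rule bounded_op_compose[OF bd(2,3)], rule bounded_op_compose[OF bd(1,4)])
  have adj1: "cinner (?U1 x) y = cinner x (?U1' y)" for x y
    by (simp add: c adj flip: adj')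
  have "commuting_triple ?U1 U2 U3"
    unfolding commuting_triple_def using bU1 bd by (simp add: fun_eq_iff c)
  moreover have "\<forall>U\<in>{?U1, U2, U3}. U \<circ> cadj UNIV U = cadj UNIV U \<circ> U"
    using cadj_UNIV_eq[OF adj1] cadj_UNIV_eq[OF adj(1)] cadj_UNIV_eq[OF adj(2)]
    by (simp add: fun_eq_iff c inv)
  moreover have "taylor_spectrum ?U1 U2 U3 \<subseteq> tetrablock_boundary"
  proof
    fix l assume l: "l \<in> taylor_spectrum ?U1 U2 U3"
    obtain l1 l2 l3 where l_eq: "l = (l1, l2, l3)" by (metis prod_cases3)
    define N1 N2 N3 where "N1 = (\<lambda>x. ?U1 x - l1 *\<^sub>C x)" and "N2 = (\<lambda>x. U2 x - l2 *\<^sub>C x)"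
      and "N3 = (\<lambda>x. U3 x - l3 *\<^sub>C x)"
    define M1 M2 M3 where "M1 = (\<lambda>x. ?U1' x - cnj l1 *\<^sub>C x)" and "M2 = (\<lambda>x. U2' x - cnj l2 *\<^sub>C x)"
      and "M3 = (\<lambda>x. U3' x - cnj l3 *\<^sub>C x)"
    note defs = N1_def N2_def N3_def M1_def M2_def M3_def
    note lin = clinear_onD(3)[OF bounded_op_clinear[OF bd(1)], OF UNIV_I] clinear_onD(3)[OF bounded_op_clinear[OF bd(2)], OF UNIV_I]
      clinear_onD(3)[OF bounded_op_clinear[OF bd(3)], OF UNIV_I] clinear_onD(3)[OF bounded_op_clinear[OF bd(4)], OF UNIV_I]
      clinear_onD(3)[OF bounded_op_clinear[OF bd(5)], OF UNIV_I]
      bd[THEN bounded_op_clinear, THEN clinear_on_diff, OF complex_vector.subspace_UNIV UNIV_I UNIV_I]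
    have not_exact: "\<not> koszul_exact N1 N2 N3"
      using l by (simp add: l_eq taylor_spectrum_def defs)
    have approx: "\<exists>x. x \<noteq> 0 \<and> norm (N1 x) \<le> e * norm x \<and> norm (N2 x) \<le> e * norm x \<and> norm (N3 x) \<le> e * norm x"
      if e: "e > 0" for e
    proof (rule ccontr)
      assume none: "\<not> ?thesis"
      have "koszul_exact N1 N2 N3"
      proof (rule koszul_exact_if_bounded_below[of N1 N2 N3 M1 M2 M3])
        show "0 < e\<^sup>2" using e by simp
        show "e\<^sup>2 * (norm x)\<^sup>2 \<le> (norm (N1 x))\<^sup>2 + (norm (N2 x))\<^sup>2 + (norm (N3 x))\<^sup>2" for x
        proof (cases "x = 0")
          case False
          then have "e * norm x < norm (N1 x) \<or> e * norm x < norm (N2 x) \<or> e * norm x < norm (N3 x)"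
            using none by force
          moreover have "e * norm x < a \<Longrightarrow> e\<^sup>2 * (norm x)\<^sup>2 \<le> a\<^sup>2" for a
            unfolding power_mult_distrib[symmetric] using e by (intro power_mono) auto
          ultimately show ?thesis by (smt (verit) zero_le_power2)
        qed simp
        show "bounded_op UNIV A" if "A \<in> {N1, N2, N3, M1, M2, M3}" for A
        proof -
          have b: "bounded_op UNIV (\<lambda>x. F x - l *\<^sub>C x)" if "bounded_op UNIV F" for F :: "'a \<Rightarrow> 'a" and l
            by (rule bounded_op_diff[OF that bounded_op_scaleC[OF bounded_op_ident]])
              (rule complex_vector.subspace_UNIV)+
          show ?thesis using that b[OF bU1(1)] b[OF bU1(2)] b[OF bd(1)] b[OF bd(2)] b[OF bd(3)] b[OF bd(4)]
            unfolding defs by auto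
        qed
        show "cinner (N1 x) y = cinner x (M1 y)" "cinner (N2 x) y = cinner x (M2 y)"
          "cinner (N3 x) y = cinner x (M3 y)" for x y
          unfolding defs cinner_diff_left cinner_diff_right cinner_scaleC_left cinner_scaleC_right
          by (simp_all only: adj1 adj complex_cnj_cnj)
        show "F (G x) = G (F x)" if "F \<in> {N1, N2, N3}" "G \<in> {N1, N2, N3, M1, M2, M3}" for F G x
          using that unfolding defs
          by (auto simp: lin c inv scaleC_scaleC complex_vector.scale_right_diff_distrib algebra_simps)
      qed
      then show False using not_exact by blast
    qed
    have l3: "cmod l3 = 1"
    proof -
      have "\<bar>1 - cmod l3\<bar> \<le> 0 + 1 * e" if e: "e > 0" for e
      proof -
        obtain x where x: "x \<noteq> 0" "norm (N3 x) \<le> e * norm x" using approx[OF e] by blast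
        have "cinner (U3 x) (U3 x) = cinner x x" by (simp only: adj inv)
        then have "(norm (U3 x))\<^sup>2 = (norm x)\<^sup>2" by (simp only: flip: Re_cinner_self)
        then have "norm (U3 x) = norm x" by simp
        then have eq: "(1 - cmod l3) * norm x = norm (U3 x) - norm (l3 *\<^sub>C x)"
          by (simp add: norm_scaleC left_diff_distrib)
        have "\<bar>1 - cmod l3\<bar> * norm x = \<bar>norm (U3 x) - norm (l3 *\<^sub>C x)\<bar>"
          unfolding eq[symmetric] abs_mult by simp
        also have "\<dots> \<le> norm (N3 x)" unfolding N3_def by (rule norm_triangle_ineq3)
        also have "\<dots> \<le> e * norm x" by (rule x(2))
        finally show ?thesis using x(1) by simp
      qed
      from le_if_le_add_epsilon[of 1, OF _ this] show ?thesis by simp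
    qed
    obtain b2 where b2: "b2 \<ge> 0" "\<And>x. norm (U2' x) \<le> b2 * norm x" using bounded_opE[OF bd(2)] by auto
    have l1: "l1 = cnj l2 * l3"
    proof -
      have "cmod (l1 - cnj l2 * l3) \<le> 0 + (2 + b2) * e" if e: "e > 0" for e
      proof -
        obtain x where x: "x \<noteq> 0" "norm (N1 x) \<le> e * norm x" "norm (N2 x) \<le> e * norm x" "norm (N3 x) \<le> e * norm x"
          using approx[OF e] by blast
        have "cinner (M2 x) (M2 x) = cinner (N2 x) (N2 x)"
          unfolding M2_def N2_def cinner_diff_left cinner_diff_right cinner_scaleC_left cinner_scaleC_right
          by (simp add: adj c flip: adj') (simp add: adj' algebra_simps)
        then have "(norm (M2 x))\<^sup>2 = (norm (N2 x))\<^sup>2" by (simp only: flip: Re_cinner_self)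
        then have M2: "norm (M2 x) = norm (N2 x)" by simp
        have "(l1 - cnj l2 * l3) *\<^sub>C x = (U2' (N3 x) + l3 *\<^sub>C M2 x) - N1 x"
          by (simp add: defs lin complex_vector.scale_right_diff_distrib complex_vector.scale_left_diff_distrib
              scaleC_scaleC mult.commute)
        then have "cmod (l1 - cnj l2 * l3) * norm x = norm ((U2' (N3 x) + l3 *\<^sub>C M2 x) - N1 x)"
          by (metis norm_scaleC)
        also have "\<dots> \<le> norm (U2' (N3 x)) + norm (l3 *\<^sub>C M2 x) + norm (N1 x)"
          by (rule order_trans[OF norm_triangle_ineq4 add_right_mono[OF norm_triangle_ineq]])
        also have "\<dots> \<le> b2 * (e * norm x) + e * norm x + e * norm x"
          using x b2(2)[of "N3 x"] mult_left_mono[OF x(4) b2(1)]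
          by (intro add_mono) (auto simp: norm_scaleC l3 M2)
        also have "\<dots> = ((2 + b2) * e) * norm x" by (simp add: algebra_simps)
        finally show ?thesis using x(1) by simp
      qed
      from le_if_le_add_epsilon[of "2 + b2", OF _ this] b2(1) show ?thesis by simp
    qed
    obtain b where b: "b \<ge> 0" "\<And>x. norm (B x) \<le> b * norm x" using bounded_opE[OF bd(5)] by auto
    have l2: "cmod l2 \<le> 1"
    proof -
      have "cmod l2 \<le> 1 + (1 + b) * e" if e: "e > 0" for e
      proof -
        obtain x where x: "x \<noteq> 0" "norm (N2 x) \<le> e * norm x" "norm (N3 x) \<le> e * norm x"
          using approx[OF e] by blast
        have "l2 *\<^sub>C x = (C x + l3 *\<^sub>C B x) + (B (N3 x) - N2 x)"
          by (simp add: N2_def N3_def lin dec)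
        then have "l2 * cinner x x = cinner (C x + l3 *\<^sub>C B x) x + cinner (B (N3 x) - N2 x) x"
          by (metis cinner_add_left cinner_scaleC_left)
        then have "cmod l2 * (norm x)\<^sup>2 = cmod (cinner (C x + l3 *\<^sub>C B x) x + cinner (B (N3 x) - N2 x) x)"
          by (metis cinner_self norm_mult norm_of_real abs_power2)
        also have "\<dots> \<le> (norm x)\<^sup>2 + norm (B (N3 x) - N2 x) * norm x"
          by (rule order_trans[OF norm_triangle_ineq add_mono[OF num[OF l3] norm_cinner_le]])
        also have "norm (B (N3 x) - N2 x) \<le> b * (e * norm x) + e * norm x"
          using b(2)[of "N3 x"] mult_left_mono[OF x(3) b(1)] x(2)
          by (intro order_trans[OF norm_triangle_ineq4 add_mono]) auto
        finally have "cmod l2 * (norm x)\<^sup>2 \<le> (norm x)\<^sup>2 + (b * (e * norm x) + e * norm x) * norm x"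
          by (simp add: mult_right_mono)
        also have "\<dots> = (1 + (1 + b) * e) * (norm x)\<^sup>2" by (simp add: algebra_simps power2_eq_square)
        finally show ?thesis using x(1) by simp
      qed
      from le_if_le_add_epsilon[of "1 + b", OF _ this] b(1) show ?thesis by simp
    qed
    show "l \<in> tetrablock_boundary" unfolding l_eq l1 by (rule tetrablock_boundaryI[OF l3 l2])
  qed
  ultimately show ?thesis by (simp add: E_unitary_def)
qed

section \<open>Sequences with entries in a subspace\<close>

definition seqs_in :: "'a::chilbert_space set \<Rightarrow> 'a seq2 set"
  where "seqs_in M = {f. \<forall>n. entry f n \<in> M}"

lemma seq2_eqI: "(\<And>n. entry f n = entry g n) \<Longrightarrow> f = g"
  by (simp add: entry_inject[symmetric] fun_eq_iff)

lemmas entry_simps = zero_seq2.rep_eq plus_seq2.rep_eq minus_seq2.rep_eq scaleC_seq2.rep_eq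

lemma entry_shift: "entry (shift f) n = (case n of 0 \<Rightarrow> 0 | Suc m \<Rightarrow> entry f m)"
  by (simp add: shift.rep_eq)

lemma seqs_inD: "f \<in> seqs_in M \<Longrightarrow> entry f n \<in> M"
  by (simp add: seqs_in_def)

lemma seqs_in_UNIV: "seqs_in UNIV = UNIV"
  by (simp add: seqs_in_def)

lemma tendsto_entry: "(f \<longlongrightarrow> g) F \<Longrightarrow> ((\<lambda>k. entry (f k) n) \<longlongrightarrow> entry g n) F"
proof (rule LIM_zero_cancel, rule Lim_null_comparison[OF always_eventually])
  show "\<forall>k. norm (entry (f k) n - entry g n) \<le> norm (f k - g)"
    using norm_entry_le[of "f _ - g" n] by (simp add: minus_seq2.rep_eq)
qed (intro tendsto_norm_zero LIM_zero)

lemma hilbert_seqs_in: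
  assumes M: "hilbert M"
  shows "hilbert (seqs_in M)"
proof -
  have sub: "csubspace M" and cl: "closed M" using M by (auto simp: hilbert_def)
  have "csubspace (seqs_in M)"
    unfolding complex_vector.subspace_def seqs_in_def
    using complex_vector.subspace_0[OF sub] complex_vector.subspace_add[OF sub] complex_vector.subspace_scale[OF sub]
    by (simp add: entry_simps)
  moreover have "closed (seqs_in M)"
    unfolding closed_sequential_limits
  proof (intro allI impI, elim conjE)
    fix f g assume f: "\<forall>k. f k \<in> seqs_in M" and g: "f \<longlonglongrightarrow> g"
    have "entry g n \<in> M" for n
    proof (rule closed_sequentially[OF cl])
      show "entry (f k) n \<in> M" for k using f by (simp add: seqs_in_def)
      show "(\<lambda>k. entry (f k) n) \<longlonglongrightarrow> entry g n" by (rule tendsto_entry[OF g])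
    qed
    then show "g \<in> seqs_in M" by (simp add: seqs_in_def)
  qed
  ultimately show ?thesis by (simp add: hilbert_def)
qed

definition smap :: "('a::chilbert_space \<Rightarrow> 'b::chilbert_space) \<Rightarrow> 'a seq2 \<Rightarrow> 'b seq2"
  where "smap A f = Abs_seq2 (\<lambda>n. A (entry f n))"

lemma summable_entry_bounded:
  assumes "\<And>x. x \<in> M \<Longrightarrow> norm (A x) \<le> B * norm x" "f \<in> seqs_in M"
  shows "summable (\<lambda>n. (norm (A (entry f n)))\<^sup>2)"
proof (rule summable_comparison_test'[where N=0])
  show "summable (\<lambda>n. B\<^sup>2 * (norm (entry f n))\<^sup>2)" by (intro summable_mult summable_entry)
  show "norm ((norm (A (entry f n)))\<^sup>2) \<le> B\<^sup>2 * (norm (entry f n))\<^sup>2" for n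
    using power_mono[OF assms(1)[OF seqs_inD[OF assms(2)]] norm_ge_zero, of n 2]
    by (simp add: power_mult_distrib)
qed

lemma entry_smap:
  assumes "\<And>x. x \<in> M \<Longrightarrow> norm (A x) \<le> B * norm x" "f \<in> seqs_in M"
  shows "entry (smap A f) n = A (entry f n)"
  unfolding smap_def by (subst Abs_seq2_inverse) (simp_all add: summable_entry_bounded[OF assms])

lemma norm_smap_le:
  assumes b: "\<And>x. x \<in> M \<Longrightarrow> norm (A x) \<le> B * norm x" and B: "B \<ge> 0" and f: "f \<in> seqs_in M"
  shows "norm (smap A f) \<le> B * norm f"
proof -
  have "(norm (smap A f))\<^sup>2 = (\<Sum>n. (norm (A (entry f n)))\<^sup>2)"
    by (simp add: norm_seq2_sq entry_smap[OF b f])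
  also have "\<dots> \<le> (\<Sum>n. B\<^sup>2 * (norm (entry f n))\<^sup>2)"
  proof (rule suminf_le[OF _ summable_entry_bounded[OF b f] summable_mult[OF summable_entry]])
    show "(norm (A (entry f n)))\<^sup>2 \<le> B\<^sup>2 * (norm (entry f n))\<^sup>2" for n
      using power_mono[OF b[OF seqs_inD[OF f]] norm_ge_zero, of n 2] by (simp add: power_mult_distrib)
  qed
  also have "\<dots> = (B * norm f)\<^sup>2" by (simp add: suminf_mult summable_entry norm_seq2_sq power_mult_distrib)
  finally show ?thesis by (rule power2_le_imp_le) (use B in simp)
qed

lemma entry_smap_op: "bounded_op M A \<Longrightarrow> f \<in> seqs_in M \<Longrightarrow> entry (smap A f) n = A (entry f n)"
  using bounded_opE[of M A] entry_smap[of M A _ f n] by metis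

lemma clinear_on_smap:
  assumes M: "hilbert M" and A: "clinear_on M N A" and b: "\<And>x. x \<in> M \<Longrightarrow> norm (A x) \<le> B * norm x"
  shows "clinear_on (seqs_in M) (seqs_in N) (smap A)"
proof -
  have sub: "csubspace (seqs_in M)" using hilbert_seqs_in[OF M] by (simp add: hilbert_def)
  note e = entry_smap[OF b]
  show ?thesis
    unfolding clinear_on_def
  proof (intro conjI ballI allI)
    fix f assume f: "f \<in> seqs_in M"
    show "smap A f \<in> seqs_in N"
      using clinear_onD(1)[OF A] f by (simp add: seqs_in_def entry_smap[OF b])
    show "smap A (c *\<^sub>C f) = c *\<^sub>C smap A f" for c
      using f complex_vector.subspace_scale[OF sub f]
      by (intro seq2_eqI) (simp add: e entry_simps clinear_onD(3)[OF A] seqs_inD)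
    show "smap A (f + g) = smap A f + smap A g" if g: "g \<in> seqs_in M" for g
      using f g complex_vector.subspace_add[OF sub f g]
      by (intro seq2_eqI) (simp add: e entry_simps clinear_onD(2)[OF A] seqs_inD)
  qed
qed

lemma bounded_op_smap:
  assumes M: "hilbert M" and A: "bounded_op M A"
  shows "bounded_op (seqs_in M) (smap A)"
proof -
  obtain B where B: "B \<ge> 0" "\<And>x. x \<in> M \<Longrightarrow> norm (A x) \<le> B * norm x" using bounded_opE[OF A] by metis
  show ?thesis
    unfolding bounded_op_def
    using clinear_on_smap[OF M bounded_op_clinear[OF A] B(2)] norm_smap_le[OF B(2) B(1)] by blast
qed

lemma norm_shift: "norm (shift f) = norm f"
proof -
  have "(\<Sum>n. (norm (entry (shift f) n))\<^sup>2) = (\<Sum>n. (norm (entry (shift f) (Suc n)))\<^sup>2)"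
    using suminf_split_initial_segment[OF summable_entry[of "shift f"], of 1] by (simp add: entry_shift)
  then show ?thesis by (simp add: norm_seq2_def entry_shift)
qed

lemma shift_add: "shift (f + g) = shift f + shift g"
  and shift_scaleC: "shift (c *\<^sub>C f) = c *\<^sub>C shift f"
  by (rule seq2_eqI, simp add: entry_shift entry_simps split: nat.split)+

lemma bounded_op_shift:
  assumes "csubspace M"
  shows "bounded_op (seqs_in M) shift"
proof (rule bounded_opI[where B=1])
  show "shift f \<in> seqs_in M" if "f \<in> seqs_in M" for f
    using that complex_vector.subspace_0[OF assms] by (simp add: seqs_in_def entry_shift split: nat.split)
qed (simp_all add: shift_add shift_scaleC norm_shift)

section \<open>Isometric images\<close>

lemma isometric_embeddingD:
  assumes "isometric_embedding M N J"
  shows "clinear_on M N J" "x \<in> M \<Longrightarrow> norm (J x) = norm x"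
  using assms by (auto simp: isometric_embedding_def)

lemma isometric_embedding_dist:
  assumes J: "isometric_embedding M N J" and M: "csubspace M" and x: "x \<in> M" "y \<in> M"
  shows "norm (J x - J y) = norm (x - y)"
  using isometric_embeddingD(2)[OF J complex_vector.subspace_diff[OF M x]]
    clinear_on_diff[OF isometric_embeddingD(1)[OF J] M x] by simp

lemma isometric_embedding_inj:
  assumes J: "isometric_embedding M N J" and M: "csubspace M"
  shows "inj_on J M"
proof (rule inj_onI)
  fix x y assume "x \<in> M" "y \<in> M" "J x = J y"
  then show "x = y" using isometric_embedding_dist[OF J M, of x y] by simp
qed

text \<open>Polarization: the inner product is determined by the norm.\<close>

lemma isometric_embedding_cinner:
  assumes J: "isometric_embedding M N J" and M: "csubspace M" and x: "x \<in> M" and y: "y \<in> M"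
  shows "cinner (J x) (J y) = cinner x y"
proof -
  note l = clinear_onD[OF isometric_embeddingD(1)[OF J]]
  have Re: "Re (cinner (J x) (J z)) = Re (cinner x z)" if z: "z \<in> M" for z
  proof -
    have "norm (J x + J z) = norm (x + z)"
      using isometric_embeddingD(2)[OF J complex_vector.subspace_add[OF M x z]] l(2)[OF x z] by simp
    then have "(norm (J x + J z))\<^sup>2 = (norm (x + z))\<^sup>2" by simp
    then show ?thesis using isometric_embeddingD(2)[OF J] x z by (simp add: norm_sq_add)
  qed
  have "Re (cinner (J x) (J (\<i> *\<^sub>C y))) = Re (cinner x (\<i> *\<^sub>C y))"
    by (rule Re) (rule complex_vector.subspace_scale[OF M y])
  then have "Im (cinner (J x) (J y)) = Im (cinner x y)"
    by (simp add: l(3)[OF y] cinner_scaleC_right)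
  then show ?thesis using Re[OF y] by (simp add: complex_eq_iff)
qed

text \<open>Completeness passes along an isometry, so the image is closed.\<close>

lemma hilbert_isometric_image:
  assumes J: "isometric_embedding M N J" and M: "hilbert M"
  shows "hilbert (J ` M)"
proof -
  have sub: "csubspace M" and cl: "closed M" using M by (auto simp: hilbert_def)
  note d = isometric_embedding_dist[OF J sub]
  have "closed (J ` M)"
    unfolding closed_sequential_limits
  proof (intro allI impI, elim conjE)
    fix y l assume y: "\<forall>n. y n \<in> J ` M" and l: "y \<longlonglongrightarrow> l"
    have "\<forall>n. \<exists>x. x \<in> M \<and> y n = J x" using y by blast
    then obtain x where x: "\<And>n. x n \<in> M" "\<And>n. y n = J (x n)" by metis
    have "Cauchy y" using l by (rule LIMSEQ_imp_Cauchy)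
    then have "Cauchy x" by (simp add: Cauchy_def dist_norm x d)
    then obtain z where z: "x \<longlonglongrightarrow> z" using Cauchy_convergent convergent_def by blast
    have zM: "z \<in> M" using closed_sequentially[OF cl _ z] x by blast
    have "(\<lambda>n. norm (y n - J z)) \<longlonglongrightarrow> 0"
      using tendsto_norm_zero[OF LIM_zero[OF z]] by (simp add: x d zM)
    then have "y \<longlonglongrightarrow> J z" by (rule LIM_zero_cancel[OF tendsto_norm_zero_cancel])
    then have "l = J z" using l LIMSEQ_unique by blast
    then show "l \<in> J ` M" using zM by blast
  qed
  then show ?thesis
    using csubspace_image[OF isometric_embeddingD(1)[OF J] sub] by (simp add: hilbert_def)
qed

lemma isometric_embedding_inv_into:
  assumes J: "isometric_embedding M N J" and M: "csubspace M"
  shows "isometric_embedding (J ` M) M (inv_into M J)"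
proof -
  note l = clinear_onD[OF isometric_embeddingD(1)[OF J]]
  have inv: "inv_into M J (J x) = x" if "x \<in> M" for x
    by (rule inv_into_f_f[OF isometric_embedding_inj[OF J M] that])
  note add = complex_vector.subspace_add[OF M] and scale = complex_vector.subspace_scale[OF M]
  have "inv_into M J (J x + J y) = x + y" "inv_into M J (c *\<^sub>C J x) = c *\<^sub>C x" if "x \<in> M" "y \<in> M" for x y c
    using inv[OF add[OF that]] inv[OF scale[OF that(1)], of c] that by (simp_all add: l)
  then show ?thesis
    unfolding isometric_embedding_def clinear_on_def using isometric_embeddingD(2)[OF J] by (simp add: inv)
qed

lemma isometric_embedding_compose:
  assumes J: "isometric_embedding M N J" and L: "isometric_embedding N P L"
  shows "isometric_embedding M P (\<lambda>x. L (J x))"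
  using clinear_onD[OF isometric_embeddingD(1)[OF J]] clinear_onD[OF isometric_embeddingD(1)[OF L]]
    isometric_embeddingD(2)[OF J] isometric_embeddingD(2)[OF L]
  by (simp add: isometric_embedding_def clinear_on_def)

lemma bounded_op_transport:
  assumes J: "isometric_embedding M N J" and L: "isometric_embedding N M L" and S: "bounded_op M S"
  shows "bounded_op N (\<lambda>y. J (S (L y)))"
proof -
  obtain B where B: "\<And>x. x \<in> M \<Longrightarrow> norm (S x) \<le> B * norm x" using bounded_opE[OF S] by metis
  note l = clinear_onD[OF isometric_embeddingD(1)[OF J]] clinear_onD[OF isometric_embeddingD(1)[OF L]]
    clinear_onD[OF bounded_op_clinear[OF S]]
  have i: "L y \<in> M" "S (L y) \<in> M" if "y \<in> N" for y using that l(4,7) by blast+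
  show ?thesis
  proof (rule bounded_opI)
    fix y assume y: "y \<in> N"
    show "J (S (L y)) \<in> N" by (rule l(1)[OF i(2)[OF y]])
    show "norm (J (S (L y))) \<le> B * norm y"
      using B[OF i(1)[OF y]] isometric_embeddingD(2)[OF J i(2)[OF y]] isometric_embeddingD(2)[OF L y] by simp
    show "J (S (L (c *\<^sub>C y))) = c *\<^sub>C J (S (L y))" for c
      by (simp add: l(6)[OF y] l(9)[OF i(1)[OF y]] l(3)[OF i(2)[OF y]])
    show "J (S (L (y + z))) = J (S (L y)) + J (S (L z))" if z: "z \<in> N" for z
      by (simp add: l(5)[OF y z] l(8)[OF i(1)[OF y] i(1)[OF z]] l(2)[OF i(2)[OF y] i(2)[OF z]])
  qed
qed

lemma bounded_op_eq_on_generators: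
  assumes K: "hilbert K" "K = closure (cspan G)"
    and C: "bounded_op K C" "bounded_op K C'" and eq: "\<And>x. x \<in> G \<Longrightarrow> C x = C' x" and k: "k \<in> K"
  shows "C k = C' k"
proof -
  have sub: "csubspace K" and cl: "closed K" using K by (auto simp: hilbert_def)
  define E where "E x = C x - C' x" for x
  have E: "bounded_op K E"
    using bounded_op_diff[OF C sub] by (simp add: E_def[abs_def])
  obtain B where B: "\<And>x. x \<in> K \<Longrightarrow> norm (E x) \<le> B * norm x" using bounded_opE[OF E] by metis
  note l = clinear_onD[OF bounded_op_clinear[OF E]]
  have GK: "G \<subseteq> K" using K(2) closure_subset complex_vector.span_superset by blast
  define Z where "Z = {x \<in> K. E x = 0}"
  have "csubspace Z"
    unfolding complex_vector.subspace_def Z_def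
    using l(2,3) clinear_on_0[OF bounded_op_clinear[OF E] sub] complex_vector.subspace_0[OF sub]
      complex_vector.subspace_add[OF sub] complex_vector.subspace_scale[OF sub] by simp
  moreover have "G \<subseteq> Z" using GK eq by (auto simp: Z_def E_def)
  ultimately have "cspan G \<subseteq> Z" by (intro complex_vector.span_minimal)
  moreover have "closed Z"
    unfolding closed_sequential_limits
  proof (intro allI impI, elim conjE)
    fix x y assume x: "\<forall>n. x n \<in> Z" and y: "x \<longlonglongrightarrow> y"
    have yK: "y \<in> K" using closed_sequentially[OF cl _ y] x by (auto simp: Z_def)
    have "norm (E y) \<le> B * norm (y - x n)" for n
    proof -
      have xn: "x n \<in> K" "E (x n) = 0" using x by (auto simp: Z_def)
      have "E (y - x n) = E y" using clinear_on_diff[OF bounded_op_clinear[OF E] sub yK xn(1)] xn(2) by simp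
      then show ?thesis using B[OF complex_vector.subspace_diff[OF sub yK xn(1)]] by simp
    qed
    moreover have "(\<lambda>n. B * norm (y - x n)) \<longlonglongrightarrow> B * norm (y - y)" by (intro tendsto_intros y)
    ultimately have "norm (E y) \<le> B * norm (y - y)" by (intro LIMSEQ_le_const) auto
    then show "y \<in> Z" using yK by (simp add: Z_def)
  qed
  ultimately have "closure (cspan G) \<subseteq> Z" by (rule closure_minimal)
  then show ?thesis using k K(2) by (auto simp: Z_def E_def)
qed

section \<open>The bilateral shift model\<close>

text \<open>Two-sided sequences are stored as one-sided ones: the index \<open>2 n\<close> stands for the integer \<open>n\<close>
  and \<open>2 n + 1\<close> for \<open>- (n + 1)\<close>. Under this coding \<open>bi_pred\<close> and \<open>bi_succ\<close> are the
  translations of the integers by \<open>-1\<close> and \<open>1\<close>.\<close>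

definition bi_pred :: "nat \<Rightarrow> nat"
  where "bi_pred m = (if m = 0 then 1 else if even m then m - 2 else m + 2)"

definition bi_succ :: "nat \<Rightarrow> nat"
  where "bi_succ m = (if m = 1 then 0 else if even m then m + 2 else m - 2)"

lemma bi_pred_succ [simp]: "bi_pred (bi_succ m) = m"
  unfolding bi_pred_def bi_succ_def by (auto elim!: oddE evenE; presburger)

lemma bi_succ_pred [simp]: "bi_succ (bi_pred m) = m"
  unfolding bi_pred_def bi_succ_def by (auto elim!: oddE evenE; presburger)

definition permute :: "(nat \<Rightarrow> nat) \<Rightarrow> 'a::chilbert_space seq2 \<Rightarrow> 'a seq2"
  where "permute p f = Abs_seq2 (\<lambda>n. entry f (p n))"

lemma entry_permute:
  assumes "inj p"
  shows "entry (permute p f) n = entry f (p n)"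
  using summable_reindex[OF summable_entry[of f] assms]
  by (simp add: permute_def Abs_seq2_inverse comp_def)

lemma isometric_permute:
  assumes p: "bij p"
  shows "isometric_embedding UNIV UNIV (permute p)"
proof -
  note e = entry_permute[OF bij_is_inj[OF p]]
  have "norm (permute p f) = norm f" for f :: "'a seq2"
    using suminf_reindex[OF summable_entry[of f] bij_is_inj[OF p]] bij_is_surj[OF p]
    by (simp add: norm_seq2_def e comp_def)
  then show ?thesis
    by (simp add: isometric_embedding_def clinear_on_def) (auto intro!: seq2_eqI simp: e entry_simps)
qed

lemma bij_bi_pred: "bij bi_pred"
  by (rule o_bij[of bi_succ]) (simp_all add: fun_eq_iff)

lemma bij_bi_succ: "bij bi_succ"
  by (rule o_bij[of bi_pred]) (simp_all add: fun_eq_iff)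

lemmas entry_bi_pred = entry_permute[OF bij_is_inj[OF bij_bi_pred]]
lemmas entry_bi_succ = entry_permute[OF bij_is_inj[OF bij_bi_succ]]

lemma bounded_op_permute: "bij p \<Longrightarrow> bounded_op UNIV (permute p)"
  using isometric_permute[of p] unfolding isometric_embedding_def bounded_op_def
  by (intro conjI exI[of _ 1]) auto

lemma bi_shift_adjoint: "cinner (permute bi_pred f) g = cinner f (permute bi_succ g)"
proof -
  have "g = permute bi_pred (permute bi_succ g)"
    by (rule seq2_eqI) (simp add: entry_bi_pred entry_bi_succ)
  then show ?thesis
    using isometric_embedding_cinner[OF isometric_permute[OF bij_bi_pred] complex_vector.subspace_UNIV, of f "permute bi_succ g"]
    by simp
qed

lemma bounded_op_smap_UNIV: "bounded_op UNIV A \<Longrightarrow> bounded_op UNIV (smap A)"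
  using bounded_op_smap[OF hilbert_UNIV] by (simp add: seqs_in_UNIV)

lemma entry_smap_UNIV: "bounded_op UNIV A \<Longrightarrow> entry (smap A f) n = A (entry f n)"
  using entry_smap_op[of UNIV A f n] by (simp add: seqs_in_UNIV)

text \<open>The operator \<open>I \<otimes> b2* + S \<otimes> b1\<close> with the bilateral shift \<open>S\<close>; that it is normal is exactly
  what the two commutation hypotheses on \<open>b1\<close>, \<open>b2\<close> express.\<close>

lemma bilateral_E_unitary:
  fixes b1 b1' b2 b2' :: "'a::chilbert_space \<Rightarrow> 'a"
  assumes bd: "bounded_op UNIV b1" "bounded_op UNIV b1'" "bounded_op UNIV b2" "bounded_op UNIV b2'"
    and adj: "\<And>x y. cinner (b1 x) y = cinner x (b1' y)" "\<And>x y. cinner (b2 x) y = cinner x (b2' y)"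
    and comm: "\<And>x. b1 (b2 x) = b2 (b1 x)"
    and commutators: "\<And>x. b1' (b1 x) - b1 (b1' x) = b2' (b2 x) - b2 (b2' x)"
    and num: "\<And>x. cmod (cinner (b1 x) x) + cmod (cinner (b2 x) x) \<le> (norm x)\<^sup>2"
  shows "E_unitary (\<lambda>f. smap b1' f + smap b2 (permute bi_pred f))
    (\<lambda>f. smap b2' f + smap b1 (permute bi_pred f)) (permute bi_pred)"
proof -
  let ?S = "permute bi_pred :: 'a seq2 \<Rightarrow> _" and ?S' = "permute bi_succ :: 'a seq2 \<Rightarrow> _"
  define U2 where "U2 = (\<lambda>f. smap b2' f + smap b1 (?S f))"
  define U2' where "U2' = (\<lambda>f. smap b2 f + ?S' (smap b1' f))"
  note bdS = bounded_op_permute[OF bij_bi_pred] bounded_op_permute[OF bij_bi_succ]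
  note e = entry_bi_pred entry_bi_succ bd[THEN entry_smap_UNIV] entry_simps
  note add = bd[THEN bounded_op_clinear, THEN clinear_onD(2), OF UNIV_I UNIV_I]
  have comm': "b1' (b2' x) = b2' (b1' x)" for x
    by (rule cinner_ext_right) (simp add: comm flip: adj)
  have sm_adj: "cinner (smap b f) g = cinner f (smap b' g)"
    if "bounded_op UNIV b" "bounded_op UNIV b'" "\<And>x y. cinner (b x) y = cinner x (b' y)"
    for b b' :: "'a \<Rightarrow> 'a" and f g
    by (simp add: cinner_seq2_def entry_smap_UNIV that)
  have "E_unitary (\<lambda>f. U2' (?S f)) U2 ?S"
  proof (rule E_unitary_criterion[where U3'="?S'" and C="smap b2'" and B="smap b1" and U2'=U2'])
    show "bounded_op UNIV U2"
      unfolding U2_def by (rule bounded_op_add[OF bounded_op_smap_UNIV[OF bd(4)]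
          bounded_op_compose[OF bounded_op_smap_UNIV[OF bd(1)] bdS(1)] complex_vector.subspace_UNIV])
    show "bounded_op UNIV U2'"
      unfolding U2'_def by (rule bounded_op_add[OF bounded_op_smap_UNIV[OF bd(3)]
          bounded_op_compose[OF bdS(2) bounded_op_smap_UNIV[OF bd(2)]] complex_vector.subspace_UNIV])
    show "bounded_op UNIV ?S" "bounded_op UNIV ?S'" "bounded_op UNIV (smap b1)"
      by (rule bdS bounded_op_smap_UNIV[OF bd(1)])+
    have adj2: "cinner (b2' x) y = cinner x (b2 y)" for x y
      using adj(2)[of y x] cinner_commute by metis
    show "cinner (U2 f) g = cinner f (U2' g)" for f g
      unfolding U2_def U2'_def cinner_add_left cinner_add_right
      by (simp add: sm_adj[OF bd(4) bd(3) adj2] sm_adj[OF bd(1) bd(2) adj(1)] bi_shift_adjoint)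
    show "cinner (?S f) g = cinner f (?S' g)" for f g by (rule bi_shift_adjoint)
    show "?S' (?S f) = f" "?S (?S' f) = f" for f by (rule seq2_eqI, simp add: e)+
    show "U2 (?S f) = ?S (U2 f)" for f
      unfolding U2_def by (rule seq2_eqI) (simp add: e)
    show "U2 (U2' f) = U2' (U2 f)" for f
    proof (rule seq2_eqI)
      fix n
      have "b2' (b2 x) + b1 (b1' x) = b2 (b2' x) + b1' (b1 x)" for x
        using commutators[of x] by (simp add: algebra_simps)
      then show "entry (U2 (U2' f)) n = entry (U2' (U2 f)) n"
        unfolding U2_def U2'_def by (simp add: e add comm comm' algebra_simps)
    qed
    show "U2 f = smap b2' f + smap b1 (?S f)" for f by (simp add: U2_def)
    show "cmod (cinner (smap b2' f + l *\<^sub>C smap b1 f) f) \<le> (norm f)\<^sup>2" if l: "cmod l = 1" for l f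
    proof -
      let ?g = "smap b2' f + l *\<^sub>C smap b1 f"
      have le: "norm (cinner (entry ?g n) (entry f n)) \<le> (norm (entry f n))\<^sup>2" for n
      proof -
        let ?x = "entry f n"
        have "cmod (cinner (b2' ?x) ?x) = cmod (cinner (b2 ?x) ?x)"
          unfolding adj2 by (subst cinner_commute) simp
        moreover have "cinner (entry ?g n) ?x = cinner (b2' ?x) ?x + l * cinner (b1 ?x) ?x"
          by (simp add: e cinner_add_left cinner_scaleC_left)
        moreover have "cmod (cinner (b2' ?x) ?x + l * cinner (b1 ?x) ?x)
            \<le> cmod (cinner (b2' ?x) ?x) + cmod (cinner (b1 ?x) ?x)"
          by (rule order_trans[OF norm_triangle_ineq]) (simp add: norm_mult l)
        ultimately show ?thesis using num[of ?x] by simp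
      qed
      have "cmod (cinner ?g f) \<le> (\<Sum>n. (norm (entry f n))\<^sup>2)"
        unfolding cinner_seq2_def by (rule norm_suminf_le[OF le summable_entry])
      then show ?thesis by (simp only: norm_seq2_sq)
    qed
  qed
  moreover have "(\<lambda>f. U2' (?S f)) = (\<lambda>f. smap b1' f + smap b2 (?S f))"
    unfolding U2'_def by (intro ext seq2_eqI) (simp add: e add.commute)
  ultimately show ?thesis by (simp add: U2_def)
qed

text \<open>One-sided sequences as two-sided ones: the even indices stand for the nonnegative integers.\<close>

definition spread :: "'a::chilbert_space seq2 \<Rightarrow> 'a seq2"
  where "spread f = Abs_seq2 (\<lambda>m. if even m then entry f (m div 2) else 0)"

lemma spread_sums: "(\<lambda>m. (norm (if even m then entry f (m div 2) else 0))\<^sup>2) sums (norm f)\<^sup>2"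
proof -
  have "(\<lambda>n. (norm (entry f n))\<^sup>2) sums (norm f)\<^sup>2"
    using summable_sums[OF summable_entry] by (simp add: norm_seq2_sq)
  from sums_if[OF sums_zero this] show ?thesis
    by (simp add: if_distrib[of "\<lambda>x. (norm x)\<^sup>2"] cong: if_cong)
qed

lemma entry_spread: "entry (spread f) m = (if even m then entry f (m div 2) else 0)"
  unfolding spread_def by (subst Abs_seq2_inverse) (use sums_summable[OF spread_sums[of f]] in auto)

lemma isometric_spread: "isometric_embedding UNIV UNIV spread"
proof -
  have "norm (spread f) = norm f" for f :: "'a seq2"
  proof -
    have "(norm (spread f))\<^sup>2 = (norm f)\<^sup>2"
      by (simp only: norm_seq2_sq[of "spread f"] entry_spread sums_unique[OF spread_sums[of f]])
    then show ?thesis by simp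
  qed
  then show ?thesis
    by (simp add: isometric_embedding_def clinear_on_def) (auto intro!: seq2_eqI simp: entry_spread entry_simps)
qed

text \<open>At the integer \<open>0\<close> the bilateral shift reads the entry at \<open>-1\<close>, which is \<open>0\<close>.\<close>

lemma permute_spread: "permute bi_pred (spread f) = spread (shift f)"
proof (rule seq2_eqI)
  fix m
  show "entry (permute bi_pred (spread f)) m = entry (spread (shift f)) m"
  proof (cases "even m")
    case True
    then obtain k where "m = 2 * k" by (rule evenE)
    then show ?thesis
      by (cases k) (simp_all add: entry_bi_pred entry_spread entry_shift bi_pred_def)
  next
    case False
    then show ?thesis by (cases m) (simp_all add: entry_bi_pred entry_spread bi_pred_def)
  qed
qed

lemma smap_spread: "bounded_op UNIV A \<Longrightarrow> smap A (spread f) = spread (smap A f)"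
  using clinear_on_0[OF bounded_op_clinear complex_vector.subspace_UNIV, of A]
  by (intro seq2_eqI) (simp add: entry_smap_UNIV entry_spread)

section \<open>Coordinates in the tensor product of the Hardy space with a subspace\<close>

definition zpow :: "nat \<Rightarrow> hardy"
  where "zpow n = (SOME f. hcoeffs f = Abs_seq2 (\<lambda>k. if k = n then 1 else 0))"

lemma entry_zpow: "entry (hcoeffs (zpow n)) k = (if k = n then 1 else 0)"
proof -
  have "summable (\<lambda>k. (cmod (if k = n then 1 else 0))\<^sup>2)"
    by (rule summable_finite[of "{n}"]) auto
  moreover have "hcoeffs (zpow n) = Abs_seq2 (\<lambda>k. if k = n then 1 else 0)"
    unfolding zpow_def using hcoeffs_surj by (rule someI_ex)
  ultimately show ?thesis by (simp add: Abs_seq2_inverse)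
qed

lemma cinner_zpow: "cinner (zpow n) f = cnj (entry (hcoeffs f) n)"
proof -
  have "(\<Sum>k. cinner (entry (hcoeffs (zpow n)) k) (entry (hcoeffs f) k))
      = (\<Sum>k\<in>{n}. cinner (entry (hcoeffs (zpow n)) k) (entry (hcoeffs f) k))"
    by (rule suminf_finite) (auto simp: entry_zpow)
  then show ?thesis by (simp add: cinner_hcoeffs cinner_seq2_def entry_zpow cinner_complex_def)
qed

lemma hcoeffs_mult_z: "hcoeffs (mult_z f) = shift (hcoeffs f)"
proof (rule seq2_eqI)
  fix n
  have s: "(\<lambda>n. entry (shift (hcoeffs f)) n * z ^ n) sums (z * hfun f z)" if "z \<in> ball 0 1" for z
  proof -
    have "(\<lambda>n. z * (taylor_coeff (hfun f) n * z ^ n)) sums (z * hfun f z)"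
      by (rule sums_mult[OF hfun_sums[OF that]])
    then have "(\<lambda>n. entry (shift (hcoeffs f)) (Suc n) * z ^ Suc n) sums (z * hfun f z)"
      by (simp add: entry_shift hcoeffs.rep_eq ac_simps)
    then show ?thesis by (subst (asm) sums_Suc_iff) (simp add: entry_shift)
  qed
  show "entry (hcoeffs (mult_z f)) n = entry (shift (hcoeffs f)) n"
    unfolding hcoeffs.rep_eq mult_z.rep_eq by (rule taylor_coeff_unique[OF s])
qed

text \<open>The operator \<open>I \<otimes> A + M\<^sub>z \<otimes> B\<close> in coordinates.\<close>

definition pencil :: "('h::chilbert_space \<Rightarrow> 'h) \<Rightarrow> ('h \<Rightarrow> 'h) \<Rightarrow> 'h seq2 \<Rightarrow> 'h seq2"
  where "pencil A B f = smap A f + shift (smap B f)"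

locale hardy_tensor =
  fixes D :: "'h::chilbert_space set" and K :: "'k::chilbert_space set" and t :: "hardy \<Rightarrow> 'h \<Rightarrow> 'k"
  assumes hilbert_D: "hilbert D" and tensor: "hilbert_tensor UNIV D K t"
begin

abbreviation "X \<equiv> seqs_in D"

text \<open>\<open>coord n x\<close> is \<open>z\<^sup>n \<otimes> x\<close>, and \<open>synth\<close> maps the sequence of the \<open>f n\<close> to the sum of the \<open>z\<^sup>n \<otimes> f n\<close>. It is
  a unitary from \<open>seqs_in D\<close> onto \<open>K\<close>, with inverse \<open>analysis\<close>; all operators on \<open>K\<close> are computed
  in these coordinates.\<close>

definition coord :: "nat \<Rightarrow> 'h \<Rightarrow> 'k" where "coord n x = t (zpow n) x"

definition synth :: "'h seq2 \<Rightarrow> 'k" where "synth f = (\<Sum>n. coord n (entry f n))"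

definition analysis :: "'k \<Rightarrow> 'h seq2" where "analysis = inv_into X synth"

lemma csubspace_D: "csubspace D" using hilbert_D by (simp add: hilbert_def)

lemma hilbert_K: "hilbert K" using tensor unfolding hilbert_tensor_def by (rule conjunct1)

lemma csubspace_K: "csubspace K" using hilbert_K by (simp add: hilbert_def)

lemma hilbert_X: "hilbert X" by (rule hilbert_seqs_in[OF hilbert_D])

lemma csubspace_X: "csubspace X" using hilbert_X by (simp add: hilbert_def)

lemma tensor_linear: "clinear_on D K (t f)"
  using tensor unfolding hilbert_tensor_def by blast

lemma tensor_cinner: "x \<in> D \<Longrightarrow> y \<in> D \<Longrightarrow> cinner (t f x) (t g y) = cinner f g * cinner x y"
  using tensor unfolding hilbert_tensor_def by blast

lemma K_eq: "K = closure (cspan {t f x | f x. f \<in> UNIV \<and> x \<in> D})"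
  using tensor unfolding hilbert_tensor_def by (elim conjE)

lemma coord_cinner: "x \<in> D \<Longrightarrow> y \<in> D \<Longrightarrow> cinner (coord m x) (coord n y) = (if m = n then cinner x y else 0)"
  by (simp add: coord_def tensor_cinner cinner_zpow entry_zpow)

lemma isometric_coord: "isometric_embedding D K (coord n)"
proof -
  have "norm (coord n x) = norm x" if "x \<in> D" for x
  proof -
    have "(norm (coord n x))\<^sup>2 = (norm x)\<^sup>2"
      using coord_cinner[OF that that, of n n] by (simp flip: Re_cinner_self)
    then show ?thesis by simp
  qed
  moreover have "clinear_on D K (coord n)" unfolding coord_def[abs_def] by (rule tensor_linear)
  ultimately show ?thesis by (simp add: isometric_embedding_def)
qed

lemmas coord_lin = clinear_onD[OF isometric_embeddingD(1)[OF isometric_coord]]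

lemma norm_sum_coord:
  assumes f: "f \<in> X" and F: "finite F"
  shows "(norm (\<Sum>n\<in>F. coord n (entry f n)))\<^sup>2 = (\<Sum>n\<in>F. (norm (entry f n))\<^sup>2)"
  using F
proof induction
  case (insert i F)
  have "cinner (coord i (entry f i)) (\<Sum>n\<in>F. coord n (entry f n)) = 0"
    unfolding cinner_sum_right
    by (rule sum.neutral) (use insert f in \<open>auto simp: coord_cinner seqs_inD\<close>)
  then show ?case
    using insert isometric_embeddingD(2)[OF isometric_coord seqs_inD[OF f]]
    by (simp add: norm_sq_add)
qed simp

lemma synth_sums:
  assumes f: "f \<in> X"
  shows "(\<lambda>n. coord n (entry f n)) sums synth f"
proof -
  have "summable (\<lambda>n. coord n (entry f n))"
    unfolding summable_Cauchy
  proof (intro allI impI)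
    fix e :: real assume e: "e > 0"
    then have "e\<^sup>2 > 0" by simp
    then obtain N where N: "\<And>m n. m \<ge> N \<Longrightarrow> norm (\<Sum>k\<in>{m..<n}. (norm (entry f k))\<^sup>2) < e\<^sup>2"
      using summable_entry[of f] unfolding summable_Cauchy by blast
    have "norm (\<Sum>k\<in>{m..<n}. coord k (entry f k)) < e" if "m \<ge> N" for m n
    proof -
      have "(norm (\<Sum>k\<in>{m..<n}. coord k (entry f k)))\<^sup>2 < e\<^sup>2"
        using N[OF that, of n] norm_sum_coord[OF f, of "{m..<n}"] by (simp add: sum_nonneg)
      then show ?thesis using e by (simp add: power_less_imp_less_base)
    qed
    then show "\<exists>N. \<forall>m\<ge>N. \<forall>n. norm (\<Sum>k\<in>{m..<n}. coord k (entry f k)) < e" by blast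
  qed
  then show ?thesis unfolding synth_def by (rule summable_sums)
qed

lemma isometric_synth: "isometric_embedding X K synth"
  unfolding isometric_embedding_def clinear_on_def
proof (intro conjI ballI allI)
  fix f assume f: "f \<in> X"
  note s = synth_sums[OF f]
  have "(\<Sum>n<N. coord n (entry f n)) \<in> K" for N
    by (rule complex_vector.subspace_sum[OF csubspace_K]) (rule coord_lin(1)[OF seqs_inD[OF f]])
  with hilbert_K[unfolded hilbert_def, THEN conjunct2] show "synth f \<in> K"
    by (rule closed_sequentially[OF _ _ s[unfolded sums_def]])
  have "(\<lambda>N. (norm (\<Sum>n<N. coord n (entry f n)))\<^sup>2) \<longlonglongrightarrow> (norm (synth f))\<^sup>2"
    by (intro tendsto_intros s[unfolded sums_def])
  moreover have "(\<lambda>N. (norm (\<Sum>n<N. coord n (entry f n)))\<^sup>2) \<longlonglongrightarrow> (norm f)\<^sup>2"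
    unfolding norm_sum_coord[OF f finite_lessThan] norm_seq2_sq
    by (rule summable_LIMSEQ[OF summable_entry])
  ultimately have "(norm (synth f))\<^sup>2 = (norm f)\<^sup>2" by (rule LIMSEQ_unique)
  then show "norm (synth f) = norm f" by simp
  show "synth (c *\<^sub>C f) = c *\<^sub>C synth f" for c
  proof (rule sums_unique2[OF synth_sums[OF complex_vector.subspace_scale[OF csubspace_X f]]])
    show "(\<lambda>n. coord n (entry (c *\<^sub>C f) n)) sums (c *\<^sub>C synth f)"
      using bounded_linear.sums[OF bounded_linear_scaleC s, of c]
      by (simp add: entry_simps coord_lin(3) seqs_inD[OF f])
  qed
  show "synth (f + g) = synth f + synth g" if g: "g \<in> X" for g
  proof (rule sums_unique2[OF synth_sums[OF complex_vector.subspace_add[OF csubspace_X f g]]])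
    show "(\<lambda>n. coord n (entry (f + g) n)) sums (synth f + synth g)"
      using sums_add[OF s synth_sums[OF g]]
      by (simp add: entry_simps coord_lin(2) seqs_inD[OF f] seqs_inD[OF g])
  qed
qed

lemmas synth_lin = clinear_onD[OF isometric_embeddingD(1)[OF isometric_synth]]

lemma synth_cinner: "f \<in> X \<Longrightarrow> g \<in> X \<Longrightarrow> cinner (synth f) (synth g) = cinner f g"
  by (rule isometric_embedding_cinner[OF isometric_synth csubspace_X])

lemma entry_tensor_coeffs: "entry (smap (\<lambda>c. c *\<^sub>C x) a) n = entry a n *\<^sub>C x"
  by (rule entry_smap[of UNIV _ "norm x"]) (simp_all add: norm_scaleC seqs_in_UNIV)

lemma tensor_coeffs_in: "x \<in> D \<Longrightarrow> smap (\<lambda>c. c *\<^sub>C x) (hcoeffs f) \<in> X"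
  using complex_vector.subspace_scale[OF csubspace_D] by (simp add: seqs_in_def entry_tensor_coeffs)

text \<open>Both sides have the same norm, and their inner product is the square of it.\<close>

lemma tensor_eq_synth:
  assumes x: "x \<in> D"
  shows "t f x = synth (smap (\<lambda>c. c *\<^sub>C x) (hcoeffs f))"
proof -
  let ?g = "smap (\<lambda>c. c *\<^sub>C x) (hcoeffs f)"
  let ?w = "synth ?g" and ?y = "t f x"
  have g: "?g \<in> X" by (rule tensor_coeffs_in[OF x])
  have "(\<lambda>n. cinner (coord n (entry ?g n)) ?y) sums cinner ?w ?y"
    by (rule bounded_linear.sums[OF bounded_bilinear.bounded_linear_left[OF bounded_bilinear_cinner] synth_sums[OF g]])
  moreover have "cinner (coord n (entry ?g n)) ?y = cinner (entry ?g n) (entry ?g n)" for n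
  proof -
    have "coord n (entry ?g n) = entry (hcoeffs f) n *\<^sub>C coord n x"
      by (simp add: entry_tensor_coeffs coord_lin(3)[OF x])
    then show ?thesis
      by (simp add: entry_tensor_coeffs coord_def cinner_scaleC_left cinner_scaleC_right tensor_cinner[OF x x] cinner_zpow)
  qed
  ultimately have "(\<lambda>n. cinner (entry ?g n) (entry ?g n)) sums cinner ?w ?y" by simp
  then have wy: "cinner ?w ?y = cinner ?g ?g" by (simp add: cinner_seq2_def sums_iff)
  have "(\<lambda>n. cinner (entry (hcoeffs f) n) (entry (hcoeffs f) n) * cinner x x) sums (cinner (hcoeffs f) (hcoeffs f) * cinner x x)"
    unfolding cinner_seq2_def by (rule sums_mult2[OF summable_sums[OF summable_cinner]])
  moreover have "cinner (entry (hcoeffs f) n) (entry (hcoeffs f) n) * cinner x x = cinner (entry ?g n) (entry ?g n)" for n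
    by (simp add: entry_tensor_coeffs cinner_scaleC_left cinner_scaleC_right cinner_complex_def)
  ultimately have "cinner ?g ?g = cinner (hcoeffs f) (hcoeffs f) * cinner x x"
    unfolding cinner_seq2_def[of ?g] by (simp add: sums_iff)
  then have yy: "cinner ?y ?y = cinner ?g ?g" by (simp add: tensor_cinner[OF x x] cinner_hcoeffs)
  have yw: "cinner ?y ?w = cinner ?g ?g"
    using wy cinner_commute[of ?y ?w] cinner_commute[of ?g ?g] by simp
  have "cinner (?y - ?w) (?y - ?w) = 0"
    by (simp add: cinner_diff_left cinner_diff_right yy wy yw synth_cinner[OF g g])
  then show ?thesis by (simp add: cinner_self_eq_0)
qed

lemma synth_image: "synth ` X = K"
proof
  show "synth ` X \<subseteq> K" using synth_lin(1) by blast
  have H: "hilbert (synth ` X)" by (rule hilbert_isometric_image[OF isometric_synth hilbert_X])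
  have "{t f x | f x. f \<in> UNIV \<and> x \<in> D} \<subseteq> synth ` X"
    using tensor_eq_synth tensor_coeffs_in by blast
  then have "cspan {t f x | f x. f \<in> UNIV \<and> x \<in> D} \<subseteq> synth ` X"
    using H by (intro complex_vector.span_minimal) (simp_all add: hilbert_def)
  then show "K \<subseteq> synth ` X"
    using H unfolding K_eq by (intro closure_minimal) (simp_all add: hilbert_def)
qed

lemma analysis_synth: "f \<in> X \<Longrightarrow> analysis (synth f) = f"
  unfolding analysis_def by (rule inv_into_f_f[OF isometric_embedding_inj[OF isometric_synth csubspace_X]])

lemma synth_analysis: "k \<in> K \<Longrightarrow> synth (analysis k) = k"
  unfolding analysis_def by (rule f_inv_into_f) (simp add: synth_image)

lemma isometric_analysis: "isometric_embedding K X analysis"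
  using isometric_embedding_inv_into[OF isometric_synth csubspace_X] by (simp add: synth_image analysis_def)

lemma analysis_in: "k \<in> K \<Longrightarrow> analysis k \<in> X"
  by (rule clinear_onD(1)[OF isometric_embeddingD(1)[OF isometric_analysis]])

text \<open>Bounded operators on \<open>K\<close> are determined by their values on elementary tensors, so exhibiting one
  operator with the required values identifies the one chosen in the definition.\<close>

lemma tensor_op_eq:
  assumes C: "bounded_op K C" "\<And>f x. x \<in> D \<Longrightarrow> C (t f x) = t (A f) (B x)" and k: "k \<in> K"
  shows "tensor_op UNIV D K t A B k = C k"
proof -
  let ?P = "\<lambda>C. bounded_op K C \<and> (\<forall>f\<in>UNIV. \<forall>x\<in>D. C (t f x) = t (A f) (B x))"
  have "\<exists>C. ?P C" using C by blast
  then have P: "?P (tensor_op UNIV D K t A B)" unfolding tensor_op_def by (rule someI_ex)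
  show ?thesis
  proof (rule bounded_op_eq_on_generators[OF hilbert_K K_eq conjunct1[OF P] C(1) _ k])
    fix y assume "y \<in> {t f x | f x. f \<in> UNIV \<and> x \<in> D}"
    then obtain f x where "x \<in> D" "y = t f x" by blast
    then show "tensor_op UNIV D K t A B y = C y" using P C(2) by simp
  qed
qed

lemma smap_tensor_coeffs:
  assumes A: "bounded_op D A" and x: "x \<in> D"
  shows "smap A (smap (\<lambda>c. c *\<^sub>C x) (hcoeffs f)) = smap (\<lambda>c. c *\<^sub>C A x) (hcoeffs f)"
  using clinear_onD(3)[OF bounded_op_clinear[OF A] x]
  by (intro seq2_eqI) (simp add: entry_smap_op[OF A tensor_coeffs_in[OF x]] entry_tensor_coeffs)

lemma shift_tensor_coeffs:
  "shift (smap (\<lambda>c. c *\<^sub>C x) (hcoeffs f)) = smap (\<lambda>c. c *\<^sub>C x) (hcoeffs (mult_z f))"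
  by (rule seq2_eqI) (simp add: entry_tensor_coeffs hcoeffs_mult_z entry_shift split: nat.split)

lemma smap_in: "bounded_op D A \<Longrightarrow> f \<in> X \<Longrightarrow> smap A f \<in> X"
  by (rule bounded_op_closed[OF bounded_op_smap[OF hilbert_D]])

lemma shift_in: "f \<in> X \<Longrightarrow> shift f \<in> X"
  by (rule bounded_op_closed[OF bounded_op_shift[OF csubspace_D]])

lemma bounded_op_shift_smap: "bounded_op D A \<Longrightarrow> bounded_op X (\<lambda>f. shift (smap A f))"
  by (rule bounded_op_compose[OF bounded_op_shift[OF csubspace_D] bounded_op_smap[OF hilbert_D]])

lemma tensor_op_id:
  assumes A: "bounded_op D A" and k: "k \<in> K"
  shows "tensor_op UNIV D K t id A k = synth (smap A (analysis k))"
proof (rule tensor_op_eq[OF _ _ k])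
  show "bounded_op K (\<lambda>k. synth (smap A (analysis k)))"
    by (rule bounded_op_transport[OF isometric_synth isometric_analysis bounded_op_smap[OF hilbert_D A]])
  show "synth (smap A (analysis (t f x))) = t (id f) (A x)" if x: "x \<in> D" for f x
    using bounded_op_closed[OF A x]
    by (simp add: tensor_eq_synth x analysis_synth tensor_coeffs_in smap_tensor_coeffs[OF A x])
qed

lemma tensor_op_mult_z:
  assumes A: "bounded_op D A" and k: "k \<in> K"
  shows "tensor_op UNIV D K t mult_z A k = synth (shift (smap A (analysis k)))"
proof (rule tensor_op_eq[OF _ _ k])
  show "bounded_op K (\<lambda>k. synth (shift (smap A (analysis k))))"
    by (rule bounded_op_transport[OF isometric_synth isometric_analysis bounded_op_shift_smap[OF A]])
  show "synth (shift (smap A (analysis (t f x)))) = t (mult_z f) (A x)" if x: "x \<in> D" for f x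
    using bounded_op_closed[OF A x]
    by (simp add: tensor_eq_synth x analysis_synth tensor_coeffs_in smap_tensor_coeffs[OF A x] shift_tensor_coeffs)
qed

lemma bounded_op_pencil: "bounded_op D A \<Longrightarrow> bounded_op D B \<Longrightarrow> bounded_op X (pencil A B)"
  unfolding pencil_def[abs_def]
  by (rule bounded_op_add[OF bounded_op_smap[OF hilbert_D] bounded_op_shift_smap csubspace_X])

lemma tensor_op_pencil:
  assumes A: "bounded_op D A" and B: "bounded_op D B" and k: "k \<in> K"
  shows "tensor_op UNIV D K t id A k + tensor_op UNIV D K t mult_z B k = synth (pencil A B (analysis k))"
  unfolding tensor_op_id[OF A k] tensor_op_mult_z[OF B k] pencil_def
  by (rule synth_lin(2)[OF smap_in[OF A analysis_in[OF k]] shift_in[OF smap_in[OF B analysis_in[OF k]]], symmetric])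

lemma tensor_op_mult_z_id: "k \<in> K \<Longrightarrow> tensor_op UNIV D K t mult_z id k = synth (shift (analysis k))"
proof -
  have id: "bounded_op D id" using bounded_op_ident[of D] by (simp add: id_def)
  have "smap id f = f" if "f \<in> X" for f
    by (rule seq2_eqI) (simp add: entry_smap_op[OF id that])
  then show "k \<in> K \<Longrightarrow> ?thesis" by (simp add: tensor_op_mult_z[OF id] analysis_in)
qed

end

section \<open>The pure isometry and the tetrablock isometry\<close>

lemma isometric_smap:
  assumes J: "isometric_embedding M N J" and M: "hilbert M"
  shows "isometric_embedding (seqs_in M) (seqs_in N) (smap J)"
proof -
  have b: "norm (J x) \<le> 1 * norm x" if "x \<in> M" for x using isometric_embeddingD(2)[OF J that] by simp
  have "norm (smap J f) = norm f" if f: "f \<in> seqs_in M" for f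
    by (simp add: norm_seq2_def entry_smap[OF b f] isometric_embeddingD(2)[OF J seqs_inD[OF f]])
  then show ?thesis
    using clinear_on_smap[OF M isometric_embeddingD(1)[OF J] b] by (simp add: isometric_embedding_def)
qed

lemma isometric_smap_image:
  assumes J: "isometric_embedding M N J" and M: "hilbert M"
  shows "smap J ` seqs_in M = seqs_in (J ` M)"
proof -
  have sub: "csubspace M" using M by (simp add: hilbert_def)
  let ?I = "inv_into M J"
  have b: "norm (J x) \<le> 1 * norm x" if "x \<in> M" for x using isometric_embeddingD(2)[OF J that] by simp
  have I: "isometric_embedding (J ` M) M ?I" by (rule isometric_embedding_inv_into[OF J sub])
  have bI: "norm (?I y) \<le> 1 * norm y" if "y \<in> J ` M" for y using isometric_embeddingD(2)[OF I that] by simp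
  show ?thesis
  proof (intro equalityI subsetI)
    fix g assume "g \<in> smap J ` seqs_in M"
    then obtain f where f: "f \<in> seqs_in M" "g = smap J f" by (elim imageE)
    have "entry g n = J (entry f n)" for n unfolding f(2) by (rule entry_smap[OF b f(1)])
    then have "entry g n \<in> J ` M" for n by (simp only:) (rule imageI[OF seqs_inD[OF f(1)]])
    then show "g \<in> seqs_in (J ` M)" unfolding seqs_in_def by blast
  next
    fix g assume g: "g \<in> seqs_in (J ` M)"
    have IM: "?I (entry g n) \<in> M" and JI: "J (?I (entry g n)) = entry g n" for n
      using inv_into_into[OF seqs_inD[OF g]] f_inv_into_f[OF seqs_inD[OF g]] by blast+
    have eI: "entry (smap ?I g) n = ?I (entry g n)" for n by (rule entry_smap[OF bI g])
    have f: "smap ?I g \<in> seqs_in M" by (simp add: seqs_in_def[of M] eI IM)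
    have eJ: "entry (smap J (smap ?I g)) n = J (entry (smap ?I g) n)" for n by (rule entry_smap[OF b f])
    have "g = smap J (smap ?I g)" by (rule seq2_eqI) (simp only: eJ eI JI)
    then show "g \<in> smap J ` seqs_in M" using f by blast
  qed
qed

lemma shift_smap:
  assumes "clinear_on M N A" "csubspace M" "\<And>x. x \<in> M \<Longrightarrow> norm (A x) \<le> B * norm x" "f \<in> seqs_in M"
  shows "smap A (shift f) = shift (smap A f)"
proof -
  have "shift f \<in> seqs_in M" by (rule bounded_op_closed[OF bounded_op_shift[OF assms(2)] assms(4)])
  then show ?thesis
    by (intro seq2_eqI) (simp add: entry_smap[OF assms(3)] assms(4) entry_shift clinear_on_0[OF assms(1,2)] split: nat.split)
qed

lemma spread_add: "spread (f + g) = spread f + spread g"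
  using clinear_onD(2)[OF isometric_embeddingD(1)[OF isometric_spread]] by simp

context hardy_tensor
begin

lemma norm_coord: "x \<in> D \<Longrightarrow> norm (coord n x) \<le> 1 * norm x"
  using isometric_embeddingD(2)[OF isometric_coord, of x n] by simp

text \<open>\<open>Q\<close> is prescribed on \<open>K\<close> only, so it need not equal the transported operator as a function.\<close>

lemma bounded_op_transported:
  assumes S: "bounded_op X S" and Q: "\<And>k. k \<in> K \<Longrightarrow> Q k = synth (S (analysis k))"
  shows "bounded_op K Q"
proof -
  have b: "bounded_op K (\<lambda>k. synth (S (analysis k)))"
    by (rule bounded_op_transport[OF isometric_synth isometric_analysis S])
  obtain B where B: "\<And>k. k \<in> K \<Longrightarrow> norm (synth (S (analysis k))) \<le> B * norm k" using bounded_opE[OF b] by metis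
  note l = clinear_onD[OF bounded_op_clinear[OF b]]
  show ?thesis
  proof (rule bounded_opI[where B=B])
    show "Q k \<in> K" "norm (Q k) \<le> B * norm k" if "k \<in> K" for k
      by (simp_all add: Q that l(1) B)
    show "Q (x + y) = Q x + Q y" if "x \<in> K" "y \<in> K" for x y
      using l(2)[OF that] complex_vector.subspace_add[OF csubspace_K that] by (simp add: Q that)
    show "Q (c *\<^sub>C x) = c *\<^sub>C Q x" if "x \<in> K" for c x
      using l(3)[OF that] complex_vector.subspace_scale[OF csubspace_K that] by (simp add: Q that)
  qed
qed

text \<open>The wandering subspace is the copy \<open>1 \<otimes> D\<close> of \<open>D\<close>.\<close>

lemma pure_isometry_shift:
  assumes V: "\<And>k. k \<in> K \<Longrightarrow> V k = synth (shift (analysis k))"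
  shows "pure_isometry K V"
  unfolding pure_isometry_def
proof (intro conjI exI)
  show "bounded_op K V" by (rule bounded_op_transported[OF bounded_op_shift[OF csubspace_D] V])
  let ?U = "\<lambda>k. smap (coord 0) (analysis k)"
  show "hilbert (coord 0 ` D)" by (rule hilbert_isometric_image[OF isometric_coord hilbert_D])
  have U: "isometric_embedding K (seqs_in K) ?U"
    by (rule isometric_embedding_compose[OF isometric_analysis isometric_smap[OF isometric_coord hilbert_D]])
  then show "isometric_embedding K UNIV ?U" by (simp add: isometric_embedding_def clinear_on_def)
  have "analysis ` K = X"
  proof
    show "analysis ` K \<subseteq> X" using analysis_in by blast
    show "X \<subseteq> analysis ` K" using analysis_synth synth_lin(1) by (metis image_eqI subsetI)
  qed
  then have "?U ` K = smap (coord 0) ` X" by (metis image_image)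
  then show "?U ` K = {f. \<forall>n. entry f n \<in> coord 0 ` D}"
    by (simp add: isometric_smap_image[OF isometric_coord hilbert_D]) (simp add: seqs_in_def)
  show "\<forall>k\<in>K. ?U (V k) = shift (?U k)"
    using shift_smap[OF isometric_embeddingD(1)[OF isometric_coord] csubspace_D norm_coord]
    by (simp add: V analysis_synth shift_in analysis_in)
qed

text \<open>Operators on \<open>D\<close> are moved into the space of \<open>K\<close> along the embedding \<open>x \<mapsto> 1 \<otimes> x\<close> and
  extended by \<open>0\<close> to the orthogonal complement of its range.\<close>

abbreviation "coord_adj \<equiv> adj_on D (coord 0)"

definition extend :: "('h \<Rightarrow> 'h) \<Rightarrow> 'k \<Rightarrow> 'k" where "extend A y = coord 0 (A (coord_adj y))"

lemma coord_clinear: "clinear_on D UNIV (coord 0)"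
  using isometric_embeddingD(1)[OF isometric_coord] by (simp add: clinear_on_def)

lemma coord_adj_in: "coord_adj y \<in> D"
  by (rule adj_on_in[OF hilbert_D coord_clinear norm_coord])

lemma coord_adj: "x \<in> D \<Longrightarrow> cinner (coord 0 x) y = cinner x (coord_adj y)"
  by (rule adj_on[OF hilbert_D coord_clinear norm_coord])

lemma coord_adj_clinear: "clinear_on UNIV D coord_adj"
  by (rule adj_on_bounded[OF hilbert_D coord_clinear norm_coord])

lemmas coord_adj_lin = clinear_onD[OF coord_adj_clinear]

lemma coord_adj_norm: "norm (coord_adj y) \<le> norm y"
  using adj_on_norm_le[OF hilbert_D coord_clinear _ norm_coord, of y] by simp

lemma coord_adj_coord: "x \<in> D \<Longrightarrow> coord_adj (coord 0 x) = x"
  by (rule cinner_ext_on[OF csubspace_D coord_adj_in]) (simp_all add: coord_cinner flip: coord_adj)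

lemma cinner_extend:
  assumes A: "bounded_op D A"
  shows "cinner (extend A x) y = cinner (A (coord_adj x)) (coord_adj y)"
  unfolding extend_def by (rule coord_adj) (rule bounded_op_closed[OF A coord_adj_in])

lemma extend_adj:
  assumes A: "bounded_op D A"
  shows "cinner (extend A x) y = cinner x (extend (cadj D A) y)"
proof -
  have "cinner x (extend (cadj D A) y) = cnj (cinner (cadj D A (coord_adj y)) (coord_adj x))"
    by (subst cinner_commute) (simp add: cinner_extend bounded_op_cadj[OF hilbert_D A])
  also have "\<dots> = cinner (coord_adj x) (cadj D A (coord_adj y))" by (rule cinner_commute[symmetric])
  finally show ?thesis by (simp add: cinner_extend[OF A] cadj[OF hilbert_D A coord_adj_in])
qed

lemma extend_compose: "bounded_op D B \<Longrightarrow> extend A (extend B y) = coord 0 (A (B (coord_adj y)))"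
  by (simp add: extend_def coord_adj_coord bounded_op_closed coord_adj_in)

lemma bounded_op_extend:
  assumes A: "bounded_op D A"
  shows "bounded_op UNIV (extend A)"
proof -
  obtain B where B: "B \<ge> 0" "\<And>x. x \<in> D \<Longrightarrow> norm (A x) \<le> B * norm x" using bounded_opE[OF A] by metis
  note l = clinear_onD[OF bounded_op_clinear[OF A]]
  have i: "A (coord_adj y) \<in> D" for y by (rule l(1)[OF coord_adj_in])
  show ?thesis
  proof (rule bounded_opI)
    show "norm (extend A y) \<le> B * norm y" for y
    proof -
      have "norm (extend A y) = norm (A (coord_adj y))"
        unfolding extend_def by (rule isometric_embeddingD(2)[OF isometric_coord i])
      also have "\<dots> \<le> B * norm (coord_adj y)" by (rule B(2)[OF coord_adj_in])
      also have "\<dots> \<le> B * norm y" by (rule mult_left_mono[OF coord_adj_norm B(1)])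
      finally show ?thesis .
    qed
    show "extend A (x + y) = extend A x + extend A y" for x y
      by (simp add: extend_def coord_adj_lin(2) l(2)[OF coord_adj_in coord_adj_in] coord_lin(2)[OF i i])
    show "extend A (c *\<^sub>C x) = c *\<^sub>C extend A x" for c x
      by (simp add: extend_def coord_adj_lin(3) l(3)[OF coord_adj_in] coord_lin(3)[OF i])
  qed simp
qed

lemma smap_extend_coord:
  assumes A: "bounded_op D A" and f: "f \<in> X"
  shows "smap (extend A) (smap (coord 0) f) = smap (coord 0) (smap A f)"
  by (rule seq2_eqI)
    (simp add: entry_smap_UNIV[OF bounded_op_extend[OF A]] entry_smap[OF norm_coord f]
      entry_smap[OF norm_coord smap_in[OF A f]] entry_smap_op[OF A f] extend_def coord_adj_coord seqs_inD[OF f])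

lemma bilateral_restricts_to_pencil:
  assumes A: "bounded_op D A" and B: "bounded_op D B" and f: "f \<in> X"
  shows "smap (extend A) (spread (smap (coord 0) f)) + smap (extend B) (permute bi_pred (spread (smap (coord 0) f)))
    = spread (smap (coord 0) (pencil A B f))"
proof -
  note iso = isometric_embeddingD(1)[OF isometric_smap[OF isometric_coord hilbert_D]]
  obtain b where b: "\<And>x. x \<in> D \<Longrightarrow> norm (B x) \<le> b * norm x" using bounded_opE[OF B] by metis
  have "shift (smap (coord 0) f) = smap (coord 0) (shift f)"
    by (rule shift_smap[OF isometric_embeddingD(1)[OF isometric_coord] csubspace_D norm_coord f, symmetric])
  moreover have "smap B (shift f) = shift (smap B f)"
    by (rule shift_smap[OF bounded_op_clinear[OF B] csubspace_D b f])
  ultimately have "smap (extend B) (shift (smap (coord 0) f)) = smap (coord 0) (shift (smap B f))"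
    by (simp add: smap_extend_coord[OF B shift_in[OF f]])
  then show ?thesis
    using clinear_onD(2)[OF iso smap_in[OF A f] shift_in[OF smap_in[OF B f]], of 0]
    by (simp add: spread_add smap_spread permute_spread bounded_op_extend A B smap_extend_coord[OF A f] pencil_def)
qed

text \<open>The three operators are the restrictions of the bilateral model to the sequences that vanish at
  negative integers and have entries in \<open>1 \<otimes> D\<close>.\<close>

lemma E_isometry_pencil:
  assumes A: "bounded_op D A1" "bounded_op D A2"
    and comm: "\<And>x. x \<in> D \<Longrightarrow> A1 (A2 x) = A2 (A1 x)"
    and commutators: "\<And>x. x \<in> D \<Longrightarrow> commutator (cadj D A1) A1 x = commutator (cadj D A2) A2 x"
    and num: "\<And>x. x \<in> D \<Longrightarrow> cmod (cinner (A1 x) x) + cmod (cinner (A2 x) x) \<le> (norm x)\<^sup>2"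
    and Q1: "\<And>k. k \<in> K \<Longrightarrow> Q1 k = synth (pencil (cadj D A1) A2 (analysis k))"
    and Q2: "\<And>k. k \<in> K \<Longrightarrow> Q2 k = synth (pencil (cadj D A2) A1 (analysis k))"
    and V: "\<And>k. k \<in> K \<Longrightarrow> V k = synth (shift (analysis k))"
  shows "E_isometry K Q1 Q2 V"
  unfolding E_isometry_def
proof (intro conjI exI)
  note A' = bounded_op_cadj[OF hilbert_D A(1)] bounded_op_cadj[OF hilbert_D A(2)]
  show "bounded_op K Q1" by (rule bounded_op_transported[OF bounded_op_pencil[OF A'(1) A(2)] Q1])
  show "bounded_op K Q2" by (rule bounded_op_transported[OF bounded_op_pencil[OF A'(2) A(1)] Q2])
  show "bounded_op K V" by (rule bounded_op_transported[OF bounded_op_shift[OF csubspace_D] V])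
  let ?J = "\<lambda>k. spread (smap (coord 0) (analysis k))"
  have "isometric_embedding X UNIV (smap (coord 0))"
    using isometric_smap[OF isometric_coord[of 0] hilbert_D] by (simp add: isometric_embedding_def clinear_on_def)
  from isometric_embedding_compose[OF isometric_embedding_compose[OF isometric_analysis this] isometric_spread]
  show "isometric_embedding K UNIV ?J" .
  let ?S = "permute bi_pred :: 'k seq2 \<Rightarrow> _"
  let ?b = extend and ?A1' = "cadj D A1" and ?A2' = "cadj D A2"
  show "E_unitary (\<lambda>f. smap (?b ?A1') f + smap (?b A2) (?S f)) (\<lambda>f. smap (?b ?A2') f + smap (?b A1) (?S f)) ?S"
  proof (rule bilateral_E_unitary)
    show "bounded_op UNIV (?b A1)" "bounded_op UNIV (?b ?A1')" "bounded_op UNIV (?b A2)" "bounded_op UNIV (?b ?A2')"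
      by (rule bounded_op_extend[OF A(1)] bounded_op_extend[OF A(2)] bounded_op_extend[OF A'(1)] bounded_op_extend[OF A'(2)])+
    show "cinner (?b A1 x) y = cinner x (?b ?A1' y)" "cinner (?b A2 x) y = cinner x (?b ?A2' y)" for x y
      by (rule extend_adj[OF A(1)], rule extend_adj[OF A(2)])
    show "?b A1 (?b A2 x) = ?b A2 (?b A1 x)" for x
      by (simp add: extend_compose A comm coord_adj_in)
    show "?b ?A1' (?b A1 x) - ?b A1 (?b ?A1' x) = ?b ?A2' (?b A2 x) - ?b A2 (?b ?A2' x)" for x
    proof -
      let ?x = "coord_adj x"
      have in_D: "?A1' (A1 ?x) \<in> D" "A1 (?A1' ?x) \<in> D" "?A2' (A2 ?x) \<in> D" "A2 (?A2' ?x) \<in> D"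
        by (intro bounded_op_closed[OF A(1)] bounded_op_closed[OF A(2)]
            bounded_op_closed[OF A'(1)] bounded_op_closed[OF A'(2)] coord_adj_in)+
      note d = clinear_on_diff[OF isometric_embeddingD(1)[OF isometric_coord] csubspace_D, symmetric]
      show ?thesis
        using commutators[OF coord_adj_in, of x]
        by (simp add: extend_compose A A' d[OF in_D(1,2)] d[OF in_D(3,4)] commutator_def)
    qed
    show "cmod (cinner (?b A1 x) x) + cmod (cinner (?b A2 x) x) \<le> (norm x)\<^sup>2" for x
      unfolding cinner_extend[OF A(1)] cinner_extend[OF A(2)]
      by (rule order_trans[OF num[OF coord_adj_in] power_mono[OF coord_adj_norm norm_ge_zero]])
  qed
  show "\<forall>k\<in>K. smap (?b ?A1') (?J k) + smap (?b A2) (?S (?J k)) = ?J (Q1 k) \<and>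
      smap (?b ?A2') (?J k) + smap (?b A1) (?S (?J k)) = ?J (Q2 k) \<and> ?S (?J k) = ?J (V k)"
  proof
    fix k assume k: "k \<in> K"
    have f: "analysis k \<in> X" by (rule analysis_in[OF k])
    have p: "pencil ?A1' A2 (analysis k) \<in> X" "pencil ?A2' A1 (analysis k) \<in> X"
      by (rule bounded_op_closed[OF bounded_op_pencil[OF A'(1) A(2)] f],
          rule bounded_op_closed[OF bounded_op_pencil[OF A'(2) A(1)] f])
    show "smap (?b ?A1') (?J k) + smap (?b A2) (?S (?J k)) = ?J (Q1 k) \<and>
      smap (?b ?A2') (?J k) + smap (?b A1) (?S (?J k)) = ?J (Q2 k) \<and> ?S (?J k) = ?J (V k)"
      unfolding bilateral_restricts_to_pencil[OF A'(1) A(2) f] bilateral_restricts_to_pencil[OF A'(2) A(1) f]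
      by (simp add: f Q1 Q2 V k analysis_synth p shift_in permute_spread
          shift_smap[OF isometric_embeddingD(1)[OF isometric_coord] csubspace_D norm_coord f])
  qed
qed

end

section \<open>The dilation\<close>

locale pure_pair = fundamental_pair +
  assumes pure: "(\<lambda>n. (S3 ^^ n) h) \<longlonglongrightarrow> 0"
begin

lemma swap_pure: "pure_pair T2 T1 T3 A2 A1"
  using swap_fundamental pure by (simp add: pure_pair_def pure_pair_axioms_def)

definition orbit :: "'a \<Rightarrow> 'a seq2" where "orbit h = Abs_seq2 (\<lambda>n. D ((S3 ^^ n) h))"

text \<open>\<open>\<parallel>D x\<parallel>\<^sup>2 = \<parallel>x\<parallel>\<^sup>2 - \<parallel>S3 x\<parallel>\<^sup>2\<close> makes the sum telescope, and purity kills the limit term.\<close>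

lemma orbit_sums: "(\<lambda>n. (norm (D ((S3 ^^ n) h)))\<^sup>2) sums (norm h)\<^sup>2"
proof -
  have "(\<lambda>n. (norm ((S3 ^^ n) h))\<^sup>2) \<longlonglongrightarrow> 0"
    using tendsto_power[OF tendsto_norm[OF pure[of h]], of 2] by simp
  from telescope_sums'[OF this] show ?thesis by (simp add: defect.norm_defect_op)
qed

lemma entry_orbit: "entry (orbit h) n = D ((S3 ^^ n) h)"
  unfolding orbit_def by (subst Abs_seq2_inverse) (use sums_summable[OF orbit_sums[of h]] in simp_all)

lemma isometric_orbit: "isometric_embedding UNIV (seqs_in \<D>) orbit"
proof -
  have "norm (orbit h) = norm h" for h
    by (simp add: norm_seq2_def entry_orbit flip: sums_unique[OF orbit_sums])
  moreover have lin: "bounded_op UNIV (\<lambda>h. D ((S3 ^^ n) h))" for n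
    by (rule bounded_op_compose[OF defect.bounded_defect_op bounded_op_funpow[OF defect.bounded]])
  note l = clinear_onD[OF bounded_op_clinear[OF lin]]
  have "orbit (x + y) = orbit x + orbit y" "orbit (c *\<^sub>C x) = c *\<^sub>C orbit x" for x y c
    by (rule seq2_eqI, simp add: entry_orbit entry_simps l)+
  ultimately show ?thesis
    by (simp add: isometric_embedding_def clinear_on_def seqs_in_def entry_orbit defect.defect_op_in)
qed

lemma orbit_in: "orbit h \<in> seqs_in \<D>"
  by (rule clinear_onD(1)[OF isometric_embeddingD(1)[OF isometric_orbit]]) simp

lemma shift_orbit: "cinner (shift f) (orbit g) = cinner f (orbit (S3 g))"
proof -
  have "cinner (shift f) (orbit g) = (\<Sum>n. cinner (entry (shift f) (Suc n)) (entry (orbit g) (Suc n)))"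
    unfolding cinner_seq2_def
    using suminf_split_initial_segment[OF summable_cinner[of "shift f" "orbit g"], of 1] by (simp add: entry_shift)
  then show ?thesis by (simp add: cinner_seq2_def entry_shift entry_orbit funpow_swap1)
qed

text \<open>In coordinates the adjoint of \<open>I \<otimes> A1* + M\<^sub>z \<otimes> A2\<close> acts on \<open>orbit g\<close> entrywise by the right-hand side of
  \<open>defect_intertwines\<close>.\<close>

lemma pencil_orbit:
  assumes f: "f \<in> seqs_in \<D>"
  shows "cinner (pencil (cadj \<D> A1) A2 f) (orbit g) = cinner f (orbit (S1 g))"
proof -
  have fn: "entry f n \<in> \<D>" for n by (rule seqs_inD[OF f])
  note A1' = bounded_op_cadj[OF hilbert_D bounded_A(1)]
  have S_comm: "(S3 ^^ n) (S1 g) = S1 ((S3 ^^ n) g)" for n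
    by (induction n) (simp_all add: cadj_commute[OF bounded(1,3) comp_commute(2)])
  have "cinner (entry (smap (cadj \<D> A1) f) n) (entry (orbit g) n)
      + cinner (entry (smap A2 f) n) (entry (orbit (S3 g)) n) = cinner (entry f n) (entry (orbit (S1 g)) n)" for n
  proof -
    let ?x = "(S3 ^^ n) g"
    have "cinner (cadj \<D> A1 (entry f n)) (D ?x) = cinner (entry f n) (A1 (D ?x))"
      by (rule cadj_right[OF hilbert_D bounded_A(1) defect.defect_op_in, symmetric])
    moreover have "cinner (A2 (entry f n)) (D (S3 ?x)) = cinner (entry f n) (cadj \<D> A2 (D (S3 ?x)))"
      by (rule cadj[OF hilbert_D bounded_A(2) fn])
    ultimately show ?thesis
      by (simp add: entry_smap_op[OF A1' f] entry_smap_op[OF bounded_A(2) f] entry_orbit S_comm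
          defect_intertwines cinner_add_right funpow_swap1)
  qed
  then have "cinner (smap (cadj \<D> A1) f) (orbit g) + cinner (smap A2 f) (orbit (S3 g)) = cinner f (orbit (S1 g))"
    by (simp add: cinner_seq2_def suminf_add summable_cinner)
  then show ?thesis by (simp add: pencil_def cinner_add_left shift_orbit)
qed

end

lemma intertwining_funpow:
  assumes "\<And>k. k \<in> K \<Longrightarrow> Q k \<in> K" "\<And>k g. k \<in> K \<Longrightarrow> cinner (Q k) (J g) = cinner k (J (S g))" "k \<in> K"
  shows "(Q ^^ m) k \<in> K \<and> cinner ((Q ^^ m) k) (J g) = cinner k (J ((S ^^ m) g))"
proof (induction m arbitrary: g)
  case (Suc m)
  have "(S ^^ Suc m) g = (S ^^ m) (S g)" by (simp add: funpow_swap1)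
  then show ?case using Suc.IH[of "S g"] assms(1,2) by simp
qed (simp add: assms(3))

locale hardy_dilation = pure_pair T1 T2 T3 A1 A2 + tensor: hardy_tensor "defect_space (cadj UNIV T3)" K t
  for T1 T2 T3 A1 A2 :: "'h::chilbert_space \<Rightarrow> 'h" and K :: "'k::chilbert_space set" and t +
  fixes Q1 Q2 V :: "'k \<Rightarrow> 'k"
  assumes Q1: "k \<in> K \<Longrightarrow> Q1 k = tensor.synth (pencil (cadj \<D> A1) A2 (tensor.analysis k))"
    and Q2: "k \<in> K \<Longrightarrow> Q2 k = tensor.synth (pencil (cadj \<D> A2) A1 (tensor.analysis k))"
    and V: "k \<in> K \<Longrightarrow> V k = tensor.synth (shift (tensor.analysis k))"
begin

lemma bounded_Q1: "bounded_op K Q1"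
  by (rule tensor.bounded_op_transported[OF tensor.bounded_op_pencil[OF bounded_op_cadj[OF hilbert_D bounded_A(1)] bounded_A(2)] Q1])

lemma bounded_Q2: "bounded_op K Q2"
  by (rule tensor.bounded_op_transported[OF tensor.bounded_op_pencil[OF bounded_op_cadj[OF hilbert_D bounded_A(2)] bounded_A(1)] Q2])

lemma bounded_V: "bounded_op K V"
  by (rule tensor.bounded_op_transported[OF bounded_op_shift[OF csubspace_D] V])

definition emb :: "'h \<Rightarrow> 'k" where "emb h = tensor.synth (orbit h)"

lemma isometric_emb: "isometric_embedding UNIV K emb"
  unfolding emb_def[abs_def] by (rule isometric_embedding_compose[OF isometric_orbit tensor.isometric_synth])

lemma emb_in: "emb h \<in> K"
  by (rule clinear_onD(1)[OF isometric_embeddingD(1)[OF isometric_emb]]) simp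

lemma cinner_synth_emb:
  assumes S: "bounded_op (seqs_in \<D>) S" and Q: "\<And>k. k \<in> K \<Longrightarrow> Q k = tensor.synth (S (tensor.analysis k))"
    and orb: "\<And>f. f \<in> seqs_in \<D> \<Longrightarrow> cinner (S f) (orbit g) = cinner f (orbit g')" and k: "k \<in> K"
  shows "cinner (Q k) (emb g) = cinner k (emb g')"
proof -
  have f: "tensor.analysis k \<in> seqs_in \<D>" by (rule tensor.analysis_in[OF k])
  have "cinner (Q k) (emb g) = cinner (tensor.analysis k) (orbit g')"
    by (simp add: Q[OF k] emb_def tensor.synth_cinner bounded_op_closed[OF S f] orbit_in orb[OF f])
  also have "\<dots> = cinner (tensor.synth (tensor.analysis k)) (emb g')"
    by (simp add: emb_def tensor.synth_cinner f orbit_in)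
  finally show ?thesis by (simp add: tensor.synth_analysis[OF k])
qed

lemma Q1_emb: "k \<in> K \<Longrightarrow> cinner (Q1 k) (emb g) = cinner k (emb (S1 g))"
  by (rule cinner_synth_emb[OF tensor.bounded_op_pencil[OF bounded_op_cadj[OF hilbert_D bounded_A(1)] bounded_A(2)] Q1 pencil_orbit])

lemma Q2_emb: "k \<in> K \<Longrightarrow> cinner (Q2 k) (emb g) = cinner k (emb (S2 g))"
proof (rule cinner_synth_emb[OF tensor.bounded_op_pencil[OF bounded_op_cadj[OF hilbert_D bounded_A(2)] bounded_A(1)] Q2])
  have "pure_pair.orbit T3 = orbit"
    by (simp add: fun_eq_iff pure_pair.orbit_def[OF swap_pure] orbit_def)
  then show "cinner (pencil (cadj \<D> A2) A1 f) (orbit g) = cinner f (orbit (S2 g))" if "f \<in> seqs_in \<D>" for f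
    using pure_pair.pencil_orbit[OF swap_pure that] by simp
qed

lemma V_emb: "k \<in> K \<Longrightarrow> cinner (V k) (emb g) = cinner k (emb (S3 g))"
  by (rule cinner_synth_emb[OF bounded_op_shift[OF csubspace_D] V shift_orbit])

text \<open>The adjoints of the three operators leave the range of \<open>emb\<close> invariant and restrict there to
  the adjoints of the original triple.\<close>

lemma dilates: "dilates_via K Q1 Q2 V T1 T2 T3 emb"
  unfolding dilates_via_def
proof (intro conjI allI isometric_emb)
  fix m1 m2 n h
  let ?S = "\<lambda>g. (S3 ^^ n) ((S2 ^^ m2) ((S1 ^^ m1) g))"
  let ?k = "(Q1 ^^ m1) ((Q2 ^^ m2) ((V ^^ n) (emb h)))"
  let ?w = "(T1 ^^ m1) ((T2 ^^ m2) ((T3 ^^ n) h))"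
  note QK = bounded_op_closed[OF bounded_Q1] bounded_op_closed[OF bounded_Q2] bounded_op_closed[OF bounded_V]
  have I1: "(Q1 ^^ m) k \<in> K \<and> cinner ((Q1 ^^ m) k) (emb g) = cinner k (emb ((S1 ^^ m) g))"
    if "k \<in> K" for m k g
    by (rule intertwining_funpow[of K Q1 emb S1, OF QK(1) Q1_emb that])
  have I2: "(Q2 ^^ m) k \<in> K \<and> cinner ((Q2 ^^ m) k) (emb g) = cinner k (emb ((S2 ^^ m) g))"
    if "k \<in> K" for m k g
    by (rule intertwining_funpow[of K Q2 emb S2, OF QK(2) Q2_emb that])
  have I3: "(V ^^ m) k \<in> K \<and> cinner ((V ^^ m) k) (emb g) = cinner k (emb ((S3 ^^ m) g))"
    if "k \<in> K" for m k g
    by (rule intertwining_funpow[of K V emb S3, OF QK(3) V_emb that])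
  have k: "cinner ?k (emb g) = cinner h (?S g)" for g
  proof -
    have 1: "(V ^^ n) (emb h) \<in> K" using I3[OF emb_in] by (rule conjunct1)
    have 2: "(Q2 ^^ m2) ((V ^^ n) (emb h)) \<in> K" using I2[OF 1] by (rule conjunct1)
    have "cinner ?k (emb g) = cinner (emb h) (emb (?S g))"
      by (simp add: I1[OF 2] I2[OF 1] I3[OF emb_in])
    also have "\<dots> = cinner h (?S g)"
      by (rule isometric_embedding_cinner[OF isometric_emb complex_vector.subspace_UNIV]) simp_all
    finally show ?thesis .
  qed
  have T: "cinner ?w g = cinner h (?S g)" for g
  proof -
    have p: "cinner ((T ^^ m) x) y = cinner x ((S ^^ m) y)" if "\<And>x y. cinner (T x) y = cinner x (S y)"
      for T S :: "'h \<Rightarrow> 'h" and m x y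
      using intertwining_funpow[of UNIV T "\<lambda>x. x" S x m y] that by simp
    show ?thesis by (simp add: p[OF T_adjoint(1)] p[OF T_adjoint(2)] p[OF T_adjoint(3)])
  qed
  show "orth_proj (range emb) ?k = emb ?w"
  proof (rule orth_proj_eq)
    show "csubspace (range emb)"
      by (rule csubspace_image[OF isometric_embeddingD(1)[OF isometric_emb] complex_vector.subspace_UNIV])
    show "emb ?w \<in> range emb" by (rule rangeI)
    fix z assume "z \<in> range emb"
    then obtain g where z: "z = emb g" by (elim rangeE)
    have "cinner (emb ?w) (emb g) = cinner ?w g"
      by (rule isometric_embedding_cinner[OF isometric_emb complex_vector.subspace_UNIV]) simp_all
    then show "cinner (?k - emb ?w) z = 0" by (simp only: z cinner_diff_left k T) simp
  qed
qed

text \<open>\<open>emb h - V (emb (S3 h))\<close> is the constant function with value \<open>D h\<close>; the powers of \<open>V\<close> move such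
  vectors to all powers of \<open>z\<close>.\<close>

lemma emb_diff: "emb h - V (emb (S3 h)) = tensor.coord 0 (D h)"
proof -
  let ?u = "smap (\<lambda>c. c *\<^sub>C D h) (hcoeffs (zpow 0))"
  have "orbit h - shift (orbit (S3 h)) = ?u"
    by (rule seq2_eqI)
      (simp add: entry_simps entry_shift entry_orbit tensor.entry_tensor_coeffs entry_zpow funpow_swap1 split: nat.split)
  then have "tensor.synth ?u = tensor.synth (orbit h) - tensor.synth (shift (orbit (S3 h)))"
    using clinear_on_diff[OF isometric_embeddingD(1)[OF tensor.isometric_synth] tensor.csubspace_X
        orbit_in[of h] tensor.shift_in[OF orbit_in[of "S3 h"]]] by simp
  moreover have "V (emb (S3 h)) = tensor.synth (shift (orbit (S3 h)))"
    unfolding V[OF emb_in] by (simp add: emb_def tensor.analysis_synth orbit_in)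
  ultimately show ?thesis
    by (simp add: emb_def tensor.coord_def tensor.tensor_eq_synth[OF defect.defect_op_in])
qed

lemma V_coord:
  assumes x: "x \<in> \<D>"
  shows "V (tensor.coord n x) = tensor.coord (Suc n) x"
proof -
  have "mult_z (zpow n) = zpow (Suc n)"
    unfolding hcoeffs_inject[symmetric] hcoeffs_mult_z
    by (rule seq2_eqI) (simp add: entry_shift entry_zpow split: nat.split)
  then show ?thesis
    using tensor.coord_lin(1)[OF x, of n]
    by (simp add: V tensor.coord_def tensor.tensor_eq_synth[OF x] tensor.analysis_synth tensor.tensor_coeffs_in[OF x]
        tensor.shift_tensor_coeffs)
qed

lemma V_funpow_emb_diff: "(V ^^ n) (emb h) - (V ^^ Suc n) (emb (S3 h)) = tensor.coord n (D h)"
proof (induction n)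
  case (Suc n)
  have inK: "(V ^^ n) (emb g) \<in> K" for n g
    by (rule bounded_op_closed[OF bounded_op_funpow[OF bounded_V] emb_in])
  have "V ((V ^^ n) (emb h) - (V ^^ Suc n) (emb (S3 h))) = (V ^^ Suc n) (emb h) - (V ^^ Suc (Suc n)) (emb (S3 h))"
    using clinear_on_diff[OF bounded_op_clinear[OF bounded_V] tensor.csubspace_K inK[of n h] inK[of "Suc n" "S3 h"]]
    by simp
  then show ?case unfolding Suc.IH V_coord[OF defect.defect_op_in] by (rule sym)
qed (simp add: emb_diff)

text \<open>The vectors \<open>z\<^sup>n \<otimes> D h\<close> are already differences of vectors \<open>V\<^sup>n (emb h)\<close>.\<close>

lemma minimal: "minimal_via K Q1 Q2 V emb"
proof -
  let ?Z = "{(Q1 ^^ m1) ((Q2 ^^ m2) ((V ^^ n) (emb h))) | m1 m2 n h. True}"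
  let ?L = "closure (cspan ?Z)"
  have L: "csubspace ?L" by (rule csubspace_closure[OF complex_vector.subspace_span])
  have ZL: "z \<in> ?Z \<Longrightarrow> z \<in> ?L" for z
    by (rule subsetD[OF closure_subset complex_vector.span_base])
  have "(V ^^ n) (emb h) \<in> ?Z" for n h
    by (rule CollectI, rule exI[of _ 0], rule exI[of _ 0], rule exI[of _ n], rule exI[of _ h]) simp
  then have VL: "(V ^^ n) (emb h) \<in> ?L" for n h by (rule ZL)
  have range: "tensor.coord n (D h) \<in> ?L" for n h
    unfolding V_funpow_emb_diff[symmetric] by (rule complex_vector.subspace_diff[OF L VL VL])
  have coordL: "tensor.coord n x \<in> ?L" if x: "x \<in> \<D>" for n x
  proof -
    obtain f where f: "\<And>k. f k \<in> range D" "f \<longlonglongrightarrow> x"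
      using x unfolding defect_space_def closure_sequential by blast
    have fD: "f k \<in> \<D>" for k using f(1)[of k] defect.defect_op_in by auto
    have "(\<lambda>k. norm (tensor.coord n (f k) - tensor.coord n x)) \<longlonglongrightarrow> 0"
      unfolding isometric_embedding_dist[OF tensor.isometric_coord csubspace_D fD x]
      by (rule tendsto_norm_zero[OF LIM_zero[OF f(2)]])
    then have lim: "(\<lambda>k. tensor.coord n (f k)) \<longlonglongrightarrow> tensor.coord n x"
      by (rule LIM_zero_cancel[OF tendsto_norm_zero_cancel])
    show ?thesis
    proof (rule closed_sequentially[OF closed_closure _ lim])
      show "tensor.coord n (f k) \<in> ?L" for k using f(1)[of k] range by auto
    qed
  qed
  have "K \<subseteq> ?L"
  proof
    fix k assume k: "k \<in> K"
    have f: "tensor.analysis k \<in> seqs_in \<D>" by (rule tensor.analysis_in[OF k])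
    have "tensor.synth (tensor.analysis k) \<in> ?L"
    proof (rule closed_sequentially[OF closed_closure])
      show "(\<lambda>N. \<Sum>n<N. tensor.coord n (entry (tensor.analysis k) n)) \<longlonglongrightarrow> tensor.synth (tensor.analysis k)"
        using tensor.synth_sums[OF f] by (simp add: sums_def)
      show "(\<Sum>n<N. tensor.coord n (entry (tensor.analysis k) n)) \<in> ?L" for N
        by (rule complex_vector.subspace_sum[OF L coordL[OF seqs_inD[OF f]]])
    qed
    then show "k \<in> ?L" by (simp add: tensor.synth_analysis[OF k])
  qed
  moreover have "?L \<subseteq> K"
  proof (rule closure_minimal)
    have "z \<in> K" if zZ: "z \<in> ?Z" for z
    proof -
      obtain m1 m2 n h where z: "z = (Q1 ^^ m1) ((Q2 ^^ m2) ((V ^^ n) (emb h)))" using zZ by blast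
      show ?thesis
        unfolding z by (rule bounded_op_closed[OF bounded_op_funpow[OF bounded_Q1]
              bounded_op_closed[OF bounded_op_funpow[OF bounded_Q2]
                bounded_op_closed[OF bounded_op_funpow[OF bounded_V] emb_in]]])
    qed
    then show "cspan ?Z \<subseteq> K" by (intro complex_vector.span_minimal tensor.csubspace_K subsetI)
    show "closed K" using tensor.hilbert_K by (simp add: hilbert_def)
  qed
  ultimately show ?thesis unfolding minimal_via_def by (rule subset_antisym)
qed

end

theorem theorem3p2:
  fixes T1 T2 T :: "'h::chilbert_space \<Rightarrow> 'h"
    and A1 A2 :: "'h \<Rightarrow> 'h"
    and D :: "'h set"
    and K :: "'k::chilbert_space set"
    and tens :: "hardy \<Rightarrow> 'h \<Rightarrow> 'k"
    and Q1 Q2 V :: "'k \<Rightarrow> 'k"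
  assumes "pure_E_contraction T1 T2 T"
    and "D = defect_space (cadj UNIV T)"
    and "fundamental_operators (cadj UNIV T1) (cadj UNIV T2) (cadj UNIV T) A1 A2"
    and "\<And>x. x \<in> D \<Longrightarrow> A1 (A2 x) = A2 (A1 x)"
    and "\<And>x. x \<in> D \<Longrightarrow> commutator (cadj D A1) A1 x = commutator (cadj D A2) A2 x"
    and "hilbert_tensor UNIV D K tens"
    and "\<And>x. x \<in> K \<Longrightarrow> Q1 x = tensor_op UNIV D K tens id (cadj D A1) x
                            + tensor_op UNIV D K tens mult_z A2 x"
    and "\<And>x. x \<in> K \<Longrightarrow> Q2 x = tensor_op UNIV D K tens id (cadj D A2) x
                            + tensor_op UNIV D K tens mult_z A1 x"
    and "\<And>x. x \<in> K \<Longrightarrow> V x = tensor_op UNIV D K tens mult_z id x"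
  shows "minimal_pure_E_isometric_dilation K Q1 Q2 V T1 T2 T"
proof -
  have tetra: "tetra_contraction T1 T2 T"
    using assms(1) by (intro E_contraction_tetra_contraction) (simp add: pure_E_contraction_def)
  have "fundamental_pair T1 T2 T A1 A2"
    by (rule fundamental_pair.intro[OF tetra fundamental_pair_axioms.intro[OF assms(3)]])
  moreover have "(\<lambda>n. (cadj UNIV T ^^ n) h) \<longlonglongrightarrow> 0" for h
    using assms(1) by (simp add: pure_E_contraction_def)
  ultimately have "pure_pair T1 T2 T A1 A2" by (intro pure_pair.intro pure_pair_axioms.intro)
  then interpret pair: pure_pair T1 T2 T A1 A2 .
  interpret tensor: hardy_tensor "defect_space (cadj UNIV T)" K tens
    by (rule hardy_tensor.intro[OF pair.hilbert_D]) (use assms(2,6) in simp)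
  note A' = bounded_op_cadj[OF pair.hilbert_D pair.bounded_A(1)] bounded_op_cadj[OF pair.hilbert_D pair.bounded_A(2)]
  interpret hardy_dilation T1 T2 T A1 A2 K tens Q1 Q2 V
  proof
    fix k assume k: "k \<in> K"
    show "Q1 k = tensor.synth (pencil (cadj (defect_space (cadj UNIV T)) A1) A2 (tensor.analysis k))"
      unfolding assms(7)[OF k] assms(2) by (rule tensor.tensor_op_pencil[OF A'(1) pair.bounded_A(2) k])
    show "Q2 k = tensor.synth (pencil (cadj (defect_space (cadj UNIV T)) A2) A1 (tensor.analysis k))"
      unfolding assms(8)[OF k] assms(2) by (rule tensor.tensor_op_pencil[OF A'(2) pair.bounded_A(1) k])
    show "V k = tensor.synth (shift (tensor.analysis k))"
      unfolding assms(9)[OF k] assms(2) by (rule tensor.tensor_op_mult_z_id[OF k])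
  qed
  have "E_isometry K Q1 Q2 V"
  proof (rule tensor.E_isometry_pencil[OF pair.bounded_A _ _ pair.numerical_radius_bound Q1 Q2 V])
    show "A1 (A2 x) = A2 (A1 x)" if "x \<in> defect_space (cadj UNIV T)" for x
      using assms(4) that by (simp add: assms(2))
    show "commutator (cadj (defect_space (cadj UNIV T)) A1) A1 x
        = commutator (cadj (defect_space (cadj UNIV T)) A2) A2 x" if "x \<in> defect_space (cadj UNIV T)" for x
      using assms(5) that unfolding assms(2) .
  qed
  moreover have "pure_isometry K V" by (rule tensor.pure_isometry_shift[OF V])
  ultimately show ?thesis
    unfolding minimal_pure_E_isometric_dilation_def pure_E_isometry_def using dilates minimal by blast
qed

end
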